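(* Let $T$ be a $d$-dimensional Calderón–Zygmund operator with an $\omega$-Dini kernel. Let $f\in L^1_c(\mathbb{R}^d)$ and let $b_1,b_2$ be such that $b_1,b_2,b_1b_2,b_1f,b_2f,b_1b_2f\in L^1_{loc}(\mathbb{R}^d)$. Then there exists a $\gamma$-sparse collection $\mathcal S$ of cubes in $\mathbb{R}^d$, with $\gamma\in(0,1)$ depending only on $d$, such that for almost every $x$ $$|C_bTf(x)|\le C_{T,d}\sum_{i=1}^4 S_if(x),$$ where, writing $\langle g\rangle_Q=\frac1{|Q|}\int_Qg$, $S_1f=\sum_{Q\in\mathcal S}|b_1-\langle b_1\rangle_Q||b_2-\langle b_2\rangle_Q|\langle|f|\rangle_Q1_Q$, $S_2f=\sum_{Q\in\mathcal S}|b_2-\langle b_2\rangle_Q|\langle|b_1-\langle b_1\rangle_Q||f|\rangle_Q1_Q$, $S_3f=\sum_{Q\in\mathcal S}|b_1-\langle b_1\rangle_Q|\langle|b_2-\langle b_2\rangle_Q||f|\rangle_Q1_Q$, $S_4f=\sum_{Q\in\mathcal S}\langle|b_1-\langle b_1\rangle_Q||b_2-\langle b_2\rangle_Q||f|\rangle_Q1_Q$, and $C_{T,d}$ depends only on $T$ and $d$.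
   Context: A $d$-dimensional Calderón–Zygmund operator with an $\omega$-Dini kernel is an operator $T$ bounded on $L^2(\mathbb{R}^d)$ with $Tf(x)=\int K(x,y)f(y)\,dy$ for $x\notin\operatorname{supp}f$, where $K$ is defined off the diagonal, $|K(x,y)|\le C|x-y|^{-d}$, and $|K(x,y)-K(x',y)|+|K(y,x)-K(y,x')|\le \frac{C'}{|x-y|^d}\omega\big(\frac{|x-x'|}{|x-y|}\big)$ whenever $|x-x'|\le\frac12|x-y|$; here $\omega:[0,1]\to[0,\infty)$ is continuous, increasing, subadditive, $\omega(0)=0$ and $\int_0^1\omega(t)\frac{dt}{t}<\infty$. The commutator is $C_bT=[b_2,[b_1,T]]$ with $[A,B]=AB-BA$, $b_i$ acting by pointwise multiplication. A collection $\mathcal S$ of cubes is $\gamma$-sparse if there are sets $E_Q\subset Q$, $Q\in\mathcal S$, pairwise disjoint, with $|E_Q|>\gamma|Q|$. *)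

theory Defs
  imports "HOL-Analysis.Analysis"
begin

definition L2 :: "('a::euclidean_space \<Rightarrow> complex) \<Rightarrow> bool" where
  "L2 f \<longleftrightarrow> f \<in> borel_measurable lebesgue \<and> integrable lebesgue (\<lambda>x. (norm (f x))\<^sup>2)"

definition L2norm :: "('a::euclidean_space \<Rightarrow> complex) \<Rightarrow> real" where
  "L2norm f = sqrt (LINT x|lebesgue. (norm (f x))\<^sup>2)"

definition loc_int :: "('a::euclidean_space \<Rightarrow> complex) \<Rightarrow> bool" where
  "loc_int g \<longleftrightarrow> g \<in> borel_measurable lebesgue \<and>
     (\<forall>K. compact K \<longrightarrow> set_integrable lebesgue K g)"

definition L1c :: "('a::euclidean_space \<Rightarrow> complex) \<Rightarrow> bool" where
  "L1c f \<longleftrightarrow> integrable lebesgue f \<and>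
     (\<exists>S. compact S \<and> (AE x in lebesgue. x \<notin> S \<longrightarrow> f x = 0))"

definition dini_modulus :: "(real \<Rightarrow> real) \<Rightarrow> bool" where
  "dini_modulus \<omega> \<longleftrightarrow> continuous_on {0..1} \<omega> \<and> mono_on {0..1} \<omega>
     \<and> (\<forall>t\<in>{0..1}. 0 \<le> \<omega> t)
     \<and> (\<forall>s t. 0 \<le> s \<longrightarrow> 0 \<le> t \<longrightarrow> s + t \<le> 1 \<longrightarrow> \<omega> (s + t) \<le> \<omega> s + \<omega> t)
     \<and> \<omega> 0 = 0
     \<and> (\<lambda>t. \<omega> t / t) integrable_on {0..1}"

definition CZ_omega_Dini ::
  "(('a::euclidean_space \<Rightarrow> complex) \<Rightarrow> 'a \<Rightarrow> complex) \<Rightarrow> ('a \<Rightarrow> 'a \<Rightarrow> complex)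
     \<Rightarrow> (real \<Rightarrow> real) \<Rightarrow> bool" where
  "CZ_omega_Dini T K \<omega> \<longleftrightarrow> dini_modulus \<omega>
   \<and> (\<forall>f g c. L2 f \<longrightarrow> L2 g \<longrightarrow>
        (AE x in lebesgue. T (\<lambda>y. f y + c * g y) x = T f x + c * T g x))
   \<and> (\<exists>A. \<forall>f. L2 f \<longrightarrow> L2 (T f) \<and> L2norm (T f) \<le> A * L2norm f)
   \<and> (\<exists>C. \<forall>x y. x \<noteq> y \<longrightarrow> norm (K x y) \<le> C / dist x y ^ DIM('a))
   \<and> (\<exists>C'. \<forall>x x' y. x \<noteq> y \<longrightarrow> dist x x' \<le> dist x y / 2 \<longrightarrow>
        norm (K x y - K x' y) + norm (K y x - K y x')
          \<le> C' / dist x y ^ DIM('a) * \<omega> (dist x x' / dist x y))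
   \<and> (\<forall>f S. L2 f \<longrightarrow> closed S \<longrightarrow> (\<forall>y. y \<notin> S \<longrightarrow> f y = 0) \<longrightarrow>
        (AE x in lebesgue. x \<notin> S \<longrightarrow> T f x = (LINT y|lebesgue. K x y * f y)))"

text \<open>Convention: T acts on L^1 through its (weak type (1,1)) continuous extension,
  i.e. for f in L^1, T f is the limit in measure of T f_k for any f_k in
  L^1 \<inter> L^2 converging to f in L^1.\<close>
definition L1_extension :: "(('a::euclidean_space \<Rightarrow> complex) \<Rightarrow> 'a \<Rightarrow> complex) \<Rightarrow> bool" where
  "L1_extension T \<longleftrightarrow> (\<forall>f. integrable lebesgue f \<longrightarrow>
      T f \<in> borel_measurable lebesgue \<and>
      (\<forall>fk. (\<forall>k. integrable lebesgue (fk k) \<and> L2 (fk k)) \<longrightarrow>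
          (\<lambda>k. LINT x|lebesgue. norm (fk k x - f x)) \<longlonglongrightarrow> 0 \<longrightarrow>
          (\<forall>\<epsilon>>0. (\<lambda>k. emeasure lebesgue {x. norm (T (fk k) x - T f x) > \<epsilon>}) \<longlonglongrightarrow> 0)))"

definition mult_comm ::
  "('a \<Rightarrow> complex) \<Rightarrow> (('a \<Rightarrow> complex) \<Rightarrow> 'a \<Rightarrow> complex) \<Rightarrow> ('a \<Rightarrow> complex) \<Rightarrow> 'a \<Rightarrow> complex" where
  "mult_comm b S = (\<lambda>g x. b x * S g x - S (\<lambda>y. b y * g y) x)"

definition is_cube :: "'a::euclidean_space set \<Rightarrow> bool" where
  "is_cube Q \<longleftrightarrow> (\<exists>a l. l > 0 \<and> Q = cbox a (a + l *\<^sub>R One))"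

definition sparse :: "real \<Rightarrow> 'a::euclidean_space set set \<Rightarrow> bool" where
  "sparse \<gamma> \<S> \<longleftrightarrow> (\<exists>E. (\<forall>Q\<in>\<S>. E Q \<subseteq> Q \<and> E Q \<in> sets lebesgue
        \<and> measure lebesgue (E Q) > \<gamma> * measure lebesgue Q)
     \<and> (\<forall>Q\<in>\<S>. \<forall>Q'\<in>\<S>. Q \<noteq> Q' \<longrightarrow> E Q \<inter> E Q' = {}))"

definition avg :: "'a::euclidean_space set \<Rightarrow> ('a \<Rightarrow> 'b::{banach,second_countable_topology}) \<Rightarrow> 'b" where
  "avg Q g = (1 / measure lebesgue Q) *\<^sub>R (LINT x:Q|lebesgue. g x)"

text \<open>The four sparse operators, valued in ennreal (sums over the family may be infinite).\<close>
definition S1 :: "'a::euclidean_space set set \<Rightarrow> ('a \<Rightarrow> complex) \<Rightarrow> ('a \<Rightarrow> complex) \<Rightarrow> ('a \<Rightarrow> complex) \<Rightarrow> 'a \<Rightarrow> ennreal" where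
  "S1 \<S> b1 b2 f x = infsum (\<lambda>Q. ennreal (norm (b1 x - avg Q b1) * norm (b2 x - avg Q b2)
       * avg Q (\<lambda>y. norm (f y)) * indicator Q x)) \<S>"

definition S2 :: "'a::euclidean_space set set \<Rightarrow> ('a \<Rightarrow> complex) \<Rightarrow> ('a \<Rightarrow> complex) \<Rightarrow> ('a \<Rightarrow> complex) \<Rightarrow> 'a \<Rightarrow> ennreal" where
  "S2 \<S> b1 b2 f x = infsum (\<lambda>Q. ennreal (norm (b2 x - avg Q b2)
       * avg Q (\<lambda>y. norm (b1 y - avg Q b1) * norm (f y)) * indicator Q x)) \<S>"

definition S3 :: "'a::euclidean_space set set \<Rightarrow> ('a \<Rightarrow> complex) \<Rightarrow> ('a \<Rightarrow> complex) \<Rightarrow> ('a \<Rightarrow> complex) \<Rightarrow> 'a \<Rightarrow> ennreal" where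
  "S3 \<S> b1 b2 f x = infsum (\<lambda>Q. ennreal (norm (b1 x - avg Q b1)
       * avg Q (\<lambda>y. norm (b2 y - avg Q b2) * norm (f y)) * indicator Q x)) \<S>"

definition S4 :: "'a::euclidean_space set set \<Rightarrow> ('a \<Rightarrow> complex) \<Rightarrow> ('a \<Rightarrow> complex) \<Rightarrow> ('a \<Rightarrow> complex) \<Rightarrow> 'a \<Rightarrow> ennreal" where
  "S4 \<S> b1 b2 f x = infsum (\<lambda>Q. ennreal (
       avg Q (\<lambda>y. norm (b1 y - avg Q b1) * norm (b2 y - avg Q b2) * norm (f y)) * indicator Q x)) \<S>"

end

theory Submission
  imports Defs
begin

text \<open>
  Write \<open>d\<close> for the dimension. For centred symbols, \<open>C\<^sub>bT f\<close> is a combination of \<open>T\<close> applied to \<open>f\<close>,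
  \<open>(b1 - c1) f\<close>, \<open>(b2 - c2) f\<close> and \<open>(b1 - c1) (b2 - c2) f\<close>, and this holds for all constants \<open>c1\<close>, \<open>c2\<close>.
  Given a cube \<open>q\<close>, with \<open>c1\<close>, \<open>c2\<close> the averages over its dilate \<open>q*\<close>, one stops at the maximal dyadic
  subcubes \<open>p\<close> that meet, in a fixed proportion, the set where \<open>T\<close> of one of the four functions is large, or on
  whose dilate \<open>p*\<close> one of these functions has a large average. By the weak type (1,1) bound for \<open>T\<close> and the
  Vitali covering lemma these cubes fill at most half of \<open>q\<close>. Off the stopping cubes the four values of \<open>T\<close> are
  controlled by averages over \<open>q*\<close>. On a stopping cube \<open>p\<close> the part of \<open>f\<close> in \<open>q* - p*\<close> produces functions
  that oscillate little on \<open>p\<close> by the Dini condition and are small at some point of \<open>p\<close>, so they obey the same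
  bound; the part in \<open>p*\<close> is treated by iteration. Since only oscillations are estimated, no maximal truncation
  of \<open>T\<close> is needed (the method of Lerner and Ombrosi). Far away from the support of \<open>f\<close> the size of the
  kernel suffices.
\<close>

section \<open>Half-open cubes, dyadic grids and stopping cubes\<close>

text \<open>Three facts shape the formal proof. \<open>T\<close> is given on L2 and extended to L1
  only through limits in measure, whereas the products of \<open>f\<close> with \<open>b1\<close>
  and \<open>b2\<close> are merely integrable; so linearity and the kernel formula have to be
  carried over to L1, and they hold almost everywhere only. For this reason every family of cubes is
  kept countable, and \<open>T\<close> is applied to finite sums alone. Next, the recursion is never
  summed as a series: the stopping cubes halve the measure in each generation, so almost every point
  leaves the tree after finitely many steps, and the domination there is a finite sum. Finally, two
  kinds of cubes occur. Partitions use half-open cubes, which make dyadic cells disjoint; averages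
  and the sparse family use the closed dilates. The disjoint sets of the tree live in the former,
  and the ratio of the volumes, \<open>(4 * d + 1) ^ d\<close>, is the source of
  \<open>\<gamma>\<close>. A tree covers a single cube around the support; a sequence of concentric
  cubes, growing by the factor \<open>4 * d + 1\<close>, takes care of the remaining space.\<close>

declare emeasure_completion [simp del] measure_completion [simp del]

abbreviation L1norm :: "('a::euclidean_space \<Rightarrow> complex) \<Rightarrow> real" where
  "L1norm f \<equiv> LINT x|lebesgue. norm (f x)"

abbreviation vol :: "'a::euclidean_space \<times> real \<Rightarrow> real" where
  "vol q \<equiv> snd q ^ DIM('a)"

text \<open>A cube is encoded as the pair of its lower corner and its side length.\<close>
definition hcube :: "'a::euclidean_space \<times> real \<Rightarrow> 'a set" where
  "hcube q = {x. \<forall>i\<in>Basis. fst q \<bullet> i \<le> x \<bullet> i \<and> x \<bullet> i < fst q \<bullet> i + snd q}"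

text \<open>The dilate of a cube by the factor \<open>4 d + 1\<close>. It is large enough that the Dini condition applies to
  any two points of the cube and any point outside the dilate.\<close>
definition star :: "'a::euclidean_space \<times> real \<Rightarrow> 'a set" where
  "star q = cbox (fst q - (2 * real DIM('a) * snd q) *\<^sub>R One) (fst q + ((2 * real DIM('a) + 1) * snd q) *\<^sub>R One)"

text \<open>The cell of generation \<open>n\<close> that contains \<open>x\<close>, in the dyadic grid generated by \<open>q\<close>.\<close>
definition dcube :: "'a::euclidean_space \<times> real \<Rightarrow> nat \<Rightarrow> 'a \<Rightarrow> 'a \<times> real" where
  "dcube q n x = ((\<Sum>i\<in>Basis. (fst q \<bullet> i + (snd q / 2^n) * of_int \<lfloor>(x \<bullet> i - fst q \<bullet> i) / (snd q / 2^n)\<rfloor>) *\<^sub>R i), snd q / 2^n)"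

section \<open>Dyadic cells as level sets of floor functions\<close>

lemma snd_dcube [simp]: "snd (dcube q n x) = snd q / 2^n"
  by (simp add: dcube_def)

lemma fst_dcube_inner:
  "i \<in> Basis \<Longrightarrow> fst (dcube q n x) \<bullet> i = fst q \<bullet> i + (snd q / 2^n) * of_int \<lfloor>(x \<bullet> i - fst q \<bullet> i) / (snd q / 2^n)\<rfloor>"
  by (simp add: dcube_def)

text \<open>Half-open intervals of length \<open>s\<close> are the level sets of a floor function.
  Membership in a cell thus becomes an equation between integers, and nesting and disjointness of
  cells become integer arithmetic.\<close>

lemma cube_cell_iff:
  fixes s t a :: real
  assumes "0 < s"
  shows "(a + s * of_int k \<le> t \<and> t < a + s * of_int k + s) \<longleftrightarrow> \<lfloor>(t - a) / s\<rfloor> = k"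
proof -
  have "(a + s * of_int k \<le> t \<and> t < a + s * of_int k + s) \<longleftrightarrow> (of_int k \<le> (t - a) / s \<and> (t - a) / s < of_int k + 1)"
    using assms by (simp add: field_simps)
  also have "\<dots> \<longleftrightarrow> \<lfloor>(t - a) / s\<rfloor> = k"
    by (auto simp: floor_eq_iff)
  finally show ?thesis .
qed

lemma mem_hcube_dcube_iff:
  assumes "0 < snd q"
  shows "y \<in> hcube (dcube q n x) \<longleftrightarrow>
    (\<forall>i\<in>Basis. \<lfloor>(y \<bullet> i - fst q \<bullet> i) / (snd q / 2^n)\<rfloor> = \<lfloor>(x \<bullet> i - fst q \<bullet> i) / (snd q / 2^n)\<rfloor>)"
proof -
  have s: "0 < snd q / 2^n" using assms by simp
  show ?thesis
    unfolding hcube_def mem_Collect_eq snd_dcube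
    by (intro ball_cong refl) (simp only: fst_dcube_inner cube_cell_iff[OF s])
qed

lemma mem_hcube_dcube: "0 < snd q \<Longrightarrow> x \<in> hcube (dcube q n x)"
  by (simp add: mem_hcube_dcube_iff)

lemma dcube_eq: "0 < snd q \<Longrightarrow> y \<in> hcube (dcube q n x) \<Longrightarrow> dcube q n y = dcube q n x"
  unfolding mem_hcube_dcube_iff by (simp add: dcube_def del: divide_divide_eq_right)

lemma dcube_0:
  assumes "0 < snd q" "x \<in> hcube q"
  shows "dcube q 0 x = q"
proof -
  have "\<lfloor>(x \<bullet> i - fst q \<bullet> i) / snd q\<rfloor> = 0" if "i \<in> Basis" for i
    using iffD1[OF cube_cell_iff[OF assms(1), of "fst q \<bullet> i" 0 "x \<bullet> i"]] assms(2) that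
    by (simp add: hcube_def del: floor_eq_iff)
  then have "fst (dcube q 0 x) = fst q"
    by (intro euclidean_eqI[where x="fst (dcube q 0 x)"]) (simp add: fst_dcube_inner del: fst_conv)
  then show ?thesis by (simp add: prod_eq_iff)
qed

lemma hcube_dcube_Suc:
  assumes "0 < snd q"
  shows "hcube (dcube q (Suc n) x) \<subseteq> hcube (dcube q n x)"
proof
  fix y assume y: "y \<in> hcube (dcube q (Suc n) x)"
  \<comment> \<open>Doubling the mesh halves the integer index, rounded down, so the index in
    generation \<open>n\<close> is a function of the index in generation
    \<open>Suc n\<close>.\<close>
  have half: "\<lfloor>t / (snd q / 2^n)\<rfloor> = \<lfloor>t / (snd q / 2^Suc n)\<rfloor> div 2" for t :: real
  proof -
    have "t / (snd q / 2^n) = t / (snd q / 2^Suc n) / of_int 2" by simp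
    then show ?thesis using floor_divide_real_eq_div[of 2 "t / (snd q / 2^Suc n)"] by simp
  qed
  show "y \<in> hcube (dcube q n x)"
    using y unfolding mem_hcube_dcube_iff[OF assms] half by metis
qed

lemma hcube_dcube_mono:
  assumes "0 < snd q" "m \<le> n"
  shows "hcube (dcube q n x) \<subseteq> hcube (dcube q m x)"
  using assms(2) by (induction rule: dec_induct) (use hcube_dcube_Suc[OF assms(1)] in blast)+

section \<open>Measures of cubes and of their dilates\<close>

lemma hcube_subset_cbox: "hcube q \<subseteq> cbox (fst q) (fst q + snd q *\<^sub>R One)"
  by (force simp: hcube_def mem_box inner_simps)

lemma box_subset_hcube: "box (fst q) (fst q + snd q *\<^sub>R One) \<subseteq> hcube q"
  by (auto simp: hcube_def mem_box inner_simps intro: less_imp_le)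

lemma hcube_borel [measurable]: "hcube q \<in> sets borel"
  unfolding hcube_def by measurable

lemma hcube_lebesgue [measurable]: "hcube q \<in> sets lebesgue"
  using hcube_borel[of q] sets_completionI_sets[of "hcube q" lborel] by simp

lemma star_lebesgue [measurable]: "star q \<in> sets lebesgue"
  by (simp add: star_def)

lemma emeasure_cbox_cube:
  fixes a :: "'a::euclidean_space"
  assumes "0 \<le> l"
  shows "emeasure lebesgue (cbox a (a + l *\<^sub>R One)) = ennreal (l ^ DIM('a))"
  using assms by (simp add: emeasure_completion emeasure_lborel_cbox_eq inner_simps)

lemma emeasure_hcube:
  fixes q :: "'a::euclidean_space \<times> real"
  assumes "0 \<le> snd q"
  shows "emeasure lebesgue (hcube q) = ennreal (vol q)"
proof (rule antisym)
  show "emeasure lebesgue (hcube q) \<le> ennreal (vol q)"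
    using emeasure_mono[OF hcube_subset_cbox[of q], of lebesgue] by (simp add: emeasure_cbox_cube[OF assms])
  have "ennreal (vol q) = emeasure lebesgue (box (fst q) (fst q + snd q *\<^sub>R One))"
    using assms by (simp add: emeasure_completion emeasure_lborel_box_eq inner_simps)
  also have "\<dots> \<le> emeasure lebesgue (hcube q)"
    by (intro emeasure_mono box_subset_hcube hcube_lebesgue)
  finally show "ennreal (vol q) \<le> emeasure lebesgue (hcube q)" .
qed

lemma measure_hcube:
  fixes q :: "'a::euclidean_space \<times> real"
  shows "0 \<le> snd q \<Longrightarrow> measure lebesgue (hcube q) = vol q"
  by (simp add: measure_def emeasure_hcube)

lemma hcube_lmeasurable [simp]: "0 \<le> snd q \<Longrightarrow> hcube q \<in> lmeasurable"
  by (simp add: fmeasurable_def emeasure_hcube)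

lemma star_eq_cube:
  fixes q :: "'a::euclidean_space \<times> real"
  shows "star q = cbox (fst q - (2 * real DIM('a) * snd q) *\<^sub>R One)
    ((fst q - (2 * real DIM('a) * snd q) *\<^sub>R One) + ((4 * real DIM('a) + 1) * snd q) *\<^sub>R One)"
proof -
  have "((4 * real DIM('a) + 1) * snd q) *\<^sub>R One =
    (2 * real DIM('a) * snd q) *\<^sub>R One + ((2 * real DIM('a) + 1) * snd q) *\<^sub>R (One :: 'a)"
    by (simp add: algebra_simps flip: scaleR_add_left)
  then show ?thesis unfolding star_def by simp
qed

lemma is_cube_star: "0 < snd q \<Longrightarrow> is_cube (star q)"
  unfolding is_cube_def using star_eq_cube[of q]
  by (meson add_nonneg_pos mult_nonneg_nonneg mult_pos_pos of_nat_0_le_iff zero_le_numeral zero_less_one)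

lemma emeasure_star:
  fixes q :: "'a::euclidean_space \<times> real"
  assumes "0 \<le> snd q"
  shows "emeasure lebesgue (star q) = ennreal ((4 * real DIM('a) + 1) ^ DIM('a) * vol q)"
proof -
  have "0 \<le> (4 * real DIM('a) + 1) * snd q" using assms by simp
  from emeasure_cbox_cube[OF this] show ?thesis
    by (subst star_eq_cube) (simp add: power_mult_distrib)
qed

lemma measure_star:
  fixes q :: "'a::euclidean_space \<times> real"
  shows "0 \<le> snd q \<Longrightarrow> measure lebesgue (star q) = (4 * real DIM('a) + 1) ^ DIM('a) * vol q"
  by (simp add: measure_def emeasure_star)

section \<open>Geometry of the dilate\<close>

lemma mem_star_iff:
  fixes q :: "'a::euclidean_space \<times> real"
  shows "x \<in> star q \<longleftrightarrow> (\<forall>i\<in>Basis. fst q \<bullet> i - 2 * real DIM('a) * snd q \<le> x \<bullet> i \<and>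
    x \<bullet> i \<le> fst q \<bullet> i + snd q + 2 * real DIM('a) * snd q)"
  unfolding star_def mem_box by (intro ball_cong refl) (simp add: inner_simps algebra_simps)

lemma mem_interior_star_iff:
  fixes q :: "'a::euclidean_space \<times> real"
  shows "x \<in> interior (star q) \<longleftrightarrow> (\<forall>i\<in>Basis. fst q \<bullet> i - 2 * real DIM('a) * snd q < x \<bullet> i \<and>
    x \<bullet> i < fst q \<bullet> i + snd q + 2 * real DIM('a) * snd q)"
  unfolding star_def interior_cbox mem_box by (intro ball_cong refl) (simp add: inner_simps algebra_simps)

lemma hcube_corner: "0 < snd q \<Longrightarrow> fst q \<in> hcube q"
  by (simp add: hcube_def)

lemma hcube_subset_imp:
  fixes p q :: "'a::euclidean_space \<times> real"
  assumes sub: "hcube p \<subseteq> hcube q" and p: "0 < snd p" and i: "i \<in> Basis"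
  shows "fst q \<bullet> i \<le> fst p \<bullet> i" "fst p \<bullet> i + snd p \<le> fst q \<bullet> i + snd q"
proof -
  show "fst q \<bullet> i \<le> fst p \<bullet> i"
    using sub hcube_corner[OF p] i by (auto simp: hcube_def)
  show "fst p \<bullet> i + snd p \<le> fst q \<bullet> i + snd q"
  \<comment> \<open>The upper face does not belong to the half-open cube, so the bound comes from
    moving from the lower corner in direction \<open>i\<close> and letting \<open>w\<close> approach
    the missing end.\<close>
  proof (rule dense_le_bounded[of "fst p \<bullet> i"])
    show "fst p \<bullet> i < fst p \<bullet> i + snd p" using p by simp
    fix w assume w: "fst p \<bullet> i < w" "w < fst p \<bullet> i + snd p"
    have "fst p + (w - fst p \<bullet> i) *\<^sub>R i \<in> hcube p"
      using w p i by (auto simp: hcube_def inner_simps inner_Basis)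
    then have "fst p + (w - fst p \<bullet> i) *\<^sub>R i \<in> hcube q" using sub by blast
    then show "w \<le> fst q \<bullet> i + snd q"
      using i by (auto simp: hcube_def inner_simps inner_Basis)
  qed
qed

lemma hcube_subset_snd:
  fixes p q :: "'a::euclidean_space \<times> real"
  assumes "hcube p \<subseteq> hcube q" "0 < snd p"
  shows "snd p \<le> snd q"
proof -
  obtain i :: 'a where "i \<in> Basis" using nonempty_Basis by blast
  from hcube_subset_imp[OF assms this] show ?thesis by linarith
qed

text \<open>The margin is proportional to the side length and so shrinks with the cube. This makes
  \<open>star p\<close> a part of \<open>star q\<close> when \<open>f\<close> is split on a stopping
  cube.\<close>

lemma star_mono:
  fixes p q :: "'a::euclidean_space \<times> real"
  assumes "hcube p \<subseteq> hcube q" "0 < snd p"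
  shows "star p \<subseteq> star q"
proof
  have s: "2 * real DIM('a) * snd p \<le> 2 * real DIM('a) * snd q"
    using hcube_subset_snd[OF assms] by (simp add: mult_left_mono)
  fix x assume x: "x \<in> star p"
  show "x \<in> star q"
    unfolding mem_star_iff
  proof (intro ballI)
    fix i :: 'a assume i: "i \<in> Basis"
    have "fst p \<bullet> i - 2 * real DIM('a) * snd p \<le> x \<bullet> i \<and>
        x \<bullet> i \<le> fst p \<bullet> i + snd p + 2 * real DIM('a) * snd p"
      using x i unfolding mem_star_iff by blast
    with hcube_subset_imp[OF assms i] s
    show "fst q \<bullet> i - 2 * real DIM('a) * snd q \<le> x \<bullet> i \<and>
        x \<bullet> i \<le> fst q \<bullet> i + snd q + 2 * real DIM('a) * snd q"
      by linarith
  qed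
qed

text \<open>The kernel formula holds off a closed set. For a function that vanishes on
  \<open>star p\<close> this set is the complement of the interior, and the inclusion makes the
  formula available on all of \<open>hcube p\<close>.\<close>

lemma hcube_subset_interior_star:
  fixes q :: "'a::euclidean_space \<times> real"
  assumes "0 < snd q"
  shows "hcube q \<subseteq> interior (star q)"
proof
  fix x assume x: "x \<in> hcube q"
  have m: "0 < 2 * real DIM('a) * snd q" using assms by simp
  show "x \<in> interior (star q)"
    unfolding mem_interior_star_iff
  proof (intro ballI)
    fix i :: 'a assume i: "i \<in> Basis"
    have "fst q \<bullet> i \<le> x \<bullet> i" "x \<bullet> i < fst q \<bullet> i + snd q" using x i by (auto simp: hcube_def)
    then show "fst q \<bullet> i - 2 * real DIM('a) * snd q < x \<bullet> i \<and>
        x \<bullet> i < fst q \<bullet> i + snd q + 2 * real DIM('a) * snd q"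
      using m by linarith
  qed
qed

lemma hcube_subset_star: "0 < snd q \<Longrightarrow> hcube q \<subseteq> star q"
  using hcube_subset_interior_star[of q] interior_subset by blast

lemma dist_hcube:
  fixes q :: "'a::euclidean_space \<times> real"
  assumes "x \<in> hcube q" "y \<in> hcube q"
  shows "dist x y \<le> DIM('a) * snd q"
proof -
  have "dist x y \<le> (\<Sum>i\<in>Basis. \<bar>(x - y) \<bullet> i\<bar>)"
    unfolding dist_norm by (rule norm_le_l1)
  also have "\<dots> \<le> (\<Sum>i\<in>(Basis::'a set). snd q)"
  proof (rule sum_mono)
    fix i :: 'a assume "i \<in> Basis"
    then show "\<bar>(x - y) \<bullet> i\<bar> \<le> snd q"
      using assms by (force simp: hcube_def inner_simps abs_le_iff)
  qed
  also have "\<dots> = DIM('a) * snd q" by simp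
  finally show ?thesis .
qed

text \<open>The margin of \<open>star q\<close> is twice the diameter bound of
  \<open>dist_hcube\<close>; together the two lemmas give the ratio at most 1/2 that the Dini
  condition asks for.\<close>

lemma dist_hcube_star:
  fixes q :: "'a::euclidean_space \<times> real"
  assumes "x \<in> hcube q" "y \<notin> star q"
  shows "2 * real DIM('a) * snd q \<le> dist x y"
proof -
  obtain i :: 'a where i: "i \<in> Basis" and
    "\<not> (fst q \<bullet> i - 2 * real DIM('a) * snd q \<le> y \<bullet> i \<and> y \<bullet> i \<le> fst q \<bullet> i + snd q + 2 * real DIM('a) * snd q)"
    using assms(2) unfolding mem_star_iff by blast
  moreover have "fst q \<bullet> i \<le> x \<bullet> i" "x \<bullet> i < fst q \<bullet> i + snd q"
    using assms(1) i by (auto simp: hcube_def)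
  ultimately have "2 * real DIM('a) * snd q \<le> \<bar>x \<bullet> i - y \<bullet> i\<bar>"
    by linarith
  also have "\<dots> \<le> dist x y" unfolding dist_norm inner_diff_left[symmetric] by (rule Basis_le_norm[OF i])
  finally show ?thesis .
qed

text \<open>The volume determines the side, and then the corner can be read off. Trees are indexed
  by pairs, the sparse family by sets; injectivity carries the disjoint sets and the sums from one
  to the other.\<close>

lemma inj_on_star:
  "inj_on star {q::'a::euclidean_space \<times> real. 0 < snd q}"
proof (rule inj_onI; clarify)
  fix a b :: 'a and l m :: real
  assume "0 < snd (a, l)" "0 < snd (b, m)" and e: "star (a, l) = star (b, m)"
  then have l: "0 < l" "0 < m" by simp_all
  have "measure lebesgue (star (a, l)) = measure lebesgue (star (b, m))" using e by simp
  then have "l ^ DIM('a) = m ^ DIM('a)" using l by (simp add: measure_star)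
  then have lm: "l = m" using l by (simp add: power_eq_iff_eq_base)
  have ne: "star (a, l) \<noteq> {}" using hcube_subset_star[of "(a,l)"] hcube_corner[of "(a,l)"] l by auto
  have "a - (2 * DIM('a) * l) *\<^sub>R One = b - (2 * DIM('a) * m) *\<^sub>R One"
    using e ne unfolding star_def by (simp add: eq_cbox)
  then show "a = b \<and> l = m" using lm by simp
qed

lemma interior_hcube_nonempty:
  assumes "0 < snd q"
  shows "interior (hcube q) \<noteq> {}"
proof -
  have "box (fst q) (fst q + snd q *\<^sub>R One) \<noteq> {}"
    using assms by (auto simp: box_ne_empty inner_simps)
  moreover have "box (fst q) (fst q + snd q *\<^sub>R One) \<subseteq> interior (hcube q)"
    by (intro interior_maximal box_subset_hcube open_box)
  ultimately show ?thesis by blast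
qed

lemma inj_on_hcube: "inj_on hcube {q::'a::euclidean_space \<times> real. 0 < snd q}"
proof (rule inj_onI)
  fix p q :: "'a \<times> real" assume pq: "p \<in> {q. 0 < snd q}" "q \<in> {q. 0 < snd q}" "hcube p = hcube q"
  then have "star p = star q" using star_mono[of p q] star_mono[of q p] by auto
  then show "p = q" using inj_onD[OF inj_on_star] pq by blast
qed

text \<open>Disjoint sets with nonempty interior form a countable family. Countability is what
  allows exceptional null sets to be united over a family of cubes.\<close>

lemma countable_disjoint_hcubes:
  assumes pos: "\<And>q. q \<in> F \<Longrightarrow> 0 < snd q"
    and dis: "\<And>p q. p \<in> F \<Longrightarrow> q \<in> F \<Longrightarrow> p \<noteq> q \<Longrightarrow> hcube p \<inter> hcube q = {}"
  shows "countable F"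
proof -
  have "countable (hcube ` F)"
  proof (rule countable_disjoint_nonempty_interior_subsets)
    show "pairwise disjnt (hcube ` F)"
      using dis unfolding pairwise_def disjnt_def by blast
    show "\<And>S. \<lbrakk>S \<in> hcube ` F; interior S = {}\<rbrakk> \<Longrightarrow> S = {}"
      using interior_hcube_nonempty pos by blast
  qed
  moreover have "inj_on hcube F" using inj_on_subset[OF inj_on_hcube] pos by blast
  ultimately show ?thesis by (simp add: countable_image_inj_eq)
qed

text \<open>The diameters of the cells around \<open>x\<close> tend to zero. Applied to an open
  superset of an exceptional set, this puts each of its points in a cell on which the superset has
  density one.\<close>

lemma dcube_in_open:
  fixes q :: "'a::euclidean_space \<times> real"
  assumes "0 < snd q" "open U" "x \<in> U"
  obtains n where "hcube (dcube q n x) \<subseteq> U"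
proof -
  obtain e where e: "0 < e" "ball x e \<subseteq> U" using assms openE by blast
  have "(\<lambda>n. real DIM('a) * snd q * (1/2) ^ n) \<longlonglongrightarrow> real DIM('a) * snd q * 0"
    by (intro tendsto_intros LIMSEQ_power_zero) simp
  then have "\<forall>\<^sub>F n in sequentially. real DIM('a) * snd q * (1/2) ^ n < e"
    using e by (auto dest: order_tendstoD)
  then obtain n where n: "real DIM('a) * snd q * (1/2) ^ n < e" by (meson eventually_sequentially order_refl)
  have "hcube (dcube q n x) \<subseteq> ball x e"
  proof
    fix y assume "y \<in> hcube (dcube q n x)"
    then have "dist x y \<le> DIM('a) * (snd q / 2^n)"
      using dist_hcube[OF mem_hcube_dcube[OF assms(1)]] by fastforce
    moreover have "DIM('a) * (snd q / 2^n) = real DIM('a) * snd q * (1/2) ^ n" by (simp add: power_one_over)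
    ultimately show "y \<in> ball x e" using n by simp
  qed
  then show ?thesis using that e by blast
qed

text \<open>The stopping cubes are the maximal dyadic subcubes of \<open>q\<close> with property \<open>S\<close>.\<close>
definition stopping :: "('a::euclidean_space \<times> real \<Rightarrow> bool) \<Rightarrow> 'a \<times> real \<Rightarrow> ('a \<times> real) set" where
  "stopping S q = {dcube q n x | n x. x \<in> hcube q \<and> S (dcube q n x) \<and> (\<forall>m<n. \<not> S (dcube q m x))}"

lemma stopping_subset:
  assumes "0 < snd q" "p \<in> stopping S q"
  shows "hcube p \<subseteq> hcube q" "0 < snd p" "S p"
proof -
  obtain n x where p: "p = dcube q n x" "x \<in> hcube q" "S (dcube q n x)"
    using assms(2) unfolding stopping_def by blast
  have "hcube (dcube q n x) \<subseteq> hcube (dcube q 0 x)"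
    by (rule hcube_dcube_mono[OF assms(1)]) simp
  then show "hcube p \<subseteq> hcube q" using dcube_0[OF assms(1) p(2)] p by simp
qed (use assms in \<open>auto simp: stopping_def\<close>)

lemma stopping_disjoint:
  assumes q: "0 < snd q" and p: "p \<in> stopping S q" "p' \<in> stopping S q" "p \<noteq> p'"
  shows "hcube p \<inter> hcube p' = {}"
proof (rule ccontr)
  assume "hcube p \<inter> hcube p' \<noteq> {}"
  then obtain y where y: "y \<in> hcube p" "y \<in> hcube p'" by blast
  \<comment> \<open>A stopping cube is determined by any of its points \<open>y\<close>: it is the
    cell of \<open>y\<close> in the first generation with property \<open>S\<close>. Two stopping
    cubes that share a point therefore coincide.\<close>
  have *: "\<exists>n. p = dcube q n y \<and> S (dcube q n y) \<and> (\<forall>m<n. \<not> S (dcube q m y))"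
    if p: "p \<in> stopping S q" and y: "y \<in> hcube p" for p
  proof -
    obtain n x where nx: "p = dcube q n x" "S (dcube q n x)" "\<forall>m<n. \<not> S (dcube q m x)"
      using p unfolding stopping_def by blast
    have "dcube q m y = dcube q m x" if "m \<le> n" for m
      using dcube_eq[OF q] hcube_dcube_mono[OF q that, of x] y nx by blast
    then show ?thesis using nx by (intro exI[of _ n]) auto
  qed
  obtain n m where "p = dcube q n y" "S (dcube q n y)" "\<forall>m<n. \<not> S (dcube q m y)"
     "p' = dcube q m y" "S (dcube q m y)" "\<forall>n<m. \<not> S (dcube q n y)"
    using *[OF p(1) y(1)] *[OF p(2) y(2)] by blast
  then show False using p(3) by (metis linorder_neqE_nat)
qed

lemma countable_stopping: "0 < snd q \<Longrightarrow> countable (stopping S q)"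
  using stopping_subset stopping_disjoint by (intro countable_disjoint_hcubes) blast+

lemma stopping_covers:
  assumes "0 < snd q" "x \<in> hcube q" "S (dcube q n x)"
  obtains p where "p \<in> stopping S q" "x \<in> hcube p"
proof
  let ?n = "LEAST n. S (dcube q n x)"
  show "dcube q ?n x \<in> stopping S q"
    unfolding stopping_def using assms LeastI[of "\<lambda>n. S (dcube q n x)"] not_less_Least by blast
  show "x \<in> hcube (dcube q ?n x)" using mem_hcube_dcube[OF assms(1)] .
qed

text \<open>As \<open>q\<close> is not stopping, the generation of \<open>p\<close> is positive. The
  parent provides upper bounds on \<open>p\<close> itself, the earlier ancestors provide bounds at
  all intermediate scales.\<close>

lemma stopping_ancestors:
  assumes "0 < snd q" "\<not> S q" "p \<in> stopping S q"
  obtains n x where "x \<in> hcube q" "p = dcube q (Suc n) x" "\<And>m. m \<le> n \<Longrightarrow> \<not> S (dcube q m x)"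
proof -
  obtain n x where nx: "p = dcube q n x" "x \<in> hcube q" "S (dcube q n x)" "\<forall>m<n. \<not> S (dcube q m x)"
    using assms(3) unfolding stopping_def by blast
  then have "n \<noteq> 0" using assms dcube_0 by (metis)
  then obtain k where "n = Suc k" using not0_implies_Suc by blast
  then show ?thesis using nx that[of x k] by auto
qed

section \<open>Extension of the operator to integrable functions\<close>

text \<open>Cutting by height makes an integrable function bounded, hence square integrable, and
  keeps its zeros in place, so support conditions survive.\<close>

definition trunc :: "('a \<Rightarrow> complex) \<Rightarrow> nat \<Rightarrow> 'a \<Rightarrow> complex" where
  "trunc f k x = (if norm (f x) \<le> real k then f x else 0)"

lemma L2_bounded:
  assumes f: "integrable lebesgue f" and b: "\<And>x. norm (f x) \<le> M"
  shows "L2 f"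
  unfolding L2_def
proof
  show "f \<in> borel_measurable lebesgue" using f by (rule borel_measurable_integrable)
  show "integrable lebesgue (\<lambda>x. (norm (f x))\<^sup>2)"
  proof (rule Bochner_Integration.integrable_bound)
    show "integrable lebesgue (\<lambda>x. M * norm (f x))" using f by simp
    show "AE x in lebesgue. norm ((norm (f x))\<^sup>2) \<le> norm (M * norm (f x))"
      using b by (intro AE_I2) (auto simp: power2_eq_square abs_mult intro!: mult_right_mono intro: order_trans[OF _ abs_ge_self])
  qed (use borel_measurable_integrable[OF f] in measurable)
qed

lemma integrable_trunc:
  assumes f: "integrable lebesgue f"
  shows "integrable lebesgue (trunc f k)"
proof (rule Bochner_Integration.integrable_bound[OF f])
  have [measurable]: "f \<in> borel_measurable lebesgue" using f by (rule borel_measurable_integrable)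
  show "trunc f k \<in> borel_measurable lebesgue" unfolding trunc_def by measurable
qed (simp add: trunc_def)

lemma norm_trunc_le: "norm (trunc f k x) \<le> norm (f x)" "norm (trunc f k x) \<le> real k"
  by (auto simp: trunc_def)

lemma L2_trunc: "integrable lebesgue f \<Longrightarrow> L2 (trunc f k)"
  by (rule L2_bounded[OF integrable_trunc norm_trunc_le(2)])

lemma trunc_tendsto: "(\<lambda>k. trunc f k x) \<longlonglongrightarrow> f x"
proof (rule tendsto_eventually)
  obtain k0 where "norm (f x) \<le> real k0" using real_arch_simple by blast
  then show "\<forall>\<^sub>F k in sequentially. trunc f k x = f x"
    unfolding eventually_sequentially trunc_def by (intro exI[of _ k0]) (auto intro: order_trans)
qed

lemma L1_dominated_tendsto:
  fixes f :: "'a::euclidean_space \<Rightarrow> complex"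
  assumes f: "integrable lebesgue f" and w: "integrable lebesgue w"
    and fk: "\<And>k. integrable lebesgue (fk k)"
    and lim: "\<And>x. (\<lambda>k. fk k x) \<longlonglongrightarrow> f x" and le: "\<And>k x. norm (fk k x) \<le> w x"
  shows "(\<lambda>k. LINT x|lebesgue. norm (fk k x - f x)) \<longlonglongrightarrow> 0"
proof -
  have [measurable]: "f \<in> borel_measurable lebesgue" "\<And>k. fk k \<in> borel_measurable lebesgue"
    using f fk by (auto intro: borel_measurable_integrable)
  have "(\<lambda>k. LINT x|lebesgue. norm (fk k x - f x)) \<longlonglongrightarrow> (LINT x|(lebesgue::'a measure). 0)"
  proof (rule integral_dominated_convergence)
    show "integrable lebesgue (\<lambda>x. w x + norm (f x))" using f w by simp
    show "AE x in lebesgue. (\<lambda>k. norm (fk k x - f x)) \<longlonglongrightarrow> 0"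
      using lim by (intro AE_I2) (simp add: tendsto_norm_zero_iff LIM_zero_iff)
    show "AE x in lebesgue. norm (norm (fk k x - f x)) \<le> w x + norm (f x)" for k
      by (intro AE_I2) (use le[of k] in \<open>auto intro: order_trans[OF norm_triangle_ineq4] add_right_mono\<close>)
  qed simp_all
  then show ?thesis by simp
qed

lemma trunc_L1_tendsto:
  "integrable lebesgue f \<Longrightarrow> (\<lambda>k. LINT x|lebesgue. norm (trunc f k x - f x)) \<longlonglongrightarrow> 0"
  by (rule L1_dominated_tendsto[where w = "\<lambda>x. norm (f x)"])
    (auto intro: integrable_trunc trunc_tendsto norm_trunc_le)

definition cutoff :: "'a set \<Rightarrow> ('a \<Rightarrow> 'b::zero) \<Rightarrow> 'a \<Rightarrow> 'b" where
  "cutoff A f x = (if x \<in> A then f x else 0)"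

lemma cutoff_eq_indicator: "cutoff A f = (\<lambda>x. indicator A x *\<^sub>R f x)" for f :: "'a \<Rightarrow> 'b::real_vector"
  by (auto simp: cutoff_def fun_eq_iff)

lemma norm_cutoff: "norm (cutoff A f x) = cutoff A (\<lambda>x. norm (f x)) x"
  by (simp add: cutoff_def)

lemma integrable_cutoff:
  fixes f :: "'a::euclidean_space \<Rightarrow> 'b::{banach, second_countable_topology}"
  assumes "integrable lebesgue f" "A \<in> sets lebesgue"
  shows "integrable lebesgue (cutoff A f)"
  unfolding cutoff_eq_indicator using integrable_mult_indicator[OF assms(2,1)] .

lemma subsequence_eventually:
  assumes "\<And>n. \<forall>\<^sub>F k in sequentially. P n k"
  obtains r :: "nat \<Rightarrow> nat" where "strict_mono r" "\<And>n. P n (r n)"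
proof -
  have "\<exists>r. \<forall>n. P n (r n) \<and> r n < r (Suc n)"
  proof (rule dependent_nat_choice)
    show "\<exists>x. P 0 x" using assms[of 0] by (rule eventually_happens'[OF sequentially_bot])
    fix x n assume "P n x"
    have "\<forall>\<^sub>F k in sequentially. P (Suc n) k \<and> x < k"
      using assms eventually_gt_at_top by (rule eventually_conj)
    then show "\<exists>y. P (Suc n) y \<and> x < y" by (rule eventually_happens'[OF sequentially_bot])
  qed
  then obtain r where "\<And>n. P n (r n)" "\<And>n. r n < r (Suc n)" by blast
  then show ?thesis using that[of r] strict_mono_Suc_iff[of r] by blast
qed

lemma dist_ratio_le_half:
  fixes x :: "'a::metric_space"
  shows "x \<noteq> y \<Longrightarrow> dist x z \<le> dist x y / 2 \<Longrightarrow> dist x z / dist x y \<le> 1 / 2"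
  by (simp add: field_simps)

section \<open>Linearity and limits for the operator on integrable functions\<close>

locale cz_operator =
  fixes T :: "('a::euclidean_space \<Rightarrow> complex) \<Rightarrow> 'a \<Rightarrow> complex" and K :: "'a \<Rightarrow> 'a \<Rightarrow> complex"
    and \<omega> :: "real \<Rightarrow> real"
  assumes cz: "CZ_omega_Dini T K \<omega>" and ext: "L1_extension T"
begin

lemma T_measurable: "integrable lebesgue f \<Longrightarrow> T f \<in> borel_measurable lebesgue"
  using ext unfolding L1_extension_def by blast

lemma T_linear_L2:
  assumes "L2 f" "L2 g"
  shows "AE x in lebesgue. T (\<lambda>y. f y + c * g y) x = T f x + c * T g x"
proof -
  have "\<forall>f g c. L2 f \<longrightarrow> L2 g \<longrightarrow> (AE x in lebesgue. T (\<lambda>y. f y + c * g y) x = T f x + c * T g x)"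
    using cz unfolding CZ_omega_Dini_def by (elim conjE)
  from this[rule_format, OF assms] show ?thesis .
qed

lemma T_kernel_L2:
  assumes "L2 f" "closed S" "\<And>y. y \<notin> S \<Longrightarrow> f y = 0"
  shows "AE x in lebesgue. x \<notin> S \<longrightarrow> T f x = (LINT y|lebesgue. K x y * f y)"
proof -
  have *: "\<forall>f S. L2 f \<longrightarrow> closed S \<longrightarrow> (\<forall>y. y \<notin> S \<longrightarrow> f y = 0) \<longrightarrow>
        (AE x in lebesgue. x \<notin> S \<longrightarrow> T f x = (LINT y|lebesgue. K x y * f y))"
    using cz unfolding CZ_omega_Dini_def by (elim conjE)
  show ?thesis by (rule *[THEN spec, THEN spec, THEN mp, THEN mp, THEN mp]) (use assms in auto)
qed

text \<open>Convergence in measure yields an almost everywhere convergent subsequence (Riesz): along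
  \<open>r\<close> the set where the error exceeds \<open>1 / Suc n\<close> has measure below
  \<open>(1/2)^n\<close>, and the Borel-Cantelli lemma applies.\<close>

lemma T_AE_subsequence:
  assumes f: "integrable lebesgue f" and fk: "\<And>k. integrable lebesgue (fk k)" "\<And>k. L2 (fk k)"
    and lim: "(\<lambda>k. LINT x|lebesgue. norm (fk k x - f x)) \<longlonglongrightarrow> 0"
  obtains r where "strict_mono r" "AE x in lebesgue. (\<lambda>n. T (fk (r n)) x) \<longlonglongrightarrow> T f x"
proof -
  have [measurable]: "T f \<in> borel_measurable lebesgue" "\<And>k. T (fk k) \<in> borel_measurable lebesgue"
    using T_measurable f fk by auto
  have m: "(\<lambda>k. emeasure lebesgue {x. norm (T (fk k) x - T f x) > \<epsilon>}) \<longlonglongrightarrow> 0" if "\<epsilon> > 0" for \<epsilon>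
  proof -
    have "\<forall>\<epsilon>>0. (\<lambda>k. emeasure lebesgue {x. norm (T (fk k) x - T f x) > \<epsilon>}) \<longlonglongrightarrow> 0"
      using ext[unfolded L1_extension_def, THEN spec, THEN mp, OF f, THEN conjunct2, THEN spec, THEN mp, THEN mp, of fk]
        fk lim by simp
    then show ?thesis using that by simp
  qed
  have ev: "\<forall>\<^sub>F k in sequentially. emeasure lebesgue {x. norm (T (fk k) x - T f x) > 1 / Suc n} < ennreal ((1/2)^n)" for n
    using m[of "1 / Suc n"] by (intro order_tendstoD(2)) auto
  obtain r where r: "strict_mono r"
    "\<And>n. emeasure lebesgue {x. norm (T (fk (r n)) x - T f x) > 1 / Suc n} < ennreal ((1/2)^n)"
    using subsequence_eventually[of "\<lambda>n k. emeasure lebesgue {x. norm (T (fk k) x - T f x) > 1 / Suc n} < ennreal ((1/2)^n)", OF ev]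
    by blast
  define A where "A n = {x. norm (T (fk (r n)) x - T f x) > 1 / Suc n}" for n
  have A: "A n \<in> sets lebesgue" for n
  proof -
    have "{x \<in> space lebesgue. norm (T (fk (r n)) x - T f x) > 1 / Suc n} \<in> sets lebesgue" by measurable
    then show ?thesis by (simp add: A_def)
  qed
  have "AE x in lebesgue. eventually (\<lambda>n. x \<in> space lebesgue - A n) sequentially"
  proof (rule borel_cantelli_AE1)
    show "emeasure lebesgue (A n) < \<infinity>" for n
      using r(2)[of n] by (auto simp: A_def intro: less_trans)
    show "summable (\<lambda>n. measure lebesgue (A n))"
    proof (rule summable_comparison_test)
      show "\<exists>N. \<forall>n\<ge>N. norm (measure lebesgue (A n)) \<le> (1/2)^n"
      proof (intro exI[of _ 0] allI impI)
        fix n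
        have "enn2real (emeasure lebesgue (A n)) \<le> (1/2)^n"
          using r(2)[of n] by (intro enn2real_leI) (simp_all add: A_def less_imp_le)
        then show "norm (measure lebesgue (A n)) \<le> (1/2)^n" by (simp add: measure_def)
      qed
    qed (simp add: summable_geometric)
  qed (rule A)
  then have "AE x in lebesgue. (\<lambda>n. T (fk (r n)) x) \<longlonglongrightarrow> T f x"
  proof (rule AE_mp, intro AE_I2 impI)
    fix x assume "eventually (\<lambda>n. x \<in> space lebesgue - A n) sequentially"
    then have "\<forall>\<^sub>F n in sequentially. norm (T (fk (r n)) x - T f x) \<le> 1 / Suc n"
      by (rule eventually_mono) (auto simp: A_def not_less)
    then have "(\<lambda>n. T (fk (r n)) x - T f x) \<longlonglongrightarrow> 0"
      using LIMSEQ_Suc[OF lim_1_over_n[where 'a=real]] by (rule Lim_null_comparison)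
    then show "(\<lambda>n. T (fk (r n)) x) \<longlonglongrightarrow> T f x" by (simp add: LIM_zero_iff)
  qed
  then show ?thesis using that r(1) by blast
qed

lemma T_linear:
  assumes f: "integrable lebesgue f" and g: "integrable lebesgue g"
  shows "AE x in lebesgue. T (\<lambda>y. f y + c * g y) x = T f x + c * T g x"
proof -
  let ?h = "\<lambda>k y. trunc f k y + c * trunc g k y"
  note lim = trunc_L1_tendsto[OF f] trunc_L1_tendsto[OF g]
  \<comment> \<open>The subsequences are nested: \<open>r2\<close> is chosen inside
    \<open>r1\<close> and \<open>r3\<close> inside both, so that along \<open>r1 (r2 (r3 n))\<close>
    all three sequences converge.\<close>
  obtain r1 where r1: "strict_mono r1" "AE x in lebesgue. (\<lambda>n. T (trunc f (r1 n)) x) \<longlonglongrightarrow> T f x"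
    using T_AE_subsequence[OF f, of "trunc f"] integrable_trunc[OF f] L2_trunc[OF f] lim(1) by blast
  obtain r2 where r2: "strict_mono r2" "AE x in lebesgue. (\<lambda>n. T (trunc g (r1 (r2 n))) x) \<longlonglongrightarrow> T g x"
    using T_AE_subsequence[OF g, of "\<lambda>n. trunc g (r1 n)"] integrable_trunc[OF g] L2_trunc[OF g]
      LIMSEQ_subseq_LIMSEQ[OF lim(2) r1(1)] by (auto simp: o_def)
  have hk: "integrable lebesgue (?h k)" for k using integrable_trunc[OF f, of k] integrable_trunc[OF g, of k] by simp
  have fg: "integrable lebesgue (\<lambda>y. f y + c * g y)" using f g by simp
  have hL2: "L2 (?h k)" for k
    by (rule L2_bounded[OF hk, of _ "k + norm c * k"])
      (auto simp: norm_mult intro!: order_trans[OF norm_triangle_ineq] add_mono mult_left_mono norm_trunc_le)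
  have hlim: "(\<lambda>k. LINT x|lebesgue. norm (?h k x - (f x + c * g x))) \<longlonglongrightarrow> 0"
    by (rule L1_dominated_tendsto[OF fg _ hk, of "\<lambda>x. norm (f x) + norm c * norm (g x)"])
      (use f g in \<open>auto simp: norm_mult intro!: tendsto_intros trunc_tendsto order_trans[OF norm_triangle_ineq] add_mono mult_left_mono norm_trunc_le\<close>)
  have sm: "strict_mono (r1 \<circ> r2)" using r1 r2 by (simp add: strict_mono_o)
  obtain r3 where r3: "strict_mono r3" "AE x in lebesgue. (\<lambda>n. T (?h (r1 (r2 (r3 n)))) x) \<longlonglongrightarrow> T (\<lambda>y. f y + c * g y) x"
    using T_AE_subsequence[OF fg, of "\<lambda>n. ?h (r1 (r2 n))"] hk hL2
      LIMSEQ_subseq_LIMSEQ[OF hlim sm] by (auto simp: o_def)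
  have lin: "AE x in lebesgue. \<forall>k. T (?h k) x = T (trunc f k) x + c * T (trunc g k) x"
    unfolding AE_all_countable using T_linear_L2 L2_trunc[OF f] L2_trunc[OF g] by blast
  show ?thesis
    using r1(2) r2(2) r3(2) lin
  proof eventually_elim
    case (elim x)
    have "(\<lambda>n. T (trunc f (r1 (r2 (r3 n)))) x) \<longlonglongrightarrow> T f x"
      using LIMSEQ_subseq_LIMSEQ[OF elim(1), of "r2 \<circ> r3"] strict_mono_o[OF r2(1) r3(1)] by (simp add: o_def)
    moreover have "(\<lambda>n. T (trunc g (r1 (r2 (r3 n)))) x) \<longlonglongrightarrow> T g x"
      using LIMSEQ_subseq_LIMSEQ[OF elim(2), of r3] r3(1) by (simp add: o_def)
    ultimately have "(\<lambda>n. T (?h (r1 (r2 (r3 n)))) x) \<longlonglongrightarrow> T f x + c * T g x"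
      using elim(4) by (auto intro!: tendsto_intros)
    then show ?case using elim(3) LIMSEQ_unique by blast
  qed
qed

text \<open>The truncations of \<open>f\<close> approximate \<open>g\<close> in L1 just as well, so
  \<open>T f\<close> and \<open>T g\<close> are limits of one sequence. The lemma is called for
  because \<open>T\<close> acts on functions, not on classes modulo null sets.\<close>

lemma T_cong_AE:
  assumes f: "integrable lebesgue f" and g: "integrable lebesgue g" and eq: "AE x in lebesgue. f x = g x"
  shows "AE x in lebesgue. T f x = T g x"
proof -
  obtain r1 where r1: "strict_mono r1" "AE x in lebesgue. (\<lambda>n. T (trunc f (r1 n)) x) \<longlonglongrightarrow> T f x"
    using T_AE_subsequence[OF f, of "trunc f"] integrable_trunc[OF f] L2_trunc[OF f] trunc_L1_tendsto[OF f] by blast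
  have "(LINT x|lebesgue. norm (trunc f k x - f x)) = (LINT x|lebesgue. norm (trunc f k x - g x))" for k
    by (rule integral_cong_AE) (use eq borel_measurable_integrable f g integrable_trunc[OF f] in auto)
  then have "(\<lambda>k. LINT x|lebesgue. norm (trunc f (r1 k) x - g x)) \<longlonglongrightarrow> 0"
    using LIMSEQ_subseq_LIMSEQ[OF trunc_L1_tendsto[OF f] r1(1)] by (simp add: o_def)
  then obtain r2 where r2: "strict_mono r2" "AE x in lebesgue. (\<lambda>n. T (trunc f (r1 (r2 n))) x) \<longlonglongrightarrow> T g x"
    using T_AE_subsequence[OF g, of "\<lambda>n. trunc f (r1 n)"] integrable_trunc[OF f] L2_trunc[OF f] by blast
  show ?thesis
    using r1(2) r2(2)
  proof eventually_elim
    case (elim x)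
    show ?case
      using LIMSEQ_unique[OF _ elim(2)] LIMSEQ_subseq_LIMSEQ[OF elim(1) r2(1)] by (simp add: o_def)
  qed
qed

lemma T_add:
  assumes "integrable lebesgue f" "integrable lebesgue g"
  shows "AE x in lebesgue. T (\<lambda>y. f y + g y) x = T f x + T g x"
  using T_linear[OF assms, of 1] by simp

lemma T_zero: "AE x in lebesgue. T (\<lambda>y. 0) x = 0"
  using T_linear[of "\<lambda>y. 0" "\<lambda>y. 0" "-1"] by simp

lemma T_sum:
  assumes "finite F" "\<And>p. p \<in> F \<Longrightarrow> integrable lebesgue (f p)"
  shows "AE x in lebesgue. T (\<lambda>y. \<Sum>p\<in>F. f p y) x = (\<Sum>p\<in>F. T (f p) x)"
  using assms
proof (induction F rule: finite_induct)
  case empty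
  then show ?case using T_zero by simp
next
  case (insert p F)
  have "AE x in lebesgue. T (\<lambda>y. f p y + (\<Sum>p\<in>F. f p y)) x = T (f p) x + T (\<lambda>y. \<Sum>p\<in>F. f p y) x"
    by (rule T_add) (use insert in auto)
  with insert.IH[OF insert.prems] show ?case
    using insert by (auto elim!: AE_mp)
qed

text \<open>Fatou's lemma for the indicators along an almost everywhere convergent subsequence. The
  strict inequality matters: if the limit exceeds \<open>t\<close>, so do all but finitely many
  terms.\<close>

lemma emeasure_T_limit:
  assumes f: "integrable lebesgue f" and fk: "\<And>k. integrable lebesgue (fk k)" "\<And>k. L2 (fk k)"
    and lim: "(\<lambda>k. LINT x|lebesgue. norm (fk k x - f x)) \<longlonglongrightarrow> 0"
    and le: "\<And>k. emeasure lebesgue {x. norm (T (fk k) x) > t} \<le> c"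
  shows "emeasure lebesgue {x. norm (T f x) > t} \<le> c"
proof -
  have [measurable]: "T f \<in> borel_measurable lebesgue" "\<And>k. T (fk k) \<in> borel_measurable lebesgue"
    using T_measurable f fk by auto
  have meas: "{x. norm (h x) > t} \<in> sets lebesgue" if [measurable]: "h \<in> borel_measurable lebesgue" for h :: "'a \<Rightarrow> complex"
  proof -
    have "{x \<in> space lebesgue. norm (h x) > t} \<in> sets lebesgue" by measurable
    then show ?thesis by simp
  qed
  obtain r where r: "strict_mono r" "AE x in lebesgue. (\<lambda>n. T (fk (r n)) x) \<longlonglongrightarrow> T f x"
    using T_AE_subsequence[OF f, of fk] fk lim by blast
  let ?A = "\<lambda>n. {x. norm (T (fk (r n)) x) > t}"
  have "emeasure lebesgue {x. norm (T f x) > t} = (\<integral>\<^sup>+x. indicator {x. norm (T f x) > t} x \<partial>lebesgue)"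
    using meas by simp
  also have "\<dots> \<le> (\<integral>\<^sup>+x. liminf (\<lambda>n. indicator (?A n) x) \<partial>lebesgue)"
  proof (rule nn_integral_mono_AE, use r(2) in eventually_elim)
    fix x assume l: "(\<lambda>n. T (fk (r n)) x) \<longlonglongrightarrow> T f x"
    show "indicator {x. norm (T f x) > t} x \<le> liminf (\<lambda>n. indicator (?A n) x :: ennreal)"
    proof (cases "norm (T f x) > t")
      case True
      have "\<forall>\<^sub>F n in sequentially. t < norm (T (fk (r n)) x)"
        using tendsto_norm[OF l] True by (rule order_tendstoD)
      then have "\<forall>\<^sub>F n in sequentially. 1 \<le> (indicator (?A n) x :: ennreal)"
        by (rule eventually_mono) simp
      then show ?thesis using True by (simp add: Liminf_bounded)
    qed simp
  qed
  also have "\<dots> \<le> liminf (\<lambda>n. \<integral>\<^sup>+x. indicator (?A n) x \<partial>lebesgue)"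
    by (rule nn_integral_liminf) (use meas in simp)
  also have "\<dots> \<le> c"
    using meas le by (simp add: Liminf_le)
  finally show ?thesis .
qed

section \<open>Size, regularity and integrals of the kernel\<close>

lemma kernel_size:
  obtains C where "0 \<le> C" "\<And>x y. x \<noteq> y \<Longrightarrow> norm (K x y) \<le> C / dist x y ^ DIM('a)"
proof -
  obtain C where C: "\<And>x y. x \<noteq> y \<Longrightarrow> norm (K x y) \<le> C / dist x y ^ DIM('a)"
    using cz unfolding CZ_omega_Dini_def by blast
  show ?thesis
  proof (rule that[of "\<bar>C\<bar>"])
    fix x y :: 'a assume "x \<noteq> y"
    from C[OF this] show "norm (K x y) \<le> \<bar>C\<bar> / dist x y ^ DIM('a)"
      by (rule order_trans) (simp add: divide_right_mono)
  qed simp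
qed

lemma dini: "dini_modulus \<omega>"
  using cz unfolding CZ_omega_Dini_def by blast

lemma omega_nonneg: "0 \<le> t \<Longrightarrow> t \<le> 1 \<Longrightarrow> 0 \<le> \<omega> t"
  using dini unfolding dini_modulus_def by simp

lemma omega_mono: "0 \<le> s \<Longrightarrow> s \<le> t \<Longrightarrow> t \<le> 1 \<Longrightarrow> \<omega> s \<le> \<omega> t"
  using dini unfolding dini_modulus_def mono_on_def by simp

lemma kernel_dini:
  obtains C where "0 \<le> C"
    "\<And>x x' y. x \<noteq> y \<Longrightarrow> dist x x' \<le> dist x y / 2 \<Longrightarrow>
        norm (K x y - K x' y) + norm (K y x - K y x') \<le> C / dist x y ^ DIM('a) * \<omega> (dist x x' / dist x y)"
proof -
  obtain C where C: "\<And>x x' y. x \<noteq> y \<Longrightarrow> dist x x' \<le> dist x y / 2 \<Longrightarrow>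
        norm (K x y - K x' y) + norm (K y x - K y x') \<le> C / dist x y ^ DIM('a) * \<omega> (dist x x' / dist x y)"
    using cz unfolding CZ_omega_Dini_def by blast
  show ?thesis
  proof (rule that[of "\<bar>C\<bar>"])
    fix x x' y :: 'a assume h: "x \<noteq> y" "dist x x' \<le> dist x y / 2"
    have "0 \<le> \<omega> (dist x x' / dist x y)"
    proof (rule omega_nonneg)
      show "dist x x' / dist x y \<le> 1"
        using dist_ratio_le_half[OF h] by linarith
    qed simp
    then show "norm (K x y - K x' y) + norm (K y x - K y x') \<le> \<bar>C\<bar> / dist x y ^ DIM('a) * \<omega> (dist x x' / dist x y)"
      by (intro order_trans[OF C[OF h]] mult_right_mono divide_right_mono) auto
  qed simp
qed

text \<open>Since \<open>\<omega> t\<close> tends to 0 with \<open>t\<close>, regularity in the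
  second variable means continuity away from the diagonal. It supplies the measurability of
  \<open>K x\<close>, on which the definition of the operator is silent.\<close>

lemma kernel_continuous: "continuous_on (- {x}) (K x)"
proof (rule continuous_at_imp_continuous_on, rule ballI)
  fix y assume "y \<in> - {x}"
  then have yx: "y \<noteq> x" by simp
  obtain C where C: "0 \<le> C" "\<And>x x' y. x \<noteq> y \<Longrightarrow> dist x x' \<le> dist x y / 2 \<Longrightarrow>
        norm (K x y - K x' y) + norm (K y x - K y x') \<le> C / dist x y ^ DIM('a) * \<omega> (dist x x' / dist x y)"
    using kernel_dini by blast
  have w0: "((\<lambda>t. \<omega> t) \<longlongrightarrow> 0) (at 0 within {0..1})"
    using dini unfolding dini_modulus_def continuous_on_def by force
  have "((\<lambda>y'. dist y y' / dist y x) \<longlongrightarrow> 0) (at y)"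
    by (auto intro!: tendsto_eq_intros simp: yx)
  moreover have near: "\<forall>\<^sub>F y' in at y. y' \<noteq> y \<and> dist y y' \<le> dist y x / 2"
    unfolding eventually_at
    by (intro exI[of _ "dist y x / 2"]) (use yx in \<open>auto simp: dist_commute\<close>)
  \<comment> \<open>\<open>\<omega>\<close> is continuous only on \<open>{0..1}\<close>, so its
    argument has to be kept in this interval near \<open>y\<close>.\<close>
  then have "\<forall>\<^sub>F y' in at y. dist y y' / dist y x \<in> {0..1} \<and> dist y y' / dist y x \<noteq> 0"
  proof (rule eventually_mono)
    fix z assume z: "z \<noteq> y \<and> dist y z \<le> dist y x / 2"
    then have "dist y z / dist y x \<le> 1"
      using yx dist_ratio_le_half[of y x z] by linarith
    moreover have "0 < dist y z / dist y x" using z yx by (intro divide_pos_pos) auto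
    ultimately show "dist y z / dist y x \<in> {0..1} \<and> dist y z / dist y x \<noteq> 0" by (metis atLeastAtMost_iff less_irrefl less_imp_le)
  qed
  ultimately have "filterlim (\<lambda>y'. dist y y' / dist y x) (at 0 within {0..1}) (at y)"
    by (simp add: filterlim_at)
  from filterlim_compose[OF w0 this]
  have "((\<lambda>y'. C / dist y x ^ DIM('a) * \<omega> (dist y y' / dist y x)) \<longlongrightarrow> C / dist y x ^ DIM('a) * 0) (at y)"
    by (intro tendsto_intros)
  moreover have "\<forall>\<^sub>F y' in at y. norm (K x y' - K x y) \<le> C / dist y x ^ DIM('a) * \<omega> (dist y y' / dist y x)"
    using near
  proof (rule eventually_mono)
    fix y' assume "y' \<noteq> y \<and> dist y y' \<le> dist y x / 2"
    then show "norm (K x y' - K x y) \<le> C / dist y x ^ DIM('a) * \<omega> (dist y y' / dist y x)"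
      using C(2)[OF yx, of y'] norm_ge_zero[of "K y x - K y' x"] norm_minus_commute[of "K x y'" "K x y"] by linarith
  qed
  ultimately have "((\<lambda>y'. K x y' - K x y) \<longlongrightarrow> 0) (at y)"
    by (simp only: mult_zero_right Lim_null_comparison)
  then show "isCont (K x) y" by (simp add: isCont_def LIM_zero_iff)
qed

text \<open>Because of \<open>f x = 0\<close> the value of the kernel on the diagonal, about which
  nothing is known, does not enter the product.\<close>

lemma kernel_mult_measurable:
  assumes "f \<in> borel_measurable lebesgue" "f x = 0"
  shows "(\<lambda>y. K x y * f y) \<in> borel_measurable lebesgue"
proof -
  have "(\<lambda>y. indicator (- {x}) y *\<^sub>R K x y) \<in> borel_measurable borel"
    by (rule borel_measurable_continuous_on_indicator[OF _ kernel_continuous]) simp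
  then have "(\<lambda>y. indicator (- {x}) y *\<^sub>R K x y) \<in> borel_measurable lebesgue"
    by (intro measurable_completion) simp
  then have "(\<lambda>y. (indicator (- {x}) y *\<^sub>R K x y) * f y) \<in> borel_measurable lebesgue"
    using assms(1) by measurable
  also have "(\<lambda>y. (indicator (- {x}) y *\<^sub>R K x y) * f y) = (\<lambda>y. K x y * f y)"
    using assms(2) by (auto simp: indicator_def)
  finally show ?thesis .
qed

lemma kernel_mult_integrable:
  assumes f: "integrable lebesgue f" and e: "0 < e" "\<And>y. dist x y < e \<Longrightarrow> f y = 0"
  shows "integrable lebesgue (\<lambda>y. K x y * f y)"
proof -
  obtain C where C: "0 \<le> C" "\<And>x y. x \<noteq> y \<Longrightarrow> norm (K x y) \<le> C / dist x y ^ DIM('a)"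
    using kernel_size by blast
  show ?thesis
  proof (rule Bochner_Integration.integrable_bound)
    show "integrable lebesgue (\<lambda>y. C / e ^ DIM('a) * norm (f y))" using f by simp
    show "(\<lambda>y. K x y * f y) \<in> borel_measurable lebesgue"
      using e f by (intro kernel_mult_measurable borel_measurable_integrable) auto
    show "AE y in lebesgue. norm (K x y * f y) \<le> norm (C / e ^ DIM('a) * norm (f y))"
    proof (rule AE_I2)
      fix y
      show "norm (K x y * f y) \<le> norm (C / e ^ DIM('a) * norm (f y))"
      proof (cases "dist x y < e")
        case False
        then have "norm (K x y) \<le> C / dist x y ^ DIM('a)" using C(2)[of x y] e(1) by fastforce
        also have "\<dots> \<le> C / e ^ DIM('a)"
          using False e C by (intro divide_left_mono power_mono mult_pos_pos zero_less_power) auto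
        finally have "norm (K x y) * norm (f y) \<le> C / e ^ DIM('a) * norm (f y)"
          by (rule mult_right_mono) simp
        then show ?thesis unfolding norm_mult real_norm_def by (rule order_trans[OF _ abs_ge_self])
      qed (use e in simp)
    qed
  qed
qed

lemma closed_far:
  fixes x :: 'a
  assumes "closed S" "x \<notin> S"
  obtains e where "0 < e" "\<And>y. dist x y < e \<Longrightarrow> y \<notin> S"
proof -
  obtain e where "0 < e" "ball x e \<subseteq> - S"
    using assms open_Compl[OF assms(1)] openE[of "- S" x] by blast
  then show ?thesis by (intro that[of e]) auto
qed

text \<open>Truncation keeps the support in \<open>S\<close>, and for a fixed \<open>x\<close> off
  \<open>S\<close> the product of the kernel with \<open>f\<close> is an integrable majorant;
  dominated convergence then carries the formula from L2 to L1.\<close>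

lemma T_kernel:
  assumes f: "integrable lebesgue f" and S: "closed S" "\<And>y. y \<notin> S \<Longrightarrow> f y = 0"
  shows "AE x in lebesgue. x \<notin> S \<longrightarrow> T f x = (LINT y|lebesgue. K x y * f y)"
proof -
  obtain r where r: "strict_mono r" "AE x in lebesgue. (\<lambda>n. T (trunc f (r n)) x) \<longlonglongrightarrow> T f x"
    using T_AE_subsequence[OF f, of "trunc f"] integrable_trunc[OF f] L2_trunc[OF f] trunc_L1_tendsto[OF f] by blast
  have "AE x in lebesgue. x \<notin> S \<longrightarrow> T (trunc f k) x = (LINT y|lebesgue. K x y * trunc f k y)" for k
  proof -
    show ?thesis by (rule T_kernel_L2[OF L2_trunc[OF f] S(1)]) (simp add: trunc_def S(2))
  qed
  then have "AE x in lebesgue. \<forall>k. x \<notin> S \<longrightarrow> T (trunc f k) x = (LINT y|lebesgue. K x y * trunc f k y)"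
    unfolding AE_all_countable by blast
  with r(2) show ?thesis
  proof eventually_elim
    case (elim x)
    show ?case
    proof
      assume x: "x \<notin> S"
      obtain e where e: "0 < e" "\<And>y. dist x y < e \<Longrightarrow> y \<notin> S" using closed_far[OF S(1) x] by blast
      have int: "integrable lebesgue (\<lambda>y. K x y * f y)"
        by (rule kernel_mult_integrable[OF f e(1)]) (use e S in blast)
      have int': "integrable lebesgue (\<lambda>y. K x y * trunc f k y)" for k
        by (rule kernel_mult_integrable[OF integrable_trunc[OF f] e(1)]) (use e S in \<open>simp add: trunc_def\<close>)
      have "(\<lambda>k. LINT y|lebesgue. K x y * trunc f k y) \<longlonglongrightarrow> (LINT y|lebesgue. K x y * f y)"
        by (rule integral_dominated_convergence[where w = "\<lambda>y. norm (K x y * f y)"])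
          (use int int' integrable_norm[OF int] in \<open>auto simp: norm_mult intro!: AE_I2 tendsto_intros trunc_tendsto mult_left_mono norm_trunc_le\<close>)
      from LIMSEQ_subseq_LIMSEQ[OF this r(1)]
      have "(\<lambda>n. T (trunc f (r n)) x) \<longlonglongrightarrow> (LINT y|lebesgue. K x y * f y)"
        using elim(2) x by (simp add: o_def)
      then show "T f x = (LINT y|lebesgue. K x y * f y)" using elim(1) LIMSEQ_unique by blast
    qed
  qed
qed

\<comment> \<open>Measure estimates for level sets, balls and families of cubes\<close>
end

text \<open>Chebyshev's inequality. The function has values in \<open>ennreal\<close>, so that
  squares and finite sums can be inserted without questions of integrability.\<close>

lemma emeasure_gt_le:
  assumes [measurable]: "u \<in> borel_measurable lebesgue" and t: "0 < t"
    and c: "(\<integral>\<^sup>+x. u x \<partial>lebesgue) \<le> ennreal c"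
  shows "emeasure lebesgue {x. ennreal t < u x} \<le> ennreal (c / t)"
proof -
  have A: "{x. ennreal t < u x} \<in> sets lebesgue"
  proof -
    have "{x \<in> space lebesgue. ennreal t < u x} \<in> sets lebesgue" by measurable
    then show ?thesis by simp
  qed
  have "ennreal t * emeasure lebesgue {x. ennreal t < u x} = (\<integral>\<^sup>+x. ennreal t * indicator {x. ennreal t < u x} x \<partial>lebesgue)"
    using A by (simp add: nn_integral_cmult)
  also have "\<dots> \<le> (\<integral>\<^sup>+x. u x \<partial>lebesgue)"
    by (intro nn_integral_mono) (auto simp: indicator_def less_imp_le)
  finally have le: "ennreal t * emeasure lebesgue {x. ennreal t < u x} \<le> ennreal c" using c by simp
  have "ennreal (1/t) * (ennreal t * emeasure lebesgue {x. ennreal t < u x}) \<le> ennreal (1/t) * ennreal c"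
    using le by (rule mult_left_mono) simp
  moreover have "ennreal (1/t) * ennreal t = 1" using t by (simp flip: ennreal_mult)
  moreover have "ennreal (1/t) * ennreal c = ennreal (c / t)" using t by (simp flip: ennreal_mult')
  ultimately show ?thesis by (simp add: mult.assoc[symmetric])
qed

lemma emeasure_cball_le:
  fixes c :: "'a::euclidean_space"
  assumes "0 \<le> r"
  shows "emeasure lebesgue (cball c r) \<le> ennreal ((2 * r) ^ DIM('a))"
proof -
  have "cball c r \<subseteq> cbox (c - r *\<^sub>R One) ((c - r *\<^sub>R One) + (2 * r) *\<^sub>R One)"
  proof
    fix x assume "x \<in> cball c r"
    then have "\<bar>(x - c) \<bullet> i\<bar> \<le> r" if "i \<in> Basis" for i
      using Basis_le_norm[OF that, of "x - c"] by (simp add: dist_norm norm_minus_commute)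
    then show "x \<in> cbox (c - r *\<^sub>R One) ((c - r *\<^sub>R One) + (2 * r) *\<^sub>R One)"
      by (fastforce simp: mem_box inner_simps abs_le_iff)
  qed
  then have "emeasure lebesgue (cball c r) \<le> emeasure lebesgue (cbox (c - r *\<^sub>R One) ((c - r *\<^sub>R One) + (2 * r) *\<^sub>R One))"
    by (rule emeasure_mono) simp
  also have "\<dots> = ennreal ((2 * r) ^ DIM('a))" using assms by (intro emeasure_cbox_cube) simp
  finally show ?thesis .
qed

lemma sum_integral_cutoff_le:
  fixes h :: "'a::euclidean_space \<Rightarrow> real"
  assumes F: "finite F" and meas: "\<And>p. p \<in> F \<Longrightarrow> A p \<in> sets lebesgue"
    and dis: "\<And>p q. p \<in> F \<Longrightarrow> q \<in> F \<Longrightarrow> p \<noteq> q \<Longrightarrow> A p \<inter> A q = {}"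
    and h: "integrable lebesgue h" "\<And>x. 0 \<le> h x"
  shows "(\<Sum>p\<in>F. LINT x|lebesgue. cutoff (A p) h x) \<le> (LINT x|lebesgue. h x)"
proof -
  have int: "integrable lebesgue (cutoff (A p) h)" if "p \<in> F" for p using integrable_cutoff h meas that by blast
  have "(\<Sum>p\<in>F. LINT x|lebesgue. cutoff (A p) h x) = (LINT x|lebesgue. (\<Sum>p\<in>F. cutoff (A p) h x))"
    by (rule Bochner_Integration.integral_sum[symmetric]) (rule int)
  also have "\<dots> \<le> (LINT x|lebesgue. h x)"
  proof (rule integral_mono)
    fix x
    show "(\<Sum>p\<in>F. cutoff (A p) h x) \<le> h x"
    proof (cases "\<exists>p\<in>F. x \<in> A p")
      case True
      then obtain p where p: "p \<in> F" "x \<in> A p" by blast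
      have "(\<Sum>p'\<in>F. cutoff (A p') h x) = (\<Sum>p'\<in>F. if p' = p then h x else 0)"
        using p dis by (intro sum.cong refl) (auto simp: cutoff_def)
      then show ?thesis using p F by simp
    next
      case False
      then have "(\<Sum>p'\<in>F. cutoff (A p') h x) = 0" by (intro sum.neutral) (auto simp: cutoff_def)
      then show ?thesis using h(2) by simp
    qed
  qed (use int h in auto)
  finally show ?thesis .
qed

text \<open>Continuity of the measure from above along an enumeration. It reduces the bad part of a
  decomposition to a finite sum, which is all that the finite additivity of \<open>T\<close> can
  handle.\<close>

lemma finite_subfamily_approx:
  assumes F: "countable F" and meas: "\<And>p. p \<in> F \<Longrightarrow> A p \<in> sets M"
    and fin: "emeasure M (\<Union>p\<in>F. A p) < \<infinity>" and d: "0 < (\<delta>::ennreal)"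
  obtains F' where "finite F'" "F' \<subseteq> F" "emeasure M ((\<Union>p\<in>F. A p) - (\<Union>p\<in>F'. A p)) < \<delta>"
proof (cases "F = {}")
  case True
  then show ?thesis using that[of "{}"] d by simp
next
  case False
  let ?F = "\<lambda>n. from_nat_into F ` {..<n}"
  let ?B = "\<lambda>n. (\<Union>p\<in>F. A p) - (\<Union>p\<in>?F n. A p)"
  have sub: "?F n \<subseteq> F" for n using False by (auto intro: from_nat_into)
  have U: "(\<Union>p\<in>F. A p) \<in> sets M" using F meas by (intro sets.countable_UN') auto
  have B: "?B n \<in> sets M" for n
  proof (rule sets.Diff[OF U], rule sets.finite_UN)
    fix p assume "p \<in> ?F n"
    with sub show "A p \<in> sets M" by (intro meas) blast
  qed simp
  have "(\<lambda>n. emeasure M (?B n)) \<longlonglongrightarrow> emeasure M (\<Inter>n. ?B n)"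
  proof (rule Lim_emeasure_decseq)
    show "range ?B \<subseteq> sets M" using B by blast
    show "decseq ?B" by (intro decseq_SucI) (auto simp: lessThan_Suc)
    show "emeasure M (?B n) \<noteq> \<infinity>" for n
      using emeasure_mono[of "?B n" "\<Union>p\<in>F. A p" M] U fin by (auto simp: top_unique)
  qed
  moreover have "(\<Inter>n. ?B n) = {}"
  proof -
    have False if x: "x \<in> (\<Inter>n. ?B n)" for x
    proof -
      obtain p where p: "p \<in> F" "x \<in> A p" using x by blast
      obtain n where "from_nat_into F n = p" using from_nat_into_surj[OF F p(1)] by blast
      then have "p \<in> ?F (Suc n)" by blast
      then show False using x p by blast
    qed
    then show ?thesis by blast
  qed
  ultimately have "(\<lambda>n. emeasure M (?B n)) \<longlonglongrightarrow> 0" by (simp only: emeasure_empty)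
  then have "\<forall>\<^sub>F n in sequentially. emeasure M (?B n) < \<delta>" using d by (rule order_tendstoD)
  then have "\<exists>n. emeasure M (?B n) < \<delta>" by (rule eventually_happens'[OF sequentially_bot])
  then obtain n where "emeasure M (?B n) < \<delta>" by blast
  then show ?thesis using that[of "?F n"] sub by blast
qed

section \<open>The Dini sum and functions of mean zero\<close>

context cz_operator
begin

lemma omega_summable: "summable (\<lambda>k. \<omega> ((1/2) ^ Suc k))"
proof (rule summableI_nonneg_bounded)
  let ?h = "\<lambda>t. \<omega> t / t"
  have h: "?h integrable_on {0..1}" using dini unfolding dini_modulus_def by blast
  have hsub: "?h integrable_on {a..b}" if "0 \<le> a" "b \<le> 1" for a b
    by (rule integrable_on_subinterval[OF h]) (use that in auto)
  have half: "(1/2::real) ^ n \<le> 1" "0 < (1/2::real) ^ n" for n by (auto simp: power_le_one)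
  \<comment> \<open>On the dyadic interval from \<open>?a\<close> to \<open>?b\<close> the integrand
    is at least \<open>\<omega> ?a / ?b\<close>, and the length is half of \<open>?b\<close>; the
    interval thus contributes at least \<open>\<omega> ?a / 2\<close>.\<close>
  have lower: "(\<Sum>k<n. \<omega> ((1/2) ^ Suc k)) / 2 \<le> integral {(1/2)^n..1} ?h" for n
  proof (induction n)
    case (Suc n)
    let ?a = "(1/2::real) ^ Suc n" and ?b = "(1/2::real) ^ n"
    have ab: "?a \<le> ?b" "?b \<le> 1" "0 < ?a" using half by auto
    have "\<omega> ?a / 2 = integral {?a..?b} (\<lambda>t. \<omega> ?a / ?b)"
      using ab by (simp add: field_simps)
    also have "\<dots> \<le> integral {?a..?b} ?h"
    proof (rule integral_le)
      show "?h integrable_on {?a..?b}" using ab by (intro hsub) auto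
      fix t assume t: "t \<in> {?a..?b}"
      then have "0 < t" "t \<le> ?b" "?a \<le> t" using less_le_trans[OF ab(3)] by simp_all
      then show "\<omega> ?a / ?b \<le> ?h t"
        using ab by (intro frac_le omega_mono omega_nonneg) (simp_all only: less_imp_le order_trans[of t ?b 1])
    qed (rule integrable_const_ivl)
    finally have "\<omega> ?a / 2 \<le> integral {?a..?b} ?h" .
    moreover have "integral {?a..?b} ?h + integral {?b..1} ?h = integral {?a..1} ?h"
      using ab by (intro Henstock_Kurzweil_Integration.integral_combine hsub) auto
    ultimately show ?case using Suc.IH by (simp add: add_divide_distrib)
  qed simp
  show "(\<Sum>k<n. \<omega> ((1/2) ^ Suc k)) \<le> 2 * integral {0..1} ?h" for n
  proof -
    have "integral {(1/2)^n..1} ?h \<le> integral {0..1} ?h"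
      using half[of n] by (intro integral_subset_le hsub h) (auto intro!: omega_nonneg divide_nonneg_nonneg)
    then show ?thesis using lower[of n] by linarith
  qed
  show "0 \<le> \<omega> ((1/2) ^ Suc n)" for n
    using half[of "Suc n"] by (intro omega_nonneg) (simp_all only: less_imp_le)
qed

definition omega_sum :: real where "omega_sum = (\<Sum>k. \<omega> ((1/2) ^ Suc k))"

lemma omega_half_nonneg: "0 \<le> \<omega> ((1/2) ^ Suc k)"
  by (rule omega_nonneg) (auto intro: power_le_one simp del: power_Suc)

lemma omega_sum_nonneg: "0 \<le> omega_sum"
  unfolding omega_sum_def by (rule suminf_nonneg[OF omega_summable omega_half_nonneg])

text \<open>Hoermander's estimate. Since \<open>b\<close> has mean zero, \<open>K x c\<close> with
  \<open>c\<close> the corner of the cube may be subtracted from \<open>K x y\<close>. On the shell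
  where \<open>dist c x\<close> is about \<open>2 * s * 2^k\<close> the Dini condition gains
  \<open>\<omega> ((1/2) ^ Suc k)\<close> over the size bound, and the sum over the shells is the
  Dini sum.\<close>

lemma T_atom:
  obtains C where "0 \<le> C" "\<And>b p. integrable lebesgue b \<Longrightarrow> 0 < snd p \<Longrightarrow> (\<And>y. y \<notin> hcube p \<Longrightarrow> b y = 0) \<Longrightarrow>
      (LINT y|lebesgue. b y) = 0 \<Longrightarrow>
      (\<integral>\<^sup>+x. ennreal (norm (T b x)) * indicator (- cball (fst p) (2 * real DIM('a) * snd p)) x \<partial>lebesgue)
        \<le> ennreal (C * (L1norm b))"
proof -
  obtain C where C: "0 \<le> C" "\<And>x x' y. x \<noteq> y \<Longrightarrow> dist x x' \<le> dist x y / 2 \<Longrightarrow>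
        norm (K x y - K x' y) + norm (K y x - K y x') \<le> C / dist x y ^ DIM('a) * \<omega> (dist x x' / dist x y)"
    using kernel_dini by blast
  show ?thesis
  proof (rule that[of "C * 4 ^ DIM('a) * omega_sum"], goal_cases)
    case 1
    show ?case using C omega_sum_nonneg by simp
  next
    case (2 b p)
    note b = 2(1) and p = 2(2) and supp = 2(3) and b0 = 2(4)
    define c where "c = fst p"
    define s where "s = real DIM('a) * snd p"
    have s: "0 < s" using p by (simp add: s_def)
    define I where "I = (L1norm b)"
    have I: "0 \<le> I" by (simp add: I_def)
    have near: "dist c y \<le> s" if "y \<in> hcube p" for y
      using dist_hcube[OF hcube_corner[OF p] that] by (simp add: c_def s_def)
    let ?a = "\<lambda>k. C / (2 * s * 2^k) ^ DIM('a) * \<omega> ((1/2) ^ Suc k) * I"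
    have a0: "0 \<le> ?a k" for k using C s I omega_half_nonneg[of k] by simp
    have "AE x in lebesgue. x \<notin> cball c s \<longrightarrow> T b x = (LINT y|lebesgue. K x y * b y)"
      by (rule T_kernel[OF b]) (use near supp in auto)
    \<comment> \<open>The bound holds for every \<open>k\<close> whose radius is below
      \<open>dist c x\<close>; a point will be charged only to the largest of these.\<close>
    then have bound: "AE x in lebesgue. \<forall>k. 2 * s * 2^k < dist c x \<longrightarrow> norm (T b x) \<le> ?a k"
    proof eventually_elim
      case (elim x)
      show ?case
      proof (intro allI impI)
        fix k assume far: "2 * s * 2^k < dist c x"
        have one: "1 \<le> (2::real)^k" by simp
        have "2 * s \<le> 2 * s * 2^k" using s one by (simp add: mult_le_cancel_left1)
        then have far2: "2 * s < dist c x" using far by linarith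
        then have x: "x \<notin> cball c s" and xc: "c \<noteq> x" using s by auto
        have xs: "b y = 0" if "dist x y < s" for y
        proof (rule supp)
          show "y \<notin> hcube p"
          proof
            assume "y \<in> hcube p"
            then show False using near[of y] that far2 dist_triangle[of c x y] by (simp add: dist_commute)
          qed
        qed
        have int: "integrable lebesgue (\<lambda>y. K x y * b y)" by (rule kernel_mult_integrable[OF b s xs])
        have "T b x = (LINT y|lebesgue. K x y * b y)" using elim x by blast
        also have "\<dots> = (LINT y|lebesgue. K x y * b y - K x c * b y)"
          using int b b0 by simp
        finally have "norm (T b x) \<le> (LINT y|lebesgue. norm (K x y * b y - K x c * b y))"
          by (simp only: integral_norm_bound)
        also have "\<dots> \<le> (LINT y|lebesgue. C / (2 * s * 2^k) ^ DIM('a) * \<omega> ((1/2) ^ Suc k) * norm (b y))"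
        proof (rule integral_mono)
          show "integrable lebesgue (\<lambda>y. norm (K x y * b y - K x c * b y))"
            using int b by (intro integrable_norm Bochner_Integration.integrable_diff) simp_all
          show "integrable lebesgue (\<lambda>y. C / (2 * s * 2^k) ^ DIM('a) * \<omega> ((1/2) ^ Suc k) * norm (b y))"
            using b by simp
          fix y
          show "norm (K x y * b y - K x c * b y) \<le> C / (2 * s * 2^k) ^ DIM('a) * \<omega> ((1/2) ^ Suc k) * norm (b y)"
          proof (cases "y \<in> hcube p")
            case True
            have cy: "dist c y \<le> dist c x / 2" using near[OF True] far2 by linarith
            have "dist c y / dist c x \<le> s / (2 * s * 2^k)"
              using near[OF True] far s by (intro frac_le) auto
            also have "\<dots> = (1/2) ^ Suc k" using s by (simp add: power_one_over)
            finally have r: "dist c y / dist c x \<le> (1/2) ^ Suc k" .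
            have "norm (K x c - K x y) \<le> C / dist c x ^ DIM('a) * \<omega> (dist c y / dist c x)"
              using C(2)[OF xc cy] norm_ge_zero[of "K c x - K y x"] by linarith
            also have "\<dots> \<le> C / (2 * s * 2^k) ^ DIM('a) * \<omega> ((1/2) ^ Suc k)"
            proof (rule mult_mono)
              show "C / dist c x ^ DIM('a) \<le> C / (2 * s * 2^k) ^ DIM('a)"
                using far s C xc by (intro divide_left_mono power_mono mult_pos_pos zero_less_power) auto
              show "\<omega> (dist c y / dist c x) \<le> \<omega> ((1/2) ^ Suc k)"
                by (rule omega_mono[OF _ r]) (auto intro: power_le_one simp del: power_Suc)
              show "0 \<le> \<omega> (dist c y / dist c x)"
                by (rule omega_nonneg) (use r power_le_one[of "1/2::real" "Suc k"] in \<open>auto intro: order_trans simp del: power_Suc\<close>)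
            qed (use C s in auto)
            finally have "norm (K x c - K x y) * norm (b y) \<le> C / (2 * s * 2^k) ^ DIM('a) * \<omega> ((1/2) ^ Suc k) * norm (b y)"
              by (rule mult_right_mono) simp
            moreover have "norm (K x y * b y - K x c * b y) = norm (K x c - K x y) * norm (b y)"
              by (metis left_diff_distrib norm_minus_commute norm_mult)
            ultimately show ?thesis by simp
          qed (simp add: supp)
        qed
        also have "\<dots> = ?a k" by (simp add: I_def)
        finally show "norm (T b x) \<le> ?a k" .
      qed
    qed
    have "(\<integral>\<^sup>+x. ennreal (norm (T b x)) * indicator (- cball (fst p) (2 * real DIM('a) * snd p)) x \<partial>lebesgue)
        \<le> (\<integral>\<^sup>+x. (\<Sum>k. ennreal (?a k) * indicator (cball c (2 * s * 2 ^ Suc k)) x) \<partial>lebesgue)"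
    proof (rule nn_integral_mono_AE, use bound in eventually_elim)
      fix x assume bd: "\<forall>k. 2 * s * 2^k < dist c x \<longrightarrow> norm (T b x) \<le> ?a k"
      show "ennreal (norm (T b x)) * indicator (- cball (fst p) (2 * real DIM('a) * snd p)) x
        \<le> (\<Sum>k. ennreal (?a k) * indicator (cball c (2 * s * 2 ^ Suc k)) x)"
      proof (cases "2 * s < dist c x")
        case True
        have "\<exists>n. dist c x \<le> 2 * s * 2^n"
        proof -
          obtain n where "dist c x / (2 * s) < 2 ^ n" using real_arch_pow[of 2] by auto
          then show ?thesis using s by (intro exI[of _ n]) (simp add: field_simps)
        qed
        \<comment> \<open>The least \<open>n\<close> with \<open>dist c x \<le> 2 * s * 2^n\<close>
          is positive, so its predecessor \<open>k\<close> names the shell of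
          \<open>x\<close>.\<close>
        then obtain n where n: "dist c x \<le> 2 * s * 2^n" "\<forall>m<n. \<not> dist c x \<le> 2 * s * 2^m"
          using exists_least_iff[of "\<lambda>n. dist c x \<le> 2 * s * 2^n"] by blast
        then have "n \<noteq> 0" using True by (metis mult.right_neutral not_le power_0)
        then obtain k where k: "n = Suc k" using not0_implies_Suc by blast
        then have "2 * s * 2^k < dist c x" using n(2) by (simp add: not_le)
        then have "ennreal (norm (T b x)) \<le> ennreal (?a k)" using bd by (intro ennreal_leI) blast
        also have "\<dots> = (\<Sum>j\<in>{k}. ennreal (?a j) * indicator (cball c (2 * s * 2 ^ Suc j)) x)"
          using n(1) k by simp
        also have "\<dots> \<le> (\<Sum>k. ennreal (?a k) * indicator (cball c (2 * s * 2 ^ Suc k)) x)"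
          by (rule sum_le_suminf) auto
        finally show ?thesis by (auto simp: indicator_def split: if_splits)
      next
        case False
        then show ?thesis by (simp add: c_def s_def mult.assoc)
      qed
    qed
    also have "\<dots> = (\<Sum>k. ennreal (?a k) * emeasure lebesgue (cball c (2 * s * 2 ^ Suc k)))"
    proof -
      have [measurable]: "cball c r \<in> sets lebesgue" for r
        using lmeasurable_cball by (rule fmeasurableD)
      show ?thesis
        by (subst nn_integral_suminf) (measurable, simp add: nn_integral_cmult_indicator)
    qed
    also have "\<dots> \<le> (\<Sum>k. ennreal (C * 4 ^ DIM('a) * I * \<omega> ((1/2) ^ Suc k)))"
    proof (rule suminf_le)
      fix k
      have "ennreal (?a k) * emeasure lebesgue (cball c (2 * s * 2 ^ Suc k))
          \<le> ennreal (?a k) * ennreal ((2 * (2 * s * 2 ^ Suc k)) ^ DIM('a))"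
        using s by (intro mult_left_mono emeasure_cball_le) auto
      also have "\<dots> = ennreal (?a k * (2 * (2 * s * 2 ^ Suc k)) ^ DIM('a))"
        by (rule ennreal_mult'[symmetric]) (rule a0)
      \<comment> \<open>The ball of radius \<open>2 * s * 2 ^ Suc k\<close> lies in a cube of side
        \<open>4 * (2 * s * 2^k)\<close>; the power of the second factor cancels the denominator of
        \<open>?a k\<close> and leaves \<open>4 ^ DIM('a)\<close>.\<close>
      also have "(2 * (2 * s * 2 ^ Suc k)) ^ DIM('a) = 4 ^ DIM('a) * (2 * s * 2^k) ^ DIM('a)"
        by (simp add: power_mult_distrib[symmetric] mult_ac)
      also have "?a k * (4 ^ DIM('a) * (2 * s * 2^k) ^ DIM('a)) = C * 4 ^ DIM('a) * I * \<omega> ((1/2) ^ Suc k)"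
        using s by simp
      finally show "ennreal (?a k) * emeasure lebesgue (cball c (2 * s * 2 ^ Suc k))
          \<le> ennreal (C * 4 ^ DIM('a) * I * \<omega> ((1/2) ^ Suc k))" .
    qed auto
    also have "\<dots> = ennreal (\<Sum>k. C * 4 ^ DIM('a) * I * \<omega> ((1/2) ^ Suc k))"
      using C I omega_half_nonneg omega_summable
      by (intro suminf_ennreal2 summable_mult mult_nonneg_nonneg) auto
    also have "(\<Sum>k. C * 4 ^ DIM('a) * I * \<omega> ((1/2) ^ Suc k)) = C * 4 ^ DIM('a) * I * omega_sum"
      unfolding omega_sum_def by (rule suminf_mult[OF omega_summable])
    finally show ?case
      by (simp add: I_def mult_ac)
  qed
qed

end

section \<open>Weak type bound\<close>

text \<open>The stopping rule is applied to \<open>\<bar>g\<bar> + t 1\<^sub>U\<close>, where the open set \<open>U\<close> contains \<open>{\<bar>g\<bar> > t}\<close> and is not much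
  larger. Every point of \<open>U\<close> then lies in a stopping cube, which makes Lebesgue differentiation
  unnecessary. As \<open>g\<close> is bounded, all but finitely many of the stopping cubes can be left in the good part.\<close>
lemma calderon_zygmund_decomposition:
  fixes g :: "'a::euclidean_space \<Rightarrow> complex"
  assumes g: "integrable lebesgue g" and M: "\<And>x. norm (g x) \<le> M" and q: "0 < snd q"
    and supp: "\<And>x. x \<notin> hcube q \<Longrightarrow> g x = 0"
    and I: "(L1norm g) \<le> I" "0 < I" and t: "3 * I < t * vol q"
  obtains F G b where "finite F" "\<forall>p\<in>F. 0 < snd p" "(\<Sum>p\<in>F. vol p) \<le> 3 * I / t"
    "integrable lebesgue G" "L2 G" "(LINT x|lebesgue. (norm (G x))\<^sup>2) \<le> (3 * 2 ^ DIM('a) + 1) * t * I"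
    "\<forall>p\<in>F. integrable lebesgue (b p)" "\<forall>p\<in>F. \<forall>x. x \<notin> hcube p \<longrightarrow> b p x = 0"
    "\<forall>p\<in>F. (LINT x|lebesgue. b p x) = 0" "(\<Sum>p\<in>F. LINT x|lebesgue. norm (b p x)) \<le> 2 * I"
    "\<forall>x. g x = G x + (\<Sum>p\<in>F. b p x)"
proof -
  have [measurable]: "g \<in> borel_measurable lebesgue" using g by (rule borel_measurable_integrable)
  have ng: "integrable lebesgue (\<lambda>x. norm (g x))" using g by simp
  have t0: "0 < t" using t I q by (smt (verit) zero_less_mult_iff zero_less_power)
  have M0: "0 \<le> M" using M[of undefined] norm_ge_zero order_trans by blast
  define V where "V = {x. t < norm (g x)}"
  have V: "V \<in> sets lebesgue"
  proof -
    have "{x \<in> space lebesgue. t < norm (g x)} \<in> sets lebesgue" by measurable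
    then show ?thesis by (simp add: V_def)
  qed
  have eV: "emeasure lebesgue V \<le> ennreal (I / t)"
  proof -
    have "(\<integral>\<^sup>+x. ennreal (norm (g x)) \<partial>lebesgue) = ennreal (L1norm g)"
      using ng by (intro nn_integral_eq_integral) auto
    also have "\<dots> \<le> ennreal I" using I by (intro ennreal_leI)
    finally have "emeasure lebesgue {x. ennreal t < ennreal (norm (g x))} \<le> ennreal (I / t)"
      using t0 by (intro emeasure_gt_le) auto
    then show ?thesis using t0 by (simp add: V_def ennreal_less_iff)
  qed
  obtain U where U: "open U" "V \<subseteq> U" "emeasure lebesgue (U - V) < ennreal (I / t)"
    using sets_lebesgue_outer_open[OF V, of "I / t"] I t0 by (metis divide_pos_pos)
  have Um: "U \<in> sets lebesgue" using U(1) by (simp add: borel_open)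
  have eU: "emeasure lebesgue U \<le> ennreal (2 * I / t)"
  proof -
    have "emeasure lebesgue U = emeasure lebesgue (V \<union> (U - V))" using U(2) by (simp add: Un_absorb1)
    also have "\<dots> \<le> emeasure lebesgue V + emeasure lebesgue (U - V)"
      by (rule emeasure_subadditive) (use V Um in auto)
    also have "\<dots> \<le> ennreal (I / t) + ennreal (I / t)" using eV U(3) by (intro add_mono) auto
    also have "\<dots> = ennreal (2 * I / t)" using I t0 by (simp flip: ennreal_plus)
    finally show ?thesis .
  qed
  have Ufin: "emeasure lebesgue U < \<infinity>" using eU by (auto intro: le_less_trans)
  have mU: "measure lebesgue U \<le> 2 * I / t" using eU I t0 unfolding measure_def by (intro enn2real_leI) auto
  \<comment> \<open>The mass of \<open>h\<close> is at most \<open>I\<close> plus \<open>t\<close>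
    times the measure of \<open>U\<close>, hence at most \<open>3 * I\<close>. This is the origin of
    \<open>3 * I\<close> in the hypothesis on \<open>q\<close> and in the volume bound.\<close>
  define h where "h x = norm (g x) + t * indicator U x" for x
  have iU: "integrable lebesgue (\<lambda>x. indicator U x :: real)" using Um Ufin by simp
  have h: "integrable lebesgue h" unfolding h_def using ng iU by simp
  have h0: "0 \<le> h x" for x using t0 by (simp add: h_def)
  have gh: "norm (g x) \<le> h x" for x using t0 by (simp add: h_def)
  have "(LINT x|lebesgue. h x) = (L1norm g) + t * measure lebesgue U"
    unfolding h_def using ng iU Um Ufin by simp
  also have "\<dots> \<le> I + t * (2 * I / t)" using I mU t0 by (intro add_mono mult_left_mono) auto
  finally have Ih: "(LINT x|lebesgue. h x) \<le> 3 * I" using t0 by simp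
  have icut: "integrable lebesgue (cutoff (hcube p) h)" for p using integrable_cutoff[OF h] by simp
  define S where "S p \<longleftrightarrow> t * vol p \<le> (LINT x|lebesgue. cutoff (hcube p) h x)" for p :: "'a \<times> real"
  have cutmono: "(LINT x|lebesgue. cutoff A h x) \<le> (LINT x|lebesgue. cutoff B h x)"
    if "A \<subseteq> B" "A \<in> sets lebesgue" "B \<in> sets lebesgue" for A B
    using that h0 by (intro integral_mono integrable_cutoff h) (auto simp: cutoff_def)
  have Sq: "\<not> S q"
  proof -
    have "(LINT x|lebesgue. cutoff (hcube q) h x) \<le> (LINT x|lebesgue. cutoff UNIV h x)" by (rule cutmono) auto
    also have "\<dots> \<le> 3 * I" using Ih by (simp add: cutoff_def)
    finally show ?thesis using t by (simp add: S_def)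
  qed
  define F0 where "F0 = stopping S q"
  have F0: "0 < snd p" "hcube p \<subseteq> hcube q" "S p" if "p \<in> F0" for p
    using stopping_subset[OF q, of p S] that by (simp_all add: F0_def)
  have dis: "hcube p \<inter> hcube p' = {}" if "p \<in> F0" "p' \<in> F0" "p \<noteq> p'" for p p'
    using stopping_disjoint[OF q] that by (simp add: F0_def)
  have cF0: "countable F0" using countable_stopping[OF q] by (simp add: F0_def)
  have cover: "norm (g x) \<le> t" if x: "x \<notin> (\<Union>p\<in>F0. hcube p)" for x
  proof (rule ccontr)
    assume "\<not> norm (g x) \<le> t"
    then have "x \<in> V" and xq: "x \<in> hcube q" using supp[of x] t0 by (cases "x \<in> hcube q"; simp add: V_def)+
    then obtain n where n: "hcube (dcube q n x) \<subseteq> U" using U dcube_in_open[OF q] by blast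
    have "t * vol (dcube q n x) = (LINT y|lebesgue. t * indicator (hcube (dcube q n x)) y)"
      using q measure_hcube[of "dcube q n x"] by simp
    also have "\<dots> \<le> (LINT y|lebesgue. cutoff (hcube (dcube q n x)) h y)"
    proof (rule integral_mono)
      show "integrable lebesgue (\<lambda>y. t * indicator (hcube (dcube q n x)) y)"
        using hcube_lmeasurable[of "dcube q n x"] q by (simp add: fmeasurable_def)
      fix y
      show "t * indicator (hcube (dcube q n x)) y \<le> cutoff (hcube (dcube q n x)) h y"
        using n by (auto simp: cutoff_def h_def indicator_def)
    qed (rule icut)
    finally have "S (dcube q n x)" by (simp add: S_def)
    then show False using stopping_covers[OF q xq] x by (metis F0_def UN_I)
  qed
  \<comment> \<open>The parent is not stopping, so its mean of \<open>h\<close> is below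
    \<open>t\<close>; passing to the child costs the volume ratio
    \<open>2 ^ DIM('a)\<close>.\<close>
  have avg: "(LINT x|lebesgue. cutoff (hcube p) h x) \<le> 2 ^ DIM('a) * t * vol p" if "p \<in> F0" for p
  proof -
    have "p \<in> stopping S q" using that by (simp add: F0_def)
    then obtain n x where p: "p = dcube q (Suc n) x" "\<And>m. m \<le> n \<Longrightarrow> \<not> S (dcube q m x)"
      using stopping_ancestors[of q S p, OF q Sq] by blast
    have "(LINT x|lebesgue. cutoff (hcube p) h x) \<le> (LINT y|lebesgue. cutoff (hcube (dcube q n x)) h y)"
      using hcube_dcube_Suc[OF q] by (intro cutmono) (auto simp: p)
    also have "\<dots> \<le> t * vol (dcube q n x)" using p(2)[of n] by (simp add: S_def)
    also have "\<dots> = 2 ^ DIM('a) * t * vol p" by (simp add: p(1) power_divide power_mult_distrib)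
    finally show ?thesis .
  qed
  \<comment> \<open>On the cubes left out of \<open>F\<close> the good part is still
    \<open>g\<close>, bounded only by \<open>M\<close>; the choice of \<open>\<delta>\<close> makes
    their share \<open>M\<^sup>2 * \<delta>\<close> of the L2 bound at most \<open>t * I\<close>.
    The summand 1 covers \<open>M = 0\<close>.\<close>
  define \<delta> where "\<delta> = t * I / (M\<^sup>2 + 1)"
  have d0: "0 < \<delta>" using t0 I by (simp add: \<delta>_def add_nonneg_pos)
  let ?O = "\<Union>p\<in>F0. hcube p"
  have Om: "?O \<in> sets lebesgue" using cF0 by (intro sets.countable_UN') auto
  have "emeasure lebesgue ?O \<le> emeasure lebesgue (hcube q)"
    using F0(2) by (intro emeasure_mono) auto
  then have "emeasure lebesgue ?O < \<infinity>" using q by (simp add: emeasure_hcube le_less_trans)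
  then obtain F where F: "finite F" "F \<subseteq> F0" "emeasure lebesgue (?O - (\<Union>p\<in>F. hcube p)) < ennreal \<delta>"
    using finite_subfamily_approx[OF cF0, of hcube lebesgue "ennreal \<delta>"] d0 by auto
  let ?R = "?O - (\<Union>p\<in>F. hcube p)"
  have Rm: "?R \<in> sets lebesgue" using Om F(1) by (intro sets.Diff[OF Om] sets.finite_UN) auto
  have mR: "measure lebesgue ?R \<le> \<delta>" using F(3) d0 unfolding measure_def by (intro enn2real_leI) auto
  have iR: "integrable lebesgue (\<lambda>x. indicator ?R x :: real)"
    using Rm less_trans[OF F(3) ennreal_less_top] by (intro integrable_real_indicator) auto
  define m where "m p = (LINT x|lebesgue. cutoff (hcube p) g x) / of_real (vol p)" for p
  define b where "b p = cutoff (hcube p) (\<lambda>x. g x - m p)" for p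
  have icg: "integrable lebesgue (cutoff (hcube p) g)" for p using integrable_cutoff[OF g] by simp
  have icm: "integrable lebesgue (cutoff (hcube p) (\<lambda>x. c))" if "p \<in> F0" for p and c :: complex
    unfolding cutoff_eq_indicator using F0(1)[OF that] by (simp add: emeasure_hcube)
  have b_split: "b p = (\<lambda>x. cutoff (hcube p) g x - cutoff (hcube p) (\<lambda>x. m p) x)" for p
    by (auto simp: b_def cutoff_def)
  have bint: "integrable lebesgue (b p)" if "p \<in> F0" for p
    unfolding b_split using icg icm[OF that] by simp
  have int_m: "(LINT x|lebesgue. cutoff (hcube p) (\<lambda>x. c) x) = of_real (vol p) * c" if "p \<in> F0" for p and c :: complex
    unfolding cutoff_eq_indicator using F0(1)[OF that] measure_hcube[of p]
    by (simp add: emeasure_hcube scaleR_conv_of_real)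
  have b0: "(LINT x|lebesgue. b p x) = 0" if "p \<in> F0" for p
    unfolding b_split using icg icm[OF that] int_m[OF that] F0(1)[OF that] by (simp add: m_def)
  have nm: "norm (m p) * vol p \<le> (LINT x|lebesgue. cutoff (hcube p) (\<lambda>x. norm (g x)) x)" if "p \<in> F0" for p
  proof -
    have "norm (m p) * vol p = norm (LINT x|lebesgue. cutoff (hcube p) g x)"
      using F0(1)[OF that] by (simp add: m_def norm_divide norm_power)
    also have "\<dots> \<le> (LINT x|lebesgue. norm (cutoff (hcube p) g x))" by (rule integral_norm_bound)
    finally show ?thesis by (simp add: norm_cutoff)
  qed
  have mle: "norm (m p) \<le> 2 ^ DIM('a) * t" if "p \<in> F0" for p
  proof -
    have "norm (m p) * vol p \<le> (LINT x|lebesgue. cutoff (hcube p) h x)"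
      using gh by (intro order_trans[OF nm[OF that]] integral_mono icut integrable_cutoff ng) (auto simp: cutoff_def)
    also have "\<dots> \<le> 2 ^ DIM('a) * t * vol p" by (rule avg[OF that])
    finally show ?thesis using F0(1)[OF that] by simp
  qed
  have nb: "(L1norm (b p)) \<le> 2 * (LINT x|lebesgue. cutoff (hcube p) (\<lambda>x. norm (g x)) x)" if "p \<in> F0" for p
  proof -
    have i1: "integrable lebesgue (cutoff (hcube p) (\<lambda>x. norm (g x)))" using integrable_cutoff[OF ng] by simp
    have i2: "integrable lebesgue (\<lambda>x. norm (m p) * indicator (hcube p) x)"
      using F0(1)[OF that] by (simp add: emeasure_hcube)
    have "(L1norm (b p)) \<le> (LINT x|lebesgue. cutoff (hcube p) (\<lambda>x. norm (g x)) x + norm (m p) * indicator (hcube p) x)"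
    proof (rule integral_mono)
      show "norm (b p x) \<le> cutoff (hcube p) (\<lambda>x. norm (g x)) x + norm (m p) * indicator (hcube p) x" for x
        by (simp add: b_def cutoff_def norm_triangle_ineq4)
    qed (use bint[OF that] i1 i2 in auto)
    also have "\<dots> = (LINT x|lebesgue. cutoff (hcube p) (\<lambda>x. norm (g x)) x) + norm (m p) * vol p"
      using i1 i2 F0(1)[OF that] by (simp add: measure_hcube)
    finally show ?thesis using nm[OF that] by simp
  qed
  have FF0: "p \<in> F0" if "p \<in> F" for p using F(2) that by blast
  have sumb: "(\<Sum>p\<in>F. LINT x|lebesgue. norm (b p x)) \<le> 2 * I"
  proof -
    have "(\<Sum>p\<in>F. LINT x|lebesgue. norm (b p x)) \<le> (\<Sum>p\<in>F. 2 * (LINT x|lebesgue. cutoff (hcube p) (\<lambda>x. norm (g x)) x))"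
      using nb FF0 by (intro sum_mono) blast
    also have "\<dots> = 2 * (\<Sum>p\<in>F. LINT x|lebesgue. cutoff (hcube p) (\<lambda>x. norm (g x)) x)" by (simp add: sum_distrib_left)
    also have "\<dots> \<le> 2 * (L1norm g)"
      using dis FF0 ng F(1) by (intro mult_left_mono sum_integral_cutoff_le) auto
    finally show ?thesis using I by simp
  qed
  define G where "G x = g x - (\<Sum>p\<in>F. b p x)" for x
  have G: "integrable lebesgue G" unfolding G_def using g bint FF0 by (intro Bochner_Integration.integrable_diff Bochner_Integration.integrable_sum) auto
  have Gin: "G x = m p" if "p \<in> F" "x \<in> hcube p" for p x
  proof -
    have "(\<Sum>p'\<in>F. b p' x) = (\<Sum>p'\<in>F. if p' = p then g x - m p else 0)"
    proof (rule sum.cong[OF refl])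
      fix p' assume p': "p' \<in> F"
      show "b p' x = (if p' = p then g x - m p else 0)"
      proof (cases "p' = p")
        case False
        then have "x \<notin> hcube p'" using dis[OF FF0[OF p'] FF0[OF that(1)]] that by blast
        then show ?thesis using False by (simp add: b_def cutoff_def)
      qed (simp add: b_def cutoff_def that)
    qed
    then show ?thesis using that F(1) by (simp add: G_def)
  qed
  have Gout: "G x = g x" if "x \<notin> (\<Union>p\<in>F. hcube p)" for x
  proof -
    have "(\<Sum>p'\<in>F. b p' x) = 0" using that by (intro sum.neutral) (auto simp: b_def cutoff_def)
    then show ?thesis by (simp add: G_def)
  qed
  have one: "1 \<le> (2::real) ^ DIM('a)" by simp
  have GM: "norm (G x) \<le> M + 2 ^ DIM('a) * t" for x
  proof (cases "x \<in> (\<Union>p\<in>F. hcube p)")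
    case True
    then show ?thesis using Gin mle FF0 M0 by (fastforce intro: order_trans)
  next
    case False
    then show ?thesis using Gout[of x] M[of x] t0 by (simp add: add_increasing2)
  qed
  have GL2: "L2 G" by (rule L2_bounded[OF G GM])
  have IG: "(L1norm G) \<le> 3 * I"
  proof -
    have "(L1norm G) \<le> (LINT x|lebesgue. norm (g x) + (\<Sum>p\<in>F. norm (b p x)))"
    proof (rule integral_mono)
      show "norm (G x) \<le> norm (g x) + (\<Sum>p\<in>F. norm (b p x))" for x
        unfolding G_def by (intro order_trans[OF norm_triangle_ineq4] add_mono order_refl norm_sum)
    qed (use G ng bint FF0 in auto)
    also have "\<dots> = (L1norm g) + (\<Sum>p\<in>F. LINT x|lebesgue. norm (b p x))"
      using ng bint FF0 by (simp add: Bochner_Integration.integral_sum)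
    finally show ?thesis using sumb I by linarith
  qed
  have G2: "(LINT x|lebesgue. (norm (G x))\<^sup>2) \<le> (3 * 2 ^ DIM('a) + 1) * t * I"
  proof -
    \<comment> \<open>On a kept cube \<open>G\<close> is the mean \<open>m p\<close>, on
      \<open>?R\<close> it is \<open>g\<close> with height \<open>M\<close>, elsewhere it is
      \<open>g\<close> with height \<open>t\<close>. Where the height is at most
      \<open>2 ^ DIM('a) * t\<close>, one factor of the square is traded for it, and the L1 norm of
      \<open>G\<close> takes over.\<close>
    have pt: "(norm (G x))\<^sup>2 \<le> 2 ^ DIM('a) * t * norm (G x) + M\<^sup>2 * indicator ?R x" for x
    proof -
      have small: ?thesis if "norm (G x) \<le> 2 ^ DIM('a) * t"
        using mult_right_mono[OF that, of "norm (G x)"] by (simp add: power2_eq_square add_increasing2)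
      consider p where "p \<in> F" "x \<in> hcube p" | "x \<in> ?R" | "x \<notin> (\<Union>p\<in>F. hcube p)" "x \<notin> ?O" using F(2) by blast
      then show ?thesis
      proof cases
        case 1
        then show ?thesis using small Gin mle FF0 by metis
      next
        case 2
        then have "G x = g x" using Gout by blast
        then have "(norm (G x))\<^sup>2 \<le> M\<^sup>2" using M[of x] by (simp add: power_mono)
        then show ?thesis using 2 t0 by (simp add: add_increasing)
      next
        case 3
        then have "norm (G x) \<le> t" using Gout[of x] cover[of x] by simp
        also have "t \<le> 2 ^ DIM('a) * t" using one t0 by simp
        finally show ?thesis by (rule small)
      qed
    qed
    have "(LINT x|lebesgue. (norm (G x))\<^sup>2) \<le> (LINT x|lebesgue. 2 ^ DIM('a) * t * norm (G x) + M\<^sup>2 * indicator ?R x)"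
      using GL2 G iR by (intro integral_mono pt) (auto simp: L2_def)
    also have "\<dots> = 2 ^ DIM('a) * t * (L1norm G) + M\<^sup>2 * measure lebesgue ?R"
      using G iR Rm by simp
    also have "\<dots> \<le> 2 ^ DIM('a) * t * (3 * I) + M\<^sup>2 * \<delta>"
      using IG mR t0 by (intro add_mono mult_left_mono) auto
    also have "M\<^sup>2 * \<delta> \<le> t * I"
    proof -
      have "M\<^sup>2 * \<delta> \<le> (M\<^sup>2 + 1) * \<delta>" using d0 by simp
      also have "\<dots> = t * I" unfolding \<delta>_def using add_nonneg_pos[OF zero_le_power2[of M], of 1] by simp
      finally show ?thesis .
    qed
    finally show ?thesis by (simp add: algebra_simps)
  qed
  have sumF: "(\<Sum>p\<in>F. vol p) \<le> 3 * I / t"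
  proof -
    have "t * (\<Sum>p\<in>F. vol p) \<le> (\<Sum>p\<in>F. LINT x|lebesgue. cutoff (hcube p) h x)"
      unfolding sum_distrib_left using F0(3) FF0 by (intro sum_mono) (simp add: S_def)
    also have "\<dots> \<le> (LINT x|lebesgue. h x)"
      using dis FF0 h h0 F(1) by (intro sum_integral_cutoff_le) auto
    finally have "t * (\<Sum>p\<in>F. vol p) \<le> 3 * I" using Ih by simp
    then show ?thesis using t0 by (simp add: field_simps)
  qed
  show ?thesis
  proof (rule that[of F G b])
    show "\<forall>x. g x = G x + (\<Sum>p\<in>F. b p x)" by (simp add: G_def)
    show "\<forall>p\<in>F. \<forall>x. x \<notin> hcube p \<longrightarrow> b p x = 0" by (simp add: b_def cutoff_def)
  qed (use F FF0 F0 sumF G GL2 G2 bint b0 sumb in blast)+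
qed

section \<open>Countable unions and a covering estimate\<close>

lemma lebesgue_sets_compl: "A \<in> sets lebesgue \<Longrightarrow> - A \<in> sets lebesgue"
  using sets.compl_sets[of A lebesgue] by (simp add: Compl_eq_Diff_UNIV)

lemma emeasure_UN_le_finite:
  assumes F: "countable F" and meas: "\<And>p. p \<in> F \<Longrightarrow> A p \<in> sets M"
    and le: "\<And>F'. finite F' \<Longrightarrow> F' \<subseteq> F \<Longrightarrow> emeasure M (\<Union>p\<in>F'. A p) \<le> c"
  shows "emeasure M (\<Union>p\<in>F. A p) \<le> c"
proof (cases "F = {}")
  case False
  let ?F = "\<lambda>n. from_nat_into F ` {..<n}"
  let ?B = "\<lambda>n. \<Union>p\<in>?F n. A p"
  have sub: "?F n \<subseteq> F" for n using False by (auto intro: from_nat_into)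
  have B: "?B n \<in> sets M" for n
  proof (rule sets.finite_UN)
    fix p assume "p \<in> ?F n"
    with sub show "A p \<in> sets M" by (intro meas) blast
  qed simp
  have "(\<Union>p\<in>F. A p) = (\<Union>n. ?B n)"
  proof
    show "(\<Union>p\<in>F. A p) \<subseteq> (\<Union>n. ?B n)"
    proof
      fix x assume "x \<in> (\<Union>p\<in>F. A p)"
      then obtain p where p: "p \<in> F" "x \<in> A p" by blast
      obtain n where "from_nat_into F n = p" using from_nat_into_surj[OF F p(1)] by blast
      then have "p \<in> ?F (Suc n)" by blast
      then show "x \<in> (\<Union>n. ?B n)" using p by blast
    qed
  qed (use sub in blast)
  then have "emeasure M (\<Union>p\<in>F. A p) = emeasure M (\<Union>n. ?B n)" by (rule arg_cong)
  also have "\<dots> = (SUP n. emeasure M (?B n))"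
  proof (rule SUP_emeasure_incseq[symmetric])
    show "range ?B \<subseteq> sets M" using B by blast
    show "incseq ?B" by (intro incseq_SucI) (auto simp: lessThan_Suc)
  qed
  also have "\<dots> \<le> c" by (intro SUP_least le sub) simp
  finally show ?thesis .
qed (use le[of "{}"] in simp)

text \<open>Countable subadditivity with the bounds summed over finite subfamilies only, so that
  disjointness arguments for finite sums apply directly.\<close>

lemma emeasure_UN_le_sum:
  assumes F: "countable F" and meas: "\<And>p. p \<in> F \<Longrightarrow> A p \<in> sets lebesgue"
    and a: "\<And>p. p \<in> F \<Longrightarrow> emeasure lebesgue (A p) \<le> ennreal (a p)" "\<And>p. p \<in> F \<Longrightarrow> 0 \<le> a p"
    and le: "\<And>F'. finite F' \<Longrightarrow> F' \<subseteq> F \<Longrightarrow> (\<Sum>p\<in>F'. a p) \<le> c"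
  shows "emeasure lebesgue (\<Union>p\<in>F. A p) \<le> ennreal c"
proof (rule emeasure_UN_le_finite[OF F meas])
  fix F' assume F': "finite F'" "F' \<subseteq> F"
  have "emeasure lebesgue (\<Union>p\<in>F'. A p) \<le> (\<Sum>p\<in>F'. emeasure lebesgue (A p))"
    using F' meas by (intro emeasure_subadditive_finite) auto
  also have "\<dots> \<le> (\<Sum>p\<in>F'. ennreal (a p))" using F' a by (intro sum_mono) blast
  also have "\<dots> = ennreal (\<Sum>p\<in>F'. a p)" using F' a by (intro sum_ennreal) blast
  also have "\<dots> \<le> ennreal c" using le[OF F'] by (rule ennreal_leI)
  finally show "emeasure lebesgue (\<Union>p\<in>F'. A p) \<le> ennreal c" .
qed

lemma star_subset_cball:
  fixes p :: "'a::euclidean_space \<times> real"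
  assumes "0 < snd p"
  shows "star p \<subseteq> cball (fst p) (real DIM('a) * (2 * real DIM('a) + 1) * snd p)"
proof
  fix y assume y: "y \<in> star p"
  have m: "0 < real DIM('a) * snd p" using assms by simp
  have "dist (fst p) y \<le> (\<Sum>i\<in>Basis. \<bar>(fst p - y) \<bullet> i\<bar>)"
    unfolding dist_norm by (rule norm_le_l1)
  also have "\<dots> \<le> (\<Sum>i\<in>(Basis::'a set). (2 * real DIM('a) + 1) * snd p)"
  proof (rule sum_mono)
    fix i :: 'a assume "i \<in> Basis"
    then have "fst p \<bullet> i - 2 * real DIM('a) * snd p \<le> y \<bullet> i" "y \<bullet> i \<le> fst p \<bullet> i + snd p + 2 * real DIM('a) * snd p"
      using y unfolding mem_star_iff by blast+
    then show "\<bar>(fst p - y) \<bullet> i\<bar> \<le> (2 * real DIM('a) + 1) * snd p"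
      using assms m unfolding inner_diff_left distrib_right by linarith
  qed
  also have "\<dots> = real DIM('a) * (2 * real DIM('a) + 1) * snd p" by simp
  finally show "y \<in> cball (fst p) (real DIM('a) * (2 * real DIM('a) + 1) * snd p)" by simp
qed

text \<open>This replaces the weak type bound of the Hardy--Littlewood maximal function.\<close>
lemma emeasure_heavy_cubes_le:
  fixes w :: "'a::euclidean_space \<Rightarrow> real"
  assumes pos: "\<And>p. p \<in> F \<Longrightarrow> 0 < snd p \<and> snd p \<le> L"
    and w: "integrable lebesgue w" "\<And>x. 0 \<le> w x" and A: "0 < A"
    and heavy: "\<And>p. p \<in> F \<Longrightarrow> A * vol p < (LINT x|lebesgue. cutoff (star p) w x)"
    and F: "countable F"
  shows "emeasure lebesgue (\<Union>p\<in>F. hcube p)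
    \<le> ennreal ((10 * (real DIM('a) * (2 * real DIM('a) + 1))) ^ DIM('a) * (LINT x|lebesgue. w x) / A)"
proof -
  define N where "N = real DIM('a) * (2 * real DIM('a) + 1)"
  have N: "0 < N" by (simp add: N_def add_nonneg_pos)
  have sub: "star p \<subseteq> cball (fst p) (N * snd p)" if "p \<in> F" for p
    using star_subset_cball[of p] pos[OF that] by (simp add: N_def)
  have r: "0 < N * snd p \<and> N * snd p \<le> N * L" if "p \<in> F" for p
    using pos[OF that] N by simp
  have S: "(\<Union>p\<in>F. hcube p) \<subseteq> (\<Union>p\<in>F. cball (fst p) (N * snd p))"
    using sub hcube_subset_star pos by blast
  \<comment> \<open>Each \<open>star p\<close> lies in a ball of radius \<open>N * snd p\<close>.
    The Vitali lemma selects disjoint balls whose fivefold enlargements cover all the cubes, each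
    inside a cube of side \<open>10 * N * snd p\<close>. Disjoint balls contain disjoint sets
    \<open>star p\<close>, so the integrals of \<open>w\<close> over these add up to at most the
    full integral.\<close>
  obtain C where C: "countable C" "C \<subseteq> F"
     "pairwise (\<lambda>i j. disjnt (cball (fst i) (N * snd i)) (cball (fst j) (N * snd j))) C"
     "(\<Union>p\<in>F. hcube p) \<subseteq> (\<Union>i\<in>C. cball (fst i) (5 * (N * snd i)))"
    by (rule Vitali_covering_lemma_cballs[OF S r])
  have cb: "cball c r \<in> sets lebesgue" for c :: 'a and r
    using lmeasurable_cball by (rule fmeasurableD)
  have "emeasure lebesgue (\<Union>p\<in>F. hcube p) \<le> emeasure lebesgue (\<Union>i\<in>C. cball (fst i) (5 * (N * snd i)))"
    using C cb by (intro emeasure_mono sets.countable_UN') auto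
  also have "\<dots> \<le> ennreal ((10 * N) ^ DIM('a) * (LINT x|lebesgue. w x) / A)"
  proof (rule emeasure_UN_le_sum[OF C(1)])
    fix p assume "p \<in> C"
    then have p: "0 < snd p" using C(2) pos by blast
    show "emeasure lebesgue (cball (fst p) (5 * (N * snd p))) \<le> ennreal ((10 * N) ^ DIM('a) * vol p)"
    proof -
      have "2 * (5 * (N * snd p)) = 10 * N * snd p" by simp
      then show ?thesis
        using emeasure_cball_le[of "5 * (N * snd p)" "fst p"] p N by (simp only: power_mult_distrib) simp
    qed
    show "0 \<le> (10 * N) ^ DIM('a) * vol p" using N p by simp
  next
    fix F' assume F': "finite F'" "F' \<subseteq> C"
    have "A * (\<Sum>p\<in>F'. vol p) \<le> (\<Sum>p\<in>F'. LINT x|lebesgue. cutoff (star p) w x)"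
      unfolding sum_distrib_left using F' C(2) heavy by (intro sum_mono less_imp_le) blast
    also have "\<dots> \<le> (LINT x|lebesgue. w x)"
    proof (rule sum_integral_cutoff_le[OF F'(1) _ _ w])
      fix p q assume pq: "p \<in> F'" "q \<in> F'" "p \<noteq> q"
      then have "disjnt (cball (fst p) (N * snd p)) (cball (fst q) (N * snd q))"
        using C(3) F'(2) unfolding pairwise_def by blast
      moreover have "p \<in> F" "q \<in> F" using pq F'(2) C(2) by auto
      ultimately show "star p \<inter> star q = {}" using sub[of p] sub[of q] unfolding disjnt_def by blast
    qed simp
    finally have "(\<Sum>p\<in>F'. vol p) \<le> (LINT x|lebesgue. w x) / A"
      using A by (simp add: field_simps)
    then have "(10 * N) ^ DIM('a) * (\<Sum>p\<in>F'. vol p) \<le> (10 * N) ^ DIM('a) * ((LINT x|lebesgue. w x) / A)"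
      using N by (intro mult_left_mono) auto
    then show "(\<Sum>p\<in>F'. (10 * N) ^ DIM('a) * vol p) \<le> (10 * N) ^ DIM('a) * (LINT x|lebesgue. w x) / A"
      by (simp add: sum_distrib_left)
  qed (rule cb)
  finally show ?thesis by (simp add: N_def)
qed

section \<open>From the decomposition to exceptional sets of small proportion\<close>

context cz_operator
begin

lemma T_L2_bound:
  obtains A where "0 \<le> A" "\<And>f. L2 f \<Longrightarrow> L2 (T f)"
    "\<And>f. L2 f \<Longrightarrow> (LINT x|lebesgue. (norm (T f x))\<^sup>2) \<le> A * (LINT x|lebesgue. (norm (f x))\<^sup>2)"
proof -
  have "\<exists>A. \<forall>f. L2 f \<longrightarrow> L2 (T f) \<and> L2norm (T f) \<le> A * L2norm f"
    using cz unfolding CZ_omega_Dini_def by (elim conjE)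
  then obtain A where A: "\<And>f. L2 f \<Longrightarrow> L2 (T f)" "\<And>f. L2 f \<Longrightarrow> L2norm (T f) \<le> A * L2norm f" by blast
  show ?thesis
  proof (rule that[of "A\<^sup>2"])
    fix f :: "'a \<Rightarrow> complex" assume f: "L2 f"
    have "0 \<le> L2norm (T f)" by (simp add: L2norm_def)
    then have "(L2norm (T f))\<^sup>2 \<le> (A * L2norm f)\<^sup>2" using A(2)[OF f] by (rule power_mono[rotated])
    then show "(LINT x|lebesgue. (norm (T f x))\<^sup>2) \<le> A\<^sup>2 * (LINT x|lebesgue. (norm (f x))\<^sup>2)"
      by (simp add: L2norm_def power_mult_distrib)
  qed (use A in auto)
qed

text \<open>Along the Calderon-Zygmund decomposition, \<open>T g\<close> exceeds
  \<open>2 * t\<close> only where \<open>T G\<close> exceeds \<open>t\<close>, or in a ball around a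
  bad cube, or where the bad functions contribute more than \<open>t\<close> off these balls.
  Chebyshev's inequality in L2, the total volume, and Chebyshev's inequality with
  \<open>T_atom\<close> bound the three sets by multiples of \<open>I / t\<close>.\<close>

lemma weak_type_bounded:
  obtains C where "0 \<le> C" "\<And>g M q I t. integrable lebesgue g \<Longrightarrow> (\<And>x. norm (g x) \<le> M) \<Longrightarrow> 0 < snd q \<Longrightarrow>
    (\<And>x. x \<notin> hcube q \<Longrightarrow> g x = 0) \<Longrightarrow> (L1norm g) \<le> I \<Longrightarrow> 0 < I \<Longrightarrow>
    3 * I < t * vol q \<Longrightarrow> emeasure lebesgue {x. 2 * t < norm (T g x)} \<le> ennreal (C * I / t)"
proof -
  show ?thesis
  proof (rule T_L2_bound, rule T_atom, goal_cases)
  case (1 A B)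
  note A = 1(1-3) and B = 1(4,5)
  define C where "C = A * (3 * 2 ^ DIM('a) + 1) + (4 * real DIM('a)) ^ DIM('a) * 3 + B * 2"
  show ?case
  proof (rule that[of C], goal_cases)
    case 1
    show ?case using A B by (simp add: C_def)
  next
    case (2 g M q I t)
    note g = 2(1) and M = 2(2) and q = 2(3) and supp = 2(4) and I = 2(5,6) and t = 2(7)
    have t0: "0 < t" using t I q by (smt (verit) zero_less_mult_iff zero_less_power)
    obtain F G b where D0: "finite F" "\<forall>p\<in>F. 0 < snd p" "(\<Sum>p\<in>F. vol p) \<le> 3 * I / t"
      "integrable lebesgue G" "L2 G" "(LINT x|lebesgue. (norm (G x))\<^sup>2) \<le> (3 * 2 ^ DIM('a) + 1) * t * I"
      "\<forall>p\<in>F. integrable lebesgue (b p)" "\<forall>p\<in>F. \<forall>x. x \<notin> hcube p \<longrightarrow> b p x = 0"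
      "\<forall>p\<in>F. (LINT x|lebesgue. b p x) = 0" "(\<Sum>p\<in>F. LINT x|lebesgue. norm (b p x)) \<le> 2 * I"
      "\<forall>x. g x = G x + (\<Sum>p\<in>F. b p x)"
      by (rule calderon_zygmund_decomposition[OF g M q supp I t])
    note D = D0[rule_format]
    let ?B = "\<lambda>p. cball (fst p) (2 * real DIM('a) * snd p)"
    define u where "u x = (\<Sum>p\<in>F. ennreal (norm (T (b p) x)) * indicator (- ?B p) x)" for x
    have Bm [measurable]: "?B p \<in> sets lebesgue" for p
      using lmeasurable_cball by (rule fmeasurableD)
    have [measurable]: "T (b p) \<in> borel_measurable lebesgue" if "p \<in> F" for p using T_measurable D(7)[OF that] .
    have TG [measurable]: "T G \<in> borel_measurable lebesgue" using T_measurable D(4) .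
    have um [measurable]: "u \<in> borel_measurable lebesgue"
      unfolding u_def by (intro borel_measurable_sum borel_measurable_times_ennreal) measurable
    have "AE x in lebesgue. T (\<lambda>x. G x + (\<Sum>p\<in>F. b p x)) x = T G x + T (\<lambda>x. \<Sum>p\<in>F. b p x) x"
      using D by (intro T_add Bochner_Integration.integrable_sum) auto
    moreover have "AE x in lebesgue. T (\<lambda>x. \<Sum>p\<in>F. b p x) x = (\<Sum>p\<in>F. T (b p) x)"
      using D by (intro T_sum) auto
    ultimately have lin: "AE x in lebesgue. T g x = T G x + (\<Sum>p\<in>F. T (b p) x)"
      unfolding D(11)[symmetric] by eventually_elim simp
    let ?E1 = "{x. ennreal (t\<^sup>2) < ennreal ((norm (T G x))\<^sup>2)}" and ?E2 = "\<Union>p\<in>F. ?B p" and ?E3 = "{x. ennreal t < u x}"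
    have m1: "?E1 \<in> sets lebesgue"
    proof -
      have "{x \<in> space lebesgue. ennreal (t\<^sup>2) < ennreal ((norm (T G x))\<^sup>2)} \<in> sets lebesgue" by measurable
      then show ?thesis by simp
    qed
    have m2: "?E2 \<in> sets lebesgue" using D(1) Bm by (intro sets.finite_UN) auto
    have m3: "?E3 \<in> sets lebesgue"
    proof -
      have "{x \<in> space lebesgue. ennreal t < u x} \<in> sets lebesgue" by measurable
      then show ?thesis by simp
    qed
    have "emeasure lebesgue {x. 2 * t < norm (T g x)} \<le> emeasure lebesgue (?E1 \<union> ?E2 \<union> ?E3)"
    proof (rule emeasure_mono_AE)
      show "AE x in lebesgue. x \<in> {x. 2 * t < norm (T g x)} \<longrightarrow> x \<in> ?E1 \<union> ?E2 \<union> ?E3"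
        using lin
      proof eventually_elim
        case (elim x)
        show ?case
        proof
          assume "x \<in> {x. 2 * t < norm (T g x)}"
          then have big: "2 * t < norm (T G x) + norm (\<Sum>p\<in>F. T (b p) x)"
            using elim norm_triangle_ineq[of "T G x" "\<Sum>p\<in>F. T (b p) x"] by simp
          show "x \<in> ?E1 \<union> ?E2 \<union> ?E3"
          proof (cases "t < norm (T G x) \<or> x \<in> ?E2")
            case True
            then show ?thesis using t0 by (auto simp: ennreal_less_iff power_strict_mono)
          next
            case False
            then have "u x = (\<Sum>p\<in>F. ennreal (norm (T (b p) x)))"
              unfolding u_def by (intro sum.cong refl) auto
            also have "\<dots> = ennreal (\<Sum>p\<in>F. norm (T (b p) x))" by (rule sum_ennreal) simp
            finally have ux: "u x = ennreal (\<Sum>p\<in>F. norm (T (b p) x))" .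
            have "norm (\<Sum>p\<in>F. T (b p) x) \<le> (\<Sum>p\<in>F. norm (T (b p) x))" by (rule norm_sum)
            then have "t < (\<Sum>p\<in>F. norm (T (b p) x))" using big False by linarith
            then show ?thesis using t0 by (simp add: ux ennreal_less_iff)
          qed
        qed
      qed
      show "?E1 \<union> ?E2 \<union> ?E3 \<in> sets lebesgue" using m1 m2 m3 by blast
    qed
    also have "\<dots> \<le> emeasure lebesgue ?E1 + emeasure lebesgue ?E2 + emeasure lebesgue ?E3"
      using m1 m2 m3 by (intro order_trans[OF emeasure_subadditive] add_mono emeasure_subadditive order_refl) auto
    also have "\<dots> \<le> ennreal (A * ((3 * 2 ^ DIM('a) + 1) * t * I) / t\<^sup>2) + ennreal ((4 * real DIM('a)) ^ DIM('a) * (3 * I / t)) + ennreal (B * (2 * I) / t)"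
    proof (intro add_mono)
      have "(\<integral>\<^sup>+x. ennreal ((norm (T G x))\<^sup>2) \<partial>lebesgue) = ennreal (LINT x|lebesgue. (norm (T G x))\<^sup>2)"
        using A(2)[OF D(5)] by (intro nn_integral_eq_integral) (auto simp: L2_def)
      also have "\<dots> \<le> ennreal (A * ((3 * 2 ^ DIM('a) + 1) * t * I))"
        using A(1) D(6) by (intro ennreal_leI order_trans[OF A(3)[OF D(5)]] mult_left_mono)
      finally show "emeasure lebesgue ?E1 \<le> ennreal (A * ((3 * 2 ^ DIM('a) + 1) * t * I) / t\<^sup>2)"
        using t0 by (intro emeasure_gt_le) auto
      show "emeasure lebesgue ?E2 \<le> ennreal ((4 * real DIM('a)) ^ DIM('a) * (3 * I / t))"
      proof (rule emeasure_UN_le_sum)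
        show "countable F" using D(1) by (rule countable_finite)
        fix p assume "p \<in> F"
        then have p: "0 < snd p" by (rule D(2))
        show "emeasure lebesgue (?B p) \<le> ennreal ((4 * real DIM('a)) ^ DIM('a) * vol p)"
        proof -
          have "2 * (2 * real DIM('a) * snd p) = 4 * real DIM('a) * snd p" by simp
          then show ?thesis
            using emeasure_cball_le[of "2 * real DIM('a) * snd p" "fst p"] p by (simp only: power_mult_distrib) simp
        qed
        show "0 \<le> (4 * real DIM('a)) ^ DIM('a) * vol p" using p by simp
      next
        fix F' assume F': "finite F'" "F' \<subseteq> F"
        have "(\<Sum>p\<in>F'. vol p) \<le> (\<Sum>p\<in>F. vol p)"
          using D(2) by (intro sum_mono2[OF D(1) F'(2)]) (auto intro: less_imp_le)
        also have "\<dots> \<le> 3 * I / t" by (rule D(3))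
        finally show "(\<Sum>p\<in>F'. (4 * real DIM('a)) ^ DIM('a) * vol p) \<le> (4 * real DIM('a)) ^ DIM('a) * (3 * I / t)"
          unfolding sum_distrib_left[symmetric] by (rule mult_left_mono) simp
      qed (rule Bm)
      have "(\<integral>\<^sup>+x. u x \<partial>lebesgue) = (\<Sum>p\<in>F. \<integral>\<^sup>+x. ennreal (norm (T (b p) x)) * indicator (- ?B p) x \<partial>lebesgue)"
        unfolding u_def by (intro nn_integral_sum borel_measurable_times_ennreal) measurable
      also have "\<dots> \<le> (\<Sum>p\<in>F. ennreal (B * (L1norm (b p))))"
        using D by (intro sum_mono B(2)) auto
      also have "\<dots> = ennreal (\<Sum>p\<in>F. B * (L1norm (b p)))"
        using B(1) by (intro sum_ennreal) simp
      also have "\<dots> \<le> ennreal (B * (2 * I))"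
        using D(10) B(1) unfolding sum_distrib_left[symmetric] by (intro ennreal_leI mult_left_mono)
      finally show "emeasure lebesgue ?E3 \<le> ennreal (B * (2 * I) / t)"
        using t0 by (intro emeasure_gt_le um)
    qed
    also have "\<dots> = ennreal (A * ((3 * 2 ^ DIM('a) + 1) * t * I) / t\<^sup>2 + (4 * real DIM('a)) ^ DIM('a) * (3 * I / t) + B * (2 * I) / t)"
      using A(1) B(1) I t0 by (simp add: ennreal_plus)
    also have "A * ((3 * 2 ^ DIM('a) + 1) * t * I) / t\<^sup>2 + (4 * real DIM('a)) ^ DIM('a) * (3 * I / t) + B * (2 * I) / t = C * I / t"
      using t0 by (simp add: C_def field_simps power2_eq_square)
    finally show ?case .
  qed
  qed
qed

text \<open>Raising the level lowers the measure: at the level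
  \<open>2 * B * L1norm g / vol q\<close> the weak type bound gives the proportion
  \<open>C / B\<close> of the volume of \<open>q\<close>. Truncation and
  \<open>emeasure_T_limit\<close> extend it from bounded to integrable functions.\<close>

lemma weak_type:
  assumes e: "0 < \<epsilon>"
  obtains A where "0 \<le> A" "\<And>q g. 0 < snd q \<Longrightarrow> integrable lebesgue g \<Longrightarrow> (\<And>x. x \<notin> star q \<Longrightarrow> g x = 0) \<Longrightarrow>
    emeasure lebesgue {x. A * (L1norm g) / vol q < norm (T g x)} \<le> ennreal (\<epsilon> * vol q)"
proof -
  show ?thesis
  proof (rule weak_type_bounded, goal_cases)
  case (1 C)
  note C = 1
  \<comment> \<open>\<open>3 < B\<close> meets the condition \<open>3 * I < t * vol R\<close> on the
    level, and \<open>C / B \<le> \<epsilon>\<close> gives the prescribed proportion.\<close>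
  define B where "B = 4 + C / \<epsilon>"
  have B: "3 < B" "C / B \<le> \<epsilon>" using e C(1) by (auto simp: B_def field_simps add_pos_nonneg)
  show ?case
  proof (rule that[of "2 * B"], goal_cases)
    case 1
    show ?case using B by simp
  next
    case (2 q g)
    note q = 2(1) and g = 2(2) and supp = 2(3)
    define I where "I = (L1norm g)"
    show ?case
    \<comment> \<open>For \<open>I = 0\<close> the level is zero and no decomposition is available;
      then \<open>g\<close> vanishes almost everywhere, and so does \<open>T g\<close>.\<close>
    proof (cases "I = 0")
      case True
      then have "AE y in lebesgue. g y = 0"
        using integral_nonneg_eq_0_iff_AE[of lebesgue "\<lambda>y. norm (g y)"] g by (simp add: I_def)
      then have "AE x in lebesgue. T g x = T (\<lambda>y. 0) x" using g by (intro T_cong_AE) auto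
      then have "AE x in lebesgue. x \<notin> {x. 2 * B * I / vol q < norm (T g x)}"
        using T_zero by eventually_elim (simp add: True)
      then have "emeasure lebesgue {x. 2 * B * I / vol q < norm (T g x)} \<le> emeasure lebesgue ({} :: 'a set)"
        by - (rule emeasure_mono_AE, simp_all)
      then show ?thesis by (simp add: I_def)
    next
      case False
      moreover have "0 \<le> I" by (simp add: I_def)
      ultimately have I: "0 < I" by simp
      \<comment> \<open>The decomposition lives on a half-open cube. \<open>star q\<close> is closed
        with side \<open>(4 * d + 1) * snd q\<close>; one more side length of \<open>q\<close> makes
        room for its upper faces.\<close>
      define R where "R = (fst q - (2 * real DIM('a) * snd q) *\<^sub>R One, (4 * real DIM('a) + 2) * snd q)"
      have R: "0 < snd R" using q by (simp add: R_def add_nonneg_pos)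
      have "star q \<subseteq> hcube R"
      proof
        fix x assume x: "x \<in> star q"
        show "x \<in> hcube R"
          unfolding hcube_def mem_Collect_eq
        proof
          fix i :: 'a assume i: "i \<in> Basis"
          have "fst q \<bullet> i - 2 * real DIM('a) * snd q \<le> x \<bullet> i" "x \<bullet> i \<le> fst q \<bullet> i + snd q + 2 * real DIM('a) * snd q"
            using x i unfolding mem_star_iff by blast+
          moreover have "fst R \<bullet> i = fst q \<bullet> i - 2 * real DIM('a) * snd q" "snd R = 2 * (2 * real DIM('a) * snd q) + 2 * snd q"
            using i by (simp_all add: R_def inner_simps algebra_simps)
          ultimately show "fst R \<bullet> i \<le> x \<bullet> i \<and> x \<bullet> i < fst R \<bullet> i + snd R" using q by linarith
        qed
      qed
      then have suppR: "trunc g k x = 0" if "x \<notin> hcube R" for k x using supp[of x] that by (auto simp: trunc_def)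
      define t where "t = B * I / vol q"
      have "snd q \<le> snd R" using q by (simp add: R_def algebra_simps)
      then have "vol q \<le> vol R" using q by (intro power_mono) auto
      moreover have t0: "0 < t" using B I q by (simp add: t_def)
      ultimately have "t * vol q \<le> t * vol R" by simp
      moreover have "3 * I < t * vol q" using B I q by (simp add: t_def)
      ultimately have tR: "3 * I < t * vol R" by linarith
      have "emeasure lebesgue {x. 2 * t < norm (T g x)} \<le> ennreal (C * I / t)"
      proof (rule emeasure_T_limit[OF g integrable_trunc[OF g] L2_trunc[OF g] trunc_L1_tendsto[OF g]])
        fix k
        have "(LINT x|lebesgue. norm (trunc g k x)) \<le> I"
          unfolding I_def using g integrable_trunc[OF g] by (intro integral_mono norm_trunc_le) auto
        then show "emeasure lebesgue {x. 2 * t < norm (T (trunc g k) x)} \<le> ennreal (C * I / t)"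
          by (intro C(2)[OF integrable_trunc[OF g] norm_trunc_le(2) R suppR _ I tR]) 
      qed
      also have "C * I / t = (C / B) * vol q" using I B q by (simp add: t_def)
      also have "ennreal \<dots> \<le> ennreal (\<epsilon> * vol q)" using B q by (intro ennreal_leI mult_right_mono) auto
      finally show ?thesis by (simp add: t_def I_def mult.assoc)
    qed
  qed
  qed
qed

text \<open>The part of \<open>star q\<close> outside the dilate of the last cell is cut into layers
  between the dilates of consecutive cells around \<open>z\<close>. Points of layer \<open>k\<close>
  are at a distance at least comparable with the side of generation \<open>Suc k\<close>, while
  \<open>x\<close> and \<open>x'\<close> are closer to each other by the factor
  \<open>2 ^ (n - k)\<close>. The Dini condition gains \<open>\<omega> ((1/2) ^ Suc (n - k))\<close>
  there, the averages over all layers are controlled by \<open>B\<close>, and the gains are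
  summable.\<close>

lemma oscillation:
  obtains C where "0 \<le> C" "\<And>g q n z B x x'. integrable lebesgue g \<Longrightarrow> 0 < snd q \<Longrightarrow> z \<in> hcube q \<Longrightarrow>
    (\<And>y. y \<notin> star q \<Longrightarrow> g y = 0) \<Longrightarrow>
    (\<And>k. k \<le> n \<Longrightarrow> (LINT y|lebesgue. cutoff (star (dcube q k z)) (\<lambda>y. norm (g y)) y) \<le> B * (snd q / 2^k) ^ DIM('a)) \<Longrightarrow>
    x \<in> hcube (dcube q (Suc n) z) \<Longrightarrow> x' \<in> hcube (dcube q (Suc n) z) \<Longrightarrow>
    norm ((LINT y|lebesgue. K x y * cutoff (- star (dcube q (Suc n) z)) g y)
        - (LINT y|lebesgue. K x' y * cutoff (- star (dcube q (Suc n) z)) g y)) \<le> C * B"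
proof -
  obtain C where C: "0 \<le> C" "\<And>x x' y. x \<noteq> y \<Longrightarrow> dist x x' \<le> dist x y / 2 \<Longrightarrow>
        norm (K x y - K x' y) + norm (K y x - K y x') \<le> C / dist x y ^ DIM('a) * \<omega> (dist x x' / dist x y)"
    by (rule kernel_dini) blast
  show ?thesis
  proof (rule that[of "C * 2 ^ DIM('a) * omega_sum"], goal_cases)
    case 1
    show ?case using C omega_sum_nonneg by simp
  next
    case (2 g q n z B x x')
    note g = 2(1) and q = 2(2) and z = 2(3) and supp = 2(4) and B = 2(5) and x = 2(6) and x' = 2(7)
    let ?D = "\<lambda>k. dcube q k z"
    define g' where "g' = cutoff (- star (?D (Suc n))) g"
    have g': "integrable lebesgue g'" unfolding g'_def by (intro integrable_cutoff g) (simp add: lebesgue_sets_compl)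
    have int: "integrable lebesgue (\<lambda>y. K u y * g' y)" if u: "u \<in> hcube (?D (Suc n))" for u
    proof (rule kernel_mult_integrable[OF g'])
      show "0 < 2 * real DIM('a) * snd (?D (Suc n))" using q by simp
      fix y assume "dist u y < 2 * real DIM('a) * snd (?D (Suc n))"
      then have "y \<in> star (?D (Suc n))" using dist_hcube_star[OF u, of y] by linarith
      then show "g' y = 0" by (simp add: g'_def cutoff_def)
    qed
    let ?c = "\<lambda>k. C / (snd q / 2 ^ Suc k) ^ DIM('a) * \<omega> ((1/2) ^ Suc (n - k))"
    have c0: "0 \<le> ?c k" for k using C(1) q omega_half_nonneg[of "n - k"] by simp
    have icut: "integrable lebesgue (cutoff (star (?D k)) (\<lambda>y. norm (g y)))" for k
      using g by (intro integrable_cutoff) auto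
    have pt: "norm (K x y * g' y - K x' y * g' y) \<le> (\<Sum>k\<le>n. ?c k * cutoff (star (?D k)) (\<lambda>y. norm (g y)) y)" for y
    proof (cases "y \<in> star (?D (Suc n)) \<or> g y = 0")
      case True
      have "0 \<le> (\<Sum>k\<le>n. ?c k * cutoff (star (?D k)) (\<lambda>y. norm (g y)) y)"
        by (intro sum_nonneg mult_nonneg_nonneg[OF c0]) (simp add: cutoff_def)
      moreover have "g' y = 0" using True by (auto simp: g'_def cutoff_def)
      ultimately show ?thesis by simp
    next
      case False
      then have "y \<in> star q" using supp by blast
      then have y0: "y \<in> star (?D 0)" using dcube_0[OF q z] by simp
      \<comment> \<open>\<open>y\<close> is inside the dilate of generation 0 and outside that of
        generation \<open>Suc n\<close>, so at some step it is left behind.\<close>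
      have "\<exists>k. k \<le> n \<and> y \<in> star (?D k) \<and> y \<notin> star (?D (Suc k))"
      proof (rule ccontr)
        assume neg: "\<not> ?thesis"
        have "k \<le> Suc n \<Longrightarrow> y \<in> star (?D k)" for k
          by (induction k) (use y0 neg in auto)
        then show False using False by blast
      qed
      then obtain k where k: "k \<le> n" "y \<in> star (?D k)" "y \<notin> star (?D (Suc k))" by blast
      have xk: "x \<in> hcube (?D (Suc k))" using x hcube_dcube_mono[OF q, of "Suc k" "Suc n" z] k(1) by auto
      define s where "s = snd q / 2 ^ Suc k"
      have s: "0 < s" using q by (simp add: s_def)
      have far: "2 * real DIM('a) * s \<le> dist x y" using dist_hcube_star[OF xk k(3)] by (simp add: s_def)
      have d1: "1 \<le> real DIM('a)" by (simp add: Suc_leI)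
      have d2: "s \<le> 2 * real DIM('a) * s" using mult_right_mono[of 1 "2 * real DIM('a)" s] d1 s by linarith
      have "0 < dist x y" using far d2 s by linarith
      then have xy: "x \<noteq> y" by auto
      have e: "snd q / 2 ^ Suc n = s * (1/2) ^ (n - k)"
      proof -
        have "(2::real) ^ Suc n = 2 ^ Suc k * 2 ^ (n - k)" using k(1) by (simp flip: power_add)
        then show ?thesis by (simp add: s_def power_one_over)
      qed
      have xx': "dist x x' \<le> real DIM('a) * (s * (1/2) ^ (n - k))"
        using dist_hcube[OF x x'] unfolding snd_dcube e .
      have p1: "(1/2::real) ^ (n - k) \<le> 1" by (simp add: power_le_one)
      have "real DIM('a) * (s * (1/2) ^ (n - k)) \<le> real DIM('a) * s"
        using p1 s by (intro mult_left_mono) (auto simp: mult_le_cancel_left1)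
      then have half: "dist x x' \<le> dist x y / 2" using xx' far by linarith
      have "dist x x' / dist x y \<le> (real DIM('a) * (s * (1/2) ^ (n - k))) / (2 * real DIM('a) * s)"
        using xx' far s by (intro frac_le) auto
      also have "\<dots> = (1/2) ^ Suc (n - k)" using s by simp
      finally have r: "dist x x' / dist x y \<le> (1/2) ^ Suc (n - k)" .
      have "norm (K x y - K x' y) \<le> C / dist x y ^ DIM('a) * \<omega> (dist x x' / dist x y)"
        using C(2)[OF xy half] norm_ge_zero[of "K y x - K y x'"] by linarith
      also have "\<dots> \<le> C / s ^ DIM('a) * \<omega> ((1/2) ^ Suc (n - k))"
      proof (rule mult_mono)
        show "C / dist x y ^ DIM('a) \<le> C / s ^ DIM('a)"
          using order_trans[OF d2 far] s C xy by (intro divide_left_mono power_mono mult_pos_pos zero_less_power) auto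
        show "\<omega> (dist x x' / dist x y) \<le> \<omega> ((1/2) ^ Suc (n - k))"
          by (rule omega_mono[OF _ r]) (auto intro: power_le_one simp del: power_Suc)
        show "0 \<le> \<omega> (dist x x' / dist x y)"
          by (rule omega_nonneg) (use r power_le_one[of "1/2::real" "Suc (n - k)"] in \<open>auto intro: order_trans simp del: power_Suc\<close>)
      qed (use C s in auto)
      finally have Kle: "norm (K x y - K x' y) \<le> ?c k" by (simp add: s_def)
      have "norm (K x y * g' y - K x' y * g' y) = norm (K x y - K x' y) * norm (g' y)"
        by (metis left_diff_distrib norm_mult)
      also have "\<dots> \<le> ?c k * norm (g y)"
        using Kle c0 by (intro mult_mono) (auto simp: g'_def cutoff_def)
      also have "\<dots> = (\<Sum>k\<in>{k}. ?c k * cutoff (star (?D k)) (\<lambda>y. norm (g y)) y)" using k(2) by (simp add: cutoff_def)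
      also have "\<dots> \<le> (\<Sum>k\<le>n. ?c k * cutoff (star (?D k)) (\<lambda>y. norm (g y)) y)"
      proof (rule sum_mono2)
        show "0 \<le> ?c j * cutoff (star (?D j)) (\<lambda>y. norm (g y)) y" for j
          by (rule mult_nonneg_nonneg[OF c0[of j]]) (simp add: cutoff_def)
      qed (use k(1) in auto)
      finally show ?thesis .
    qed
    have B0: "0 \<le> B"
    proof -
      have "0 \<le> (LINT y|lebesgue. cutoff (star (?D 0)) (\<lambda>y. norm (g y)) y)"
        by (intro integral_nonneg_AE AE_I2) (simp add: cutoff_def)
      then have "0 \<le> B * (snd q / 2^0) ^ DIM('a)" using B[of 0] by linarith
      then show ?thesis using zero_less_power[OF q, of "DIM('a)"] by (auto simp: zero_le_mult_iff)
    qed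
    have "norm ((LINT y|lebesgue. K x y * g' y) - (LINT y|lebesgue. K x' y * g' y))
        = norm (LINT y|lebesgue. K x y * g' y - K x' y * g' y)"
      using int[OF x] int[OF x'] by simp
    also have "\<dots> \<le> (LINT y|lebesgue. norm (K x y * g' y - K x' y * g' y))" by (rule integral_norm_bound)
    also have "\<dots> \<le> (LINT y|lebesgue. (\<Sum>k\<le>n. ?c k * cutoff (star (?D k)) (\<lambda>y. norm (g y)) y))"
      using int[OF x] int[OF x'] icut
      by (intro integral_mono pt integrable_norm Bochner_Integration.integrable_diff Bochner_Integration.integrable_sum integrable_mult_right)
    also have "\<dots> = (\<Sum>k\<le>n. ?c k * (LINT y|lebesgue. cutoff (star (?D k)) (\<lambda>y. norm (g y)) y))"
      using icut by (subst Bochner_Integration.integral_sum) auto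
    also have "\<dots> \<le> (\<Sum>k\<le>n. C * 2 ^ DIM('a) * B * \<omega> ((1/2) ^ Suc (n - k)))"
    proof (rule sum_mono)
      fix k assume "k \<in> {..n}"
      then have "?c k * (LINT y|lebesgue. cutoff (star (?D k)) (\<lambda>y. norm (g y)) y) \<le> ?c k * (B * (snd q / 2^k) ^ DIM('a))"
        using B[of k] c0 by (intro mult_left_mono) auto
      also have "(snd q / 2^k) ^ DIM('a) = 2 ^ DIM('a) * (snd q / 2 ^ Suc k) ^ DIM('a)"
        by (simp flip: power_mult_distrib)
      also have "?c k * (B * (2 ^ DIM('a) * (snd q / 2 ^ Suc k) ^ DIM('a))) = C * 2 ^ DIM('a) * B * \<omega> ((1/2) ^ Suc (n - k))"
        using q by (simp del: power_Suc)
      finally show "?c k * (LINT y|lebesgue. cutoff (star (?D k)) (\<lambda>y. norm (g y)) y) \<le> C * 2 ^ DIM('a) * B * \<omega> ((1/2) ^ Suc (n - k))" .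
    qed
    also have "\<dots> = C * 2 ^ DIM('a) * B * (\<Sum>k<Suc n. \<omega> ((1/2) ^ Suc (Suc n - Suc k)))"
      by (simp add: sum_distrib_left lessThan_Suc_atMost)
    \<comment> \<open>The layers are numbered from the outside, the gains from the inside. Reversing
      the index leaves a partial sum of the Dini series, with a bound independent of the depth
      \<open>n\<close>.\<close>
    also have "(\<Sum>k<Suc n. \<omega> ((1/2) ^ Suc (Suc n - Suc k))) = (\<Sum>k<Suc n. \<omega> ((1/2) ^ Suc k))"
      by (rule sum.nat_diff_reindex)
    also have "C * 2 ^ DIM('a) * B * (\<Sum>k<Suc n. \<omega> ((1/2) ^ Suc k)) \<le> C * 2 ^ DIM('a) * B * omega_sum"
      unfolding omega_sum_def using C B0 omega_half_nonneg
      by (intro mult_left_mono sum_le_suminf omega_summable) auto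
    finally show ?case
      by (simp add: g'_def mult_ac)
  qed
qed

end

section \<open>The stopping-time step\<close>

definition half_packing :: "'a::euclidean_space \<times> real \<Rightarrow> ('a \<times> real) set \<Rightarrow> bool" where
  "half_packing q F \<longleftrightarrow> (\<forall>p\<in>F. 0 < snd p \<and> hcube p \<subseteq> hcube q) \<and>
     (\<forall>p\<in>F. \<forall>p'\<in>F. p \<noteq> p' \<longrightarrow> hcube p \<inter> hcube p' = {}) \<and>
     emeasure lebesgue (\<Union>p\<in>F. hcube p) \<le> ennreal (vol q / 2)"

context cz_operator
begin

text \<open>One family has to serve four functions, so the exceptional sets are united over
  \<open>i\<close>. At a well chosen point of a stopping cube, \<open>T\<close> of the outer part is
  the difference of \<open>T (G i)\<close> and \<open>T\<close> of the inner part, both under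
  control; that such a point exists follows by comparing proportions inside the cube.\<close>

lemma stopping_step:
  obtains C where "0 < C" "\<And>q (G :: nat \<Rightarrow> 'a \<Rightarrow> complex). 0 < snd q \<Longrightarrow>
    (\<And>i. i < 4 \<Longrightarrow> integrable lebesgue (G i)) \<Longrightarrow> (\<And>i x. i < 4 \<Longrightarrow> x \<notin> star q \<Longrightarrow> G i x = 0) \<Longrightarrow>
    \<exists>F. half_packing q F \<and>
      (\<forall>x \<in> hcube q - (\<Union>p\<in>F. hcube p). \<forall>i<4. norm (T (G i) x) \<le> C * (L1norm (G i)) / vol q) \<and>
      (\<forall>p\<in>F. AE x in lebesgue. x \<in> hcube p \<longrightarrow>
        (\<forall>i<4. norm (T (cutoff (- star p) (G i)) x) \<le> C * (L1norm (G i)) / vol q))"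
proof -
  \<comment> \<open>Two demands fix \<open>\<epsilon>\<close>. The measure of \<open>U\<close> will
    be at most \<open>5 * \<epsilon> * L\<close>, so the disjoint stopping cubes on which
    \<open>U\<close> has density at least \<open>1 / 2 ^ (DIM('a) + 1)\<close> have total volume at
    most \<open>5 / 32 * L\<close>. Inside a stopping cube, four exceptional sets take at most one
    sixteenth.\<close>
  define \<epsilon> where "\<epsilon> = 1 / (2::real) ^ (DIM('a) + 6)"
  have e: "0 < \<epsilon>" by (simp add: \<epsilon>_def)
  have e1: "2 ^ (DIM('a) + 1) * \<epsilon> = 1 / 32" by (simp add: \<epsilon>_def power_add)
  have e2: "\<epsilon> \<le> 1 / 64"
  proof -
    have "(1::real) \<le> 2 ^ DIM('a)" by simp
    then show ?thesis by (simp add: \<epsilon>_def power_add field_simps)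
  qed
  show ?thesis
  proof (rule weak_type[OF e], rule oscillation, goal_cases)
  case (1 A1 Co)
  note A1 = 1(1,2) and Co = 1(3,4)
  define N where "N = (10 * (real DIM('a) * (2 * real DIM('a) + 1))) ^ DIM('a)"
  have N: "0 \<le> N" by (simp add: N_def)
  \<comment> \<open>\<open>N\<close> is the constant of the covering estimate. With this level each
    of the four heavy families covers at most \<open>L / 16\<close>, and
    \<open>5 / 32 + 4 / 16\<close> is below one half.\<close>
  define A2 where "A2 = 16 * N + 1"
  have A2: "1 \<le> A2" "0 < A2" "N / A2 \<le> 1 / 16" using N by (auto simp: A2_def field_simps)
  \<comment> \<open>At the chosen point \<open>T (G i)\<close> costs \<open>A1\<close> and the inner
    part costs \<open>A1 * (2 ^ DIM('a) * A2)\<close>; moving to another point of the cube costs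
    \<open>Co * A2\<close>. The summand 1 ensures positivity.\<close>
  define C where "C = A1 + A1 * (2 ^ DIM('a) * A2) + Co * A2 + 1"
  have C0: "0 < C" using A1(1) A2 Co(1) by (simp add: C_def add_nonneg_pos)
  show ?case
  proof (rule that[OF C0], goal_cases)
    case (1 q G)
    note q = 1(1) and G = 1(2) and supp = 1(3)
    define L where "L = vol q"
    have L: "0 < L" using q by (simp add: L_def)
    define \<mu> where "\<mu> i = (L1norm (G i))" for i
    have mu0: "0 \<le> \<mu> i" for i by (simp add: \<mu>_def)
    have gt_meas: "{x. c < norm (T g x)} \<in> sets lebesgue" if g: "integrable lebesgue g" for g c
    proof -
      have [measurable]: "T g \<in> borel_measurable lebesgue" using T_measurable[OF g] .
      have "{x \<in> space lebesgue. c < norm (T g x)} \<in> sets lebesgue" by measurable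
      then show ?thesis by simp
    qed
    define bad where "bad p g = (\<Union>i\<in>{..<4::nat}. {x. A1 * (L1norm (g i)) / vol p < norm (T (g i) x)})"
      for p :: "'a \<times> real" and g
    have bad_meas: "bad p g \<in> sets lebesgue" if "\<And>i. i < 4 \<Longrightarrow> integrable lebesgue (g i)" for p g
      unfolding bad_def by (intro sets.finite_UN gt_meas) (use that in auto)
    have bad_le: "emeasure lebesgue (bad p g) \<le> ennreal (4 * \<epsilon> * vol p)"
      if "0 < snd p" "\<And>i. i < 4 \<Longrightarrow> integrable lebesgue (g i)" "\<And>i x. i < 4 \<Longrightarrow> x \<notin> star p \<Longrightarrow> g i x = 0" for p g
      unfolding bad_def
    proof (rule emeasure_UN_le_sum)
      fix i assume "i \<in> {..<4::nat}"
      then show "emeasure lebesgue {x. A1 * (L1norm (g i)) / vol p < norm (T (g i) x)}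
          \<le> ennreal (\<epsilon> * vol p)"
        using that by (intro A1(2)) auto
    next
      fix F' assume F': "finite F'" "F' \<subseteq> {..<4::nat}"
      then have "real (card F') \<le> 4" using card_mono[OF _ F'(2)] by simp
      then show "(\<Sum>i\<in>F'. \<epsilon> * vol p) \<le> 4 * \<epsilon> * vol p"
        using e that(1) by (simp add: mult_right_mono)
    qed (use that e in \<open>auto intro: gt_meas\<close>)
    have bqm: "bad q G \<in> sets lebesgue" by (rule bad_meas[OF G])
    obtain U where U: "open U" "bad q G \<subseteq> U" "emeasure lebesgue (U - bad q G) < ennreal (\<epsilon> * L)"
      using sets_lebesgue_outer_open[OF bqm, of "\<epsilon> * L"] e L by (metis mult_pos_pos)
    have Um: "U \<in> sets lebesgue" using U(1) by (simp add: borel_open)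
    have eU: "emeasure lebesgue U \<le> ennreal (5 * \<epsilon> * L)"
    proof -
      have "emeasure lebesgue U = emeasure lebesgue (bad q G \<union> (U - bad q G))" using U(2) by (simp add: Un_absorb1)
      also have "\<dots> \<le> emeasure lebesgue (bad q G) + emeasure lebesgue (U - bad q G)"
        by (rule emeasure_subadditive) (use bqm Um in auto)
      also have "\<dots> \<le> ennreal (4 * \<epsilon> * L) + ennreal (\<epsilon> * L)"
        using bad_le[OF q G supp] U(3) by (intro add_mono) (auto simp: L_def)
      also have "\<dots> = ennreal (5 * \<epsilon> * L)" using e L by (simp flip: ennreal_plus)
      finally show ?thesis .
    qed
    have Ufin: "emeasure lebesgue U < \<infinity>" using eU by (auto intro: le_less_trans)
    have mU: "measure lebesgue U \<le> 5 * \<epsilon> * L" using eU e L unfolding measure_def by (intro enn2real_leI) auto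
    let ?u = "\<lambda>x. indicator U x :: real"
    have iU: "integrable lebesgue ?u" using Um Ufin by simp
    have Iu: "(LINT x|lebesgue. ?u x) = measure lebesgue U" using Um by simp
    \<comment> \<open>The density threshold is one half divided by the number
      \<open>2 ^ DIM('a)\<close> of dyadic children: when the parent stays below it, at most half of
      the child lies in \<open>U\<close>.\<close>
    define S where "S p \<longleftrightarrow> vol p \<le> 2 ^ (DIM('a) + 1) * (LINT x|lebesgue. cutoff (hcube p) ?u x) \<or>
      (\<exists>i<4. A2 * \<mu> i / L * vol p < (LINT x|lebesgue. cutoff (star p) (\<lambda>x. norm (G i x)) x))" for p
    have nG: "integrable lebesgue (\<lambda>x. norm (G i x))" if "i < 4" for i using G[OF that] by simp
    have cutoff_mono: "(LINT x|lebesgue. cutoff A h x) \<le> (LINT x|lebesgue. cutoff B h x)"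
      if "integrable lebesgue h" "\<And>x. 0 \<le> h x" "A \<subseteq> B" "A \<in> sets lebesgue" "B \<in> sets lebesgue" for A B and h :: "'a \<Rightarrow> real"
      using that by (intro integral_mono integrable_cutoff) (auto simp: cutoff_def)
    have cutoff_le: "(LINT x|lebesgue. cutoff A h x) \<le> (LINT x|lebesgue. h x)"
      if "integrable lebesgue h" "\<And>x. 0 \<le> h x" "A \<in> sets lebesgue" for A and h :: "'a \<Rightarrow> real"
      using that by (intro integral_mono integrable_cutoff) (auto simp: cutoff_def)
    have Sq: "\<not> S q"
    proof -
      have "2 ^ (DIM('a) + 1) * (LINT x|lebesgue. cutoff (hcube q) ?u x) \<le> 2 ^ (DIM('a) + 1) * (5 * \<epsilon> * L)"
        using cutoff_le[OF iU, of "hcube q"] Iu mU by (intro mult_left_mono) auto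
      also have "\<dots> = 5 * (2 ^ (DIM('a) + 1) * \<epsilon>) * L" by simp
      also have "\<dots> < L" unfolding e1 using L by simp
      finally have 1: "2 ^ (DIM('a) + 1) * (LINT x|lebesgue. cutoff (hcube q) ?u x) < L" .
      have "(LINT x|lebesgue. cutoff (star q) (\<lambda>x. norm (G i x)) x) \<le> A2 * \<mu> i / L * L" if "i < 4" for i
      proof -
        have "(LINT x|lebesgue. cutoff (star q) (\<lambda>x. norm (G i x)) x) \<le> \<mu> i"
          unfolding \<mu>_def using nG[OF that] by (intro cutoff_le) auto
        also have "\<mu> i \<le> A2 * \<mu> i" using A2(1) mu0[of i] by (simp add: mult_le_cancel_right1)
        finally show ?thesis using L by simp
      qed
      then show ?thesis using 1 unfolding S_def L_def[symmetric] by (meson not_le)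
    qed
    define F where "F = stopping S q"
    have F: "hcube p \<subseteq> hcube q" "0 < snd p" "S p" if "p \<in> F" for p
      using stopping_subset[OF q, of p S] that by (simp_all add: F_def)
    have dis: "hcube p \<inter> hcube p' = {}" if "p \<in> F" "p' \<in> F" "p \<noteq> p'" for p p'
      using stopping_disjoint[OF q] that by (simp add: F_def)
    have cF: "countable F" using countable_stopping[OF q] by (simp add: F_def)
    have total: "emeasure lebesgue (\<Union>p\<in>F. hcube p) \<le> ennreal (L / 2)"
    proof -
      define Fa where "Fa = {p\<in>F. vol p \<le> 2 ^ (DIM('a) + 1) * (LINT x|lebesgue. cutoff (hcube p) ?u x)}"
      define Fb where "Fb i = {p\<in>F. A2 * \<mu> i / L * vol p < (LINT x|lebesgue. cutoff (star p) (\<lambda>x. norm (G i x)) x)}" for i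
      have cFa: "countable Fa" and cFb: "countable (Fb i)" for i
        using cF by (auto simp: Fa_def Fb_def intro: countable_subset[OF _ cF])
      have ea: "emeasure lebesgue (\<Union>p\<in>Fa. hcube p) \<le> ennreal (5 / 32 * L)"
      proof (rule emeasure_UN_le_sum[OF cFa])
        fix p assume "p \<in> Fa"
        then have "0 < snd p" using F by (simp add: Fa_def)
        then show "emeasure lebesgue (hcube p) \<le> ennreal (vol p)" "0 \<le> vol p"
          by (simp_all add: emeasure_hcube)
      next
        fix F' assume F': "finite F'" "F' \<subseteq> Fa"
        have "(\<Sum>p\<in>F'. vol p) \<le> (\<Sum>p\<in>F'. 2 ^ (DIM('a) + 1) * (LINT x|lebesgue. cutoff (hcube p) ?u x))"
          using F' by (intro sum_mono) (auto simp: Fa_def)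
        also have "\<dots> = 2 ^ (DIM('a) + 1) * (\<Sum>p\<in>F'. LINT x|lebesgue. cutoff (hcube p) ?u x)"
          by (rule sum_distrib_left[symmetric])
        also have "\<dots> \<le> 2 ^ (DIM('a) + 1) * (LINT x|lebesgue. ?u x)"
        proof (rule mult_left_mono, rule sum_integral_cutoff_le[OF F'(1) _ _ iU])
          fix p p' assume pp': "p \<in> F'" "p' \<in> F'" "p \<noteq> p'"
          then have "p \<in> F" "p' \<in> F" using F'(2) by (auto simp: Fa_def)
          then show "hcube p \<inter> hcube p' = {}" using dis pp'(3) by blast
        qed simp_all
        also have "\<dots> \<le> 2 ^ (DIM('a) + 1) * (5 * \<epsilon> * L)" unfolding Iu using mU by (intro mult_left_mono) auto
        also have "\<dots> = 5 * (2 ^ (DIM('a) + 1) * \<epsilon>) * L" by simp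
        also have "\<dots> = 5 / 32 * L" unfolding e1 by simp
        finally show "(\<Sum>p\<in>F'. vol p) \<le> 5 / 32 * L" .
      qed simp
      have eb: "emeasure lebesgue (\<Union>p\<in>Fb i. hcube p) \<le> ennreal (L / 16)" if i: "i < 4" for i
      \<comment> \<open>For \<open>\<mu> i = 0\<close> the level is zero, and the strict inequality
        leaves no heavy cube; otherwise the covering estimate applies at a positive level.\<close>
      proof (cases "\<mu> i = 0")
        case True
        have "(LINT x|lebesgue. cutoff (star p) (\<lambda>x. norm (G i x)) x) \<le> 0" for p
          using cutoff_le[OF nG[OF i], of "star p"] True by (simp add: \<mu>_def)
        then have "Fb i = {}" using True by (auto simp: Fb_def not_less)
        then show ?thesis by simp
      next
        case False
        then have mu: "0 < \<mu> i" using mu0[of i] by simp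
        have "emeasure lebesgue (\<Union>p\<in>Fb i. hcube p) \<le> ennreal (N * (L1norm (G i)) / (A2 * \<mu> i / L))"
          unfolding N_def
        proof (rule emeasure_heavy_cubes_le[where L = "snd q"])
          show "0 < snd p \<and> snd p \<le> snd q" if "p \<in> Fb i" for p
            using that F hcube_subset_snd[of p q] by (simp add: Fb_def)
          show "0 < A2 * \<mu> i / L" using A2 mu L by simp
        qed (use nG[OF i] cFb in \<open>auto simp: Fb_def\<close>)
        also have "N * (L1norm (G i)) / (A2 * \<mu> i / L) = (N / A2) * L"
          using mu A2 L by (simp add: \<mu>_def)
        also have "ennreal \<dots> \<le> ennreal (1 / 16 * L)" using A2(3) L by (intro ennreal_leI mult_right_mono) auto
        finally show ?thesis by simp
      qed
      have ebU: "emeasure lebesgue (\<Union>i\<in>{..<4::nat}. \<Union>p\<in>Fb i. hcube p) \<le> ennreal (L / 4)"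
      proof (rule emeasure_UN_le_sum)
        fix F' assume F': "finite F'" "F' \<subseteq> {..<4::nat}"
        then have "real (card F') \<le> 4" using card_mono[OF _ F'(2)] by simp
        then have "real (card F') * (L / 16) \<le> 4 * (L / 16)" using L by (intro mult_right_mono) auto
        then show "(\<Sum>i\<in>F'. L / 16) \<le> L / 4" by simp
      qed (use eb L cFb in \<open>auto intro!: sets.countable_UN'\<close>)
      have ma: "(\<Union>p\<in>Fa. hcube p) \<in> sets lebesgue" using cFa by (intro sets.countable_UN') auto
      have mb: "(\<Union>i\<in>{..<4::nat}. \<Union>p\<in>Fb i. hcube p) \<in> sets lebesgue"
        using cFb by (intro sets.finite_UN sets.countable_UN') auto
      have "(\<Union>p\<in>F. hcube p) \<subseteq> (\<Union>p\<in>Fa. hcube p) \<union> (\<Union>i\<in>{..<4::nat}. \<Union>p\<in>Fb i. hcube p)"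
      proof
        fix x assume "x \<in> (\<Union>p\<in>F. hcube p)"
        then obtain p where p: "p \<in> F" "x \<in> hcube p" by blast
        from F(3)[OF p(1)] have "p \<in> Fa \<or> (\<exists>i<4. p \<in> Fb i)"
          unfolding S_def Fa_def Fb_def using p(1) by blast
        then show "x \<in> (\<Union>p\<in>Fa. hcube p) \<union> (\<Union>i\<in>{..<4::nat}. \<Union>p\<in>Fb i. hcube p)" using p(2) by blast
      qed
      then have "emeasure lebesgue (\<Union>p\<in>F. hcube p)
          \<le> emeasure lebesgue ((\<Union>p\<in>Fa. hcube p) \<union> (\<Union>i\<in>{..<4::nat}. \<Union>p\<in>Fb i. hcube p))"
        using ma mb by (intro emeasure_mono) auto
      also have "\<dots> \<le> emeasure lebesgue (\<Union>p\<in>Fa. hcube p) + emeasure lebesgue (\<Union>i\<in>{..<4::nat}. \<Union>p\<in>Fb i. hcube p)"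
        by (rule emeasure_subadditive[OF ma mb])
      also have "\<dots> \<le> ennreal (5 / 32 * L) + ennreal (L / 4)" by (intro add_mono ea ebU)
      also have "\<dots> = ennreal (5 / 32 * L + L / 4)" using L by (intro ennreal_plus[symmetric]) auto
      also have "\<dots> \<le> ennreal (L / 2)" using L by (intro ennreal_leI) auto
      finally show ?thesis .
    qed
    have notbad: "norm (T (G i) x) \<le> A1 * \<mu> i / L" if "x \<notin> U" "i < 4" for i x
    proof -
      have "x \<notin> bad q G" using U(2) that by blast
      then show ?thesis using that(2) unfolding bad_def by (simp add: \<mu>_def L_def not_less)
    qed
    have CA1: "A1 * \<mu> i / L \<le> C * \<mu> i / L" for i
      using A1(1) A2 Co(1) mu0[of i] L by (intro divide_right_mono mult_right_mono) (auto simp: C_def)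
    have good: "norm (T (G i) x) \<le> C * \<mu> i / L" if x: "x \<in> hcube q - (\<Union>p\<in>F. hcube p)" and i: "i < 4" for x i
    proof -
      have "x \<notin> U"
      proof
        assume "x \<in> U"
        then obtain n where n: "hcube (dcube q n x) \<subseteq> U" using U dcube_in_open[OF q] by blast
        let ?p = "dcube q n x"
        have "cutoff (hcube ?p) ?u = (\<lambda>y. indicator (hcube ?p) y)" using n by (auto simp: cutoff_def indicator_def fun_eq_iff)
        then have "(LINT y|lebesgue. cutoff (hcube ?p) ?u y) = snd ?p ^ DIM('a)"
          using q measure_hcube[of ?p] by simp
        moreover have "snd ?p ^ DIM('a) \<le> 2 ^ (DIM('a) + 1) * snd ?p ^ DIM('a)"
          using q mult_right_mono[of 1 "2 ^ (DIM('a) + 1)" "snd ?p ^ DIM('a)"] one_le_power[of "2::real" "DIM('a) + 1"] by simp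
        ultimately have "S ?p" unfolding S_def by simp
        moreover have "x \<in> hcube q" using x by blast
        ultimately obtain p where "p \<in> F" "x \<in> hcube p" using stopping_covers[OF q, of x S n] unfolding F_def by blast
        then show False using x by blast
      qed
      then show ?thesis using notbad[of x i] i CA1[of i] by linarith
    qed
    have stop: "AE x in lebesgue. x \<in> hcube p \<longrightarrow> (\<forall>i<4. norm (T (cutoff (- star p) (G i)) x) \<le> C * \<mu> i / L)" if p: "p \<in> F" for p
    proof -
      have "p \<in> stopping S q" using p by (simp add: F_def)
      then obtain n z where z: "z \<in> hcube q" and pD: "p = dcube q (Suc n) z" and nS: "\<And>m. m \<le> n \<Longrightarrow> \<not> S (dcube q m z)"
        using stopping_ancestors[of q S p, OF q Sq] by blast
      have p0: "0 < snd p" using F(2)[OF p] .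
      have par: "snd (dcube q n z) = 2 * snd p" by (simp add: pD)
      have psub: "hcube p \<subseteq> hcube (dcube q n z)" unfolding pD by (rule hcube_dcube_Suc[OF q])
      have ssub: "star p \<subseteq> star (dcube q n z)" using star_mono[OF psub p0] .
      have light: "(LINT y|lebesgue. cutoff (star (dcube q k z)) (\<lambda>y. norm (G i y)) y) \<le> A2 * \<mu> i / L * (snd q / 2^k) ^ DIM('a)"
        if "k \<le> n" "i < 4" for k i
        using nS[OF that(1)] that(2) unfolding S_def snd_dcube by (meson not_less)
      have lightp: "(LINT y|lebesgue. norm (cutoff (star p) (G i) y)) / vol p \<le> 2 ^ DIM('a) * A2 * \<mu> i / L" if i: "i < 4" for i
      proof -
        have "(LINT y|lebesgue. norm (cutoff (star p) (G i) y)) \<le> (LINT y|lebesgue. cutoff (star (dcube q n z)) (\<lambda>y. norm (G i y)) y)"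
          unfolding norm_cutoff using nG[OF i] ssub by (intro cutoff_mono) auto
        also have "\<dots> \<le> A2 * \<mu> i / L * vol (dcube q n z)" using light[OF order_refl i] by simp
        also have "\<dots> = 2 ^ DIM('a) * A2 * \<mu> i / L * vol p" unfolding par by (simp add: power_mult_distrib)
        finally show ?thesis using p0 by (simp add: divide_le_eq)
      qed
      have halfU: "emeasure lebesgue (hcube p \<inter> U) \<le> ennreal (vol p / 2)"
      proof -
        have "2 ^ (DIM('a) + 1) * (LINT x|lebesgue. cutoff (hcube (dcube q n z)) ?u x) < vol (dcube q n z)"
          using nS[OF order_refl] unfolding S_def by (simp add: not_le)
        moreover have "(LINT x|lebesgue. cutoff (hcube p) ?u x) \<le> (LINT x|lebesgue. cutoff (hcube (dcube q n z)) ?u x)"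
          using psub iU by (intro cutoff_mono) auto
        then have "2 ^ (DIM('a) + 1) * (LINT x|lebesgue. cutoff (hcube p) ?u x) \<le> 2 ^ (DIM('a) + 1) * (LINT x|lebesgue. cutoff (hcube (dcube q n z)) ?u x)"
          by (rule mult_left_mono) simp
        ultimately have "2 ^ (DIM('a) + 1) * (LINT x|lebesgue. cutoff (hcube p) ?u x) < 2 ^ DIM('a) * vol p"
          unfolding par power_mult_distrib by linarith
        then have "(LINT x|lebesgue. cutoff (hcube p) ?u x) \<le> vol p / 2" by simp
        moreover have "cutoff (hcube p) ?u = (\<lambda>x. indicator (hcube p \<inter> U) x)" by (auto simp: cutoff_def indicator_def fun_eq_iff)
        ultimately have m: "measure lebesgue (hcube p \<inter> U) \<le> vol p / 2" using Um by simp
        have "emeasure lebesgue (hcube p \<inter> U) \<le> emeasure lebesgue U" using Um by (intro emeasure_mono) auto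
        then have "emeasure lebesgue (hcube p \<inter> U) = ennreal (measure lebesgue (hcube p \<inter> U))"
          using Ufin by (intro emeasure_eq_ennreal_measure) (auto simp: top_unique)
        then show ?thesis using m by (simp add: ennreal_leI)
      qed
      let ?in = "\<lambda>i. cutoff (star p) (G i)" and ?out = "\<lambda>i. cutoff (- star p) (G i)"
      have inI: "integrable lebesgue (?in i)" and outI: "integrable lebesgue (?out i)" if "i < 4" for i
        using G[OF that] by (simp_all add: integrable_cutoff lebesgue_sets_compl)
      \<comment> \<open>\<open>T\<close> of the outer part is known only almost everywhere. The
        kernel integral \<open>H\<close> makes sense at every point of \<open>p\<close>, so all
        points can be compared with the same point \<open>x'\<close>.\<close>
      define H where "H i x = (LINT y|lebesgue. K x y * ?out i y)" for i x
      have "AE x in lebesgue. \<forall>i\<in>{..<4}. x \<notin> - interior (star p) \<longrightarrow> T (?out i) x = H i x"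
      proof (rule AE_ball_countable[THEN iffD2], simp, intro ballI)
        fix i :: nat assume "i \<in> {..<4}"
        then show "AE x in lebesgue. x \<notin> - interior (star p) \<longrightarrow> T (?out i) x = H i x"
          unfolding H_def using interior_subset by (intro T_kernel outI) (auto simp: cutoff_def)
      qed
      moreover have "AE x in lebesgue. \<forall>i\<in>{..<4}. T (G i) x = T (?in i) x + T (?out i) x"
      proof (rule AE_ball_countable[THEN iffD2], simp, intro ballI)
        fix i :: nat assume "i \<in> {..<4}"
        then have "AE x in lebesgue. T (\<lambda>y. ?in i y + ?out i y) x = T (?in i) x + T (?out i) x"
          by (intro T_add inI outI) auto
        moreover have "(\<lambda>y. ?in i y + ?out i y) = G i" by (auto simp: cutoff_def)
        ultimately show "AE x in lebesgue. T (G i) x = T (?in i) x + T (?out i) x" by simp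
      qed
      ultimately have ae: "AE x in lebesgue. x \<in> hcube p \<longrightarrow>
          (\<forall>i<4. T (?out i) x = H i x \<and> T (G i) x = T (?in i) x + T (?out i) x)"
        by eventually_elim (use hcube_subset_interior_star[OF p0] in auto)
      \<comment> \<open>At most half of \<open>p\<close> lies in \<open>U\<close>, and at most one
        sixteenth of its volume is taken by the exceptional set of the inner parts. A set of
        positive measure is left, which the null set of bad points for the identities cannot
        exhaust.\<close>
      have "\<exists>x'\<in>hcube p. x' \<notin> U \<and> x' \<notin> bad p ?in \<and>
          (\<forall>i<4. T (?out i) x' = H i x' \<and> T (G i) x' = T (?in i) x' + T (?out i) x')"
      proof (rule ccontr)
        assume neg: "\<not> ?thesis"
        have bm: "bad p ?in \<in> sets lebesgue" by (rule bad_meas[OF inI])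
        have "AE x in lebesgue. x \<in> hcube p \<longrightarrow> x \<in> (hcube p \<inter> U) \<union> bad p ?in"
          using ae by eventually_elim (use neg in blast)
        then have "emeasure lebesgue (hcube p) \<le> emeasure lebesgue ((hcube p \<inter> U) \<union> bad p ?in)"
          using bm Um by (intro emeasure_mono_AE) auto
        also have "\<dots> \<le> emeasure lebesgue (hcube p \<inter> U) + emeasure lebesgue (bad p ?in)"
          using bm Um by (intro emeasure_subadditive) auto
        also have "\<dots> \<le> ennreal (vol p / 2) + ennreal (4 * \<epsilon> * vol p)"
          using p0 inI by (intro add_mono halfU bad_le) (auto simp: cutoff_def)
        also have "\<dots> = ennreal (vol p / 2 + 4 * \<epsilon> * vol p)"
          using p0 e by (intro ennreal_plus[symmetric]) auto
        finally have "ennreal (vol p) \<le> ennreal (vol p / 2 + 4 * \<epsilon> * vol p)"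
          using p0 by (simp add: emeasure_hcube)
        then have le: "vol p \<le> vol p / 2 + 4 * \<epsilon> * vol p"
          using p0 e by (subst (asm) ennreal_le_iff) auto
        have "4 * \<epsilon> * vol p \<le> 1 / 16 * vol p"
          using e2 p0 by (intro mult_right_mono) auto
        moreover have "0 < vol p" using p0 by simp
        ultimately show False using le by linarith
      qed
      then obtain x' where x': "x' \<in> hcube p" "x' \<notin> U" "x' \<notin> bad p ?in"
          "\<And>i. i < 4 \<Longrightarrow> T (?out i) x' = H i x'" "\<And>i. i < 4 \<Longrightarrow> T (G i) x' = T (?in i) x' + T (?out i) x'" by blast
      have Hle: "norm (H i x) \<le> C * \<mu> i / L" if x: "x \<in> hcube p" and i: "i < 4" for x i
      proof -
        have "norm (H i x - H i x') \<le> Co * (A2 * \<mu> i / L)"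
          unfolding H_def pD
        proof (rule Co(2)[OF G[OF i] q z])
          show "x \<in> hcube (dcube q (Suc n) z)" "x' \<in> hcube (dcube q (Suc n) z)" using x x'(1) by (simp_all add: pD)
        qed (use supp[OF i] light i in auto)
        moreover have "norm (T (?in i) x') \<le> A1 * (LINT y|lebesgue. norm (?in i y)) / vol p"
          using x'(3) i unfolding bad_def by (simp add: not_less)
        moreover have "A1 * (LINT y|lebesgue. norm (?in i y)) / vol p \<le> A1 * (2 ^ DIM('a) * A2 * \<mu> i / L)"
          using mult_left_mono[OF lightp[OF i] A1(1)] by simp
        moreover have "norm (T (G i) x') \<le> A1 * \<mu> i / L" using notbad[OF x'(2) i] .
        moreover have "H i x' = T (G i) x' - T (?in i) x'" using x'(4,5)[OF i] by simp
        then have "norm (H i x') \<le> norm (T (G i) x') + norm (T (?in i) x')" by (simp add: norm_triangle_ineq4)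
        moreover have "norm (H i x) \<le> norm (H i x') + norm (H i x - H i x')" by (rule norm_triangle_sub)
        ultimately have "norm (H i x) \<le> A1 * \<mu> i / L + A1 * (2 ^ DIM('a) * A2 * \<mu> i / L) + Co * (A2 * \<mu> i / L)" by linarith
        also have "\<dots> = (C - 1) * \<mu> i / L" using L by (simp add: C_def field_simps)
        also have "\<dots> \<le> C * \<mu> i / L" using mu0[of i] L by (intro divide_right_mono mult_right_mono) auto
        finally show ?thesis .
      qed
      show ?thesis using ae by eventually_elim (use Hle in auto)
    qed
    show ?case
      unfolding L_def[symmetric] \<mu>_def[symmetric]
    proof (intro exI[of _ F] conjI)
      show "half_packing q F" unfolding half_packing_def using F dis total by (simp add: L_def)
      show "\<forall>x\<in>hcube q - (\<Union>p\<in>F. hcube p). \<forall>i<4. norm (T (G i) x) \<le> C * \<mu> i / L" using good by blast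
      show "\<forall>p\<in>F. AE x in lebesgue. x \<in> hcube p \<longrightarrow> (\<forall>i<4. norm (T (cutoff (- star p) (G i)) x) \<le> C * \<mu> i / L)"
        using stop by blast
    qed
  qed
  qed
qed

end

section \<open>Commutators with centred symbols\<close>

text \<open>These are the functions that \<open>T\<close> meets when the iterated commutator is
  unfolded, with the bracketing that \<open>mult_comm\<close> produces.\<close>

definition admissible :: "('a::euclidean_space \<Rightarrow> complex) \<Rightarrow> ('a \<Rightarrow> complex) \<Rightarrow> ('a \<Rightarrow> complex) \<Rightarrow> bool" where
  "admissible b1 b2 f \<longleftrightarrow> integrable lebesgue f \<and> integrable lebesgue (\<lambda>y. b1 y * f y) \<and>
     integrable lebesgue (\<lambda>y. b2 y * f y) \<and> integrable lebesgue (\<lambda>y. b1 y * (b2 y * f y))"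

text \<open>The four functions that \<open>T\<close> acts on when the commutator is written with the centred symbols
  \<open>b1 - c1\<close> and \<open>b2 - c2\<close>, and the absolute values of the coefficients in front of them.\<close>
definition centred :: "('a \<Rightarrow> complex) \<Rightarrow> ('a \<Rightarrow> complex) \<Rightarrow> complex \<Rightarrow> complex \<Rightarrow> ('a \<Rightarrow> complex) \<Rightarrow> nat \<Rightarrow> 'a \<Rightarrow> complex" where
  "centred b1 b2 c1 c2 f i y = (if i = 0 then f y else if i = 1 then (b1 y - c1) * f y
     else if i = 2 then (b2 y - c2) * f y else (b1 y - c1) * (b2 y - c2) * f y)"

definition weight :: "('a \<Rightarrow> complex) \<Rightarrow> ('a \<Rightarrow> complex) \<Rightarrow> complex \<Rightarrow> complex \<Rightarrow> nat \<Rightarrow> 'a \<Rightarrow> real" where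
  "weight b1 b2 c1 c2 i x = (if i = 0 then norm (b1 x - c1) * norm (b2 x - c2) else if i = 1 then norm (b2 x - c2)
     else if i = 2 then norm (b1 x - c1) else 1)"

text \<open>The summands of \<open>Q\<close> in \<open>S1\<close>, \<open>S2\<close>,
  \<open>S3\<close>, \<open>S4\<close>, for \<open>i\<close> from 0 to 3, added as real numbers; the
  passage to \<open>ennreal\<close> is postponed to the end.\<close>

definition sparse_term :: "('a::euclidean_space \<Rightarrow> complex) \<Rightarrow> ('a \<Rightarrow> complex) \<Rightarrow> ('a \<Rightarrow> complex) \<Rightarrow> 'a set \<Rightarrow> 'a \<Rightarrow> real" where
  "sparse_term b1 b2 f Q x = (\<Sum>i<4. weight b1 b2 (avg Q b1) (avg Q b2) i x
     * avg Q (\<lambda>y. norm (centred b1 b2 (avg Q b1) (avg Q b2) f i y)) * indicator Q x)"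

lemma sum_lessThan_4: "(\<Sum>i<4. g i) = g 0 + g 1 + g 2 + g (3::nat)"
  by (simp add: eval_nat_numeral)

lemma weight_nonneg: "0 \<le> weight b1 b2 c1 c2 i x"
  by (simp add: weight_def)

lemma avg_nonneg: "(\<And>y. 0 \<le> g y) \<Longrightarrow> 0 \<le> avg Q g" for g :: "'a::euclidean_space \<Rightarrow> real"
  unfolding avg_def set_lebesgue_integral_def by simp

lemma avg_eq_cutoff: "avg Q g = (1 / measure lebesgue Q) *\<^sub>R (LINT y|lebesgue. cutoff Q g y)"
  by (simp add: avg_def set_lebesgue_integral_def cutoff_eq_indicator)

lemma centred_cutoff: "centred b1 b2 c1 c2 (cutoff A f) i = cutoff A (centred b1 b2 c1 c2 f i)"
  by (auto simp: centred_def cutoff_def fun_eq_iff)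

lemma admissible_cutoff:
  assumes "admissible b1 b2 f" "A \<in> sets lebesgue"
  shows "admissible b1 b2 (cutoff A f)"
proof -
  have e: "(\<lambda>y. b1 y * cutoff A f y) = cutoff A (\<lambda>y. b1 y * f y)" "(\<lambda>y. b2 y * cutoff A f y) = cutoff A (\<lambda>y. b2 y * f y)"
    "(\<lambda>y. b1 y * (b2 y * cutoff A f y)) = cutoff A (\<lambda>y. b1 y * (b2 y * f y))"
    by (auto simp: cutoff_def fun_eq_iff)
  show ?thesis using assms unfolding admissible_def e by (blast intro: integrable_cutoff)
qed

lemma integrable_centred:
  assumes "admissible b1 b2 f"
  shows "integrable lebesgue (centred b1 b2 c1 c2 f i)"
proof -
  have "(b1 y - c1) * (b2 y - c2) * f y = b1 y * (b2 y * f y) - c1 * (b2 y * f y) - c2 * (b1 y * f y) + c1 * c2 * f y" for y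
    by (simp add: algebra_simps)
  then have "integrable lebesgue (\<lambda>y. (b1 y - c1) * (b2 y - c2) * f y)"
    using assms by (simp add: admissible_def)
  moreover have "integrable lebesgue (\<lambda>y. (b1 y - c1) * f y)" "integrable lebesgue (\<lambda>y. (b2 y - c2) * f y)"
    using assms by (simp_all add: admissible_def left_diff_distrib)
  ultimately show ?thesis
    using assms unfolding centred_def admissible_def by (cases "i = 0"; cases "i = 1"; cases "i = 2"; simp)
qed

text \<open>In \<open>ennreal\<close> every family is summable, so a finite partial sum never
  exceeds \<open>infsum\<close>. Finite sums suffice, since almost every point leaves the tree after
  finitely many generations.\<close>

lemma sum_sparse_term_le:
  assumes H: "finite H" "H \<subseteq> \<S>"
  shows "(\<Sum>Q\<in>H. ennreal (sparse_term b1 b2 f Q x)) \<le> S1 \<S> b1 b2 f x + S2 \<S> b1 b2 f x + S3 \<S> b1 b2 f x + S4 \<S> b1 b2 f x"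
proof -
  have le: "(\<Sum>Q\<in>H. g Q) \<le> infsum g \<S>" for g :: "'a set \<Rightarrow> ennreal"
  proof -
    have "infsum g H \<le> infsum g \<S>"
      by (rule infsum_mono_neutral) (use H in \<open>auto intro: nonneg_summable_on_complete\<close>)
    then show ?thesis using H(1) by simp
  qed
  let ?t1 = "\<lambda>Q. norm (b1 x - avg Q b1) * norm (b2 x - avg Q b2) * avg Q (\<lambda>y. norm (f y)) * indicator Q x"
  let ?t2 = "\<lambda>Q. norm (b2 x - avg Q b2) * avg Q (\<lambda>y. norm (b1 y - avg Q b1) * norm (f y)) * indicator Q x"
  let ?t3 = "\<lambda>Q. norm (b1 x - avg Q b1) * avg Q (\<lambda>y. norm (b2 y - avg Q b2) * norm (f y)) * indicator Q x"
  let ?t4 = "\<lambda>Q. avg Q (\<lambda>y. norm (b1 y - avg Q b1) * norm (b2 y - avg Q b2) * norm (f y)) * indicator Q x"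
  have "sparse_term b1 b2 f Q x = ?t1 Q + ?t2 Q + ?t3 Q + ?t4 Q" for Q
    unfolding sparse_term_def sum_lessThan_4 by (simp add: weight_def centred_def norm_mult)
  moreover have "0 \<le> ?t1 Q" "0 \<le> ?t2 Q" "0 \<le> ?t3 Q" "0 \<le> ?t4 Q" for Q
    by (intro mult_nonneg_nonneg avg_nonneg; simp)+
  ultimately have "ennreal (sparse_term b1 b2 f Q x) = ennreal (?t1 Q) + ennreal (?t2 Q) + ennreal (?t3 Q) + ennreal (?t4 Q)" for Q
    by (simp only: ennreal_plus add_nonneg_nonneg)
  then have "(\<Sum>Q\<in>H. ennreal (sparse_term b1 b2 f Q x)) = (\<Sum>Q\<in>H. ennreal (?t1 Q)) + (\<Sum>Q\<in>H. ennreal (?t2 Q))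
      + (\<Sum>Q\<in>H. ennreal (?t3 Q)) + (\<Sum>Q\<in>H. ennreal (?t4 Q))"
    by (simp only: sum.distrib)
  also have "\<dots> \<le> S1 \<S> b1 b2 f x + S2 \<S> b1 b2 f x + S3 \<S> b1 b2 f x + S4 \<S> b1 b2 f x"
    unfolding S1_def S2_def S3_def S4_def by (intro add_mono le)
  finally show ?thesis .
qed

text \<open>The stopping estimates are normalised by the volume of the small cube, the sparse
  operators by that of the dilate; here the ratio of the volumes enters the constant.\<close>

lemma integral_cutoff_star_avg:
  fixes q :: "'a::euclidean_space \<times> real" and g :: "'a \<Rightarrow> real"
  assumes "0 < snd q"
  shows "(LINT y|lebesgue. cutoff (star q) g y) / vol q = (4 * real DIM('a) + 1) ^ DIM('a) * avg (star q) g"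
proof -
  have "(4 * real DIM('a) + 1) ^ DIM('a) \<noteq> 0" by (metis add_nonneg_pos mult_nonneg_nonneg of_nat_0_le_iff order_less_irrefl power_eq_0_iff zero_le_numeral zero_less_one)
  then show ?thesis using assms by (simp add: avg_eq_cutoff measure_star)
qed

section \<open>Algebra of the iterated commutator\<close>

context cz_operator
begin

abbreviation comm2 :: "('a \<Rightarrow> complex) \<Rightarrow> ('a \<Rightarrow> complex) \<Rightarrow> ('a \<Rightarrow> complex) \<Rightarrow> 'a \<Rightarrow> complex" where
  "comm2 b1 b2 \<equiv> mult_comm b2 (mult_comm b1 T)"

text \<open>Multiplication by a constant commutes with \<open>T\<close>, so constants drop out of
  both commutators. The four uses of \<open>T_linear\<close> are the only analytic input; the rest
  is expansion.\<close>

lemma commutator_centre: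
  assumes "admissible b1 b2 f"
  shows "AE x in lebesgue. comm2 b1 b2 f x =
    (b1 x - c1) * (b2 x - c2) * T (centred b1 b2 c1 c2 f 0) x - (b2 x - c2) * T (centred b1 b2 c1 c2 f 1) x
    - (b1 x - c1) * T (centred b1 b2 c1 c2 f 2) x + T (centred b1 b2 c1 c2 f 3) x"
proof -
  note a = assms[unfolded admissible_def]
  have c: "centred b1 b2 c1 c2 f 0 = f" "centred b1 b2 c1 c2 f 1 = (\<lambda>y. b1 y * f y + (- c1) * f y)"
    "centred b1 b2 c1 c2 f 2 = (\<lambda>y. b2 y * f y + (- c2) * f y)"
    "centred b1 b2 c1 c2 f 3 = (\<lambda>y. (b1 y * (b2 y * f y) + (- c1) * (b2 y * f y)) + (- c2) * (b1 y * f y + (- c1) * f y))"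
    by (auto simp: centred_def fun_eq_iff algebra_simps)
  have 1: "AE x in lebesgue. T (\<lambda>y. b1 y * f y + (- c1) * f y) x = T (\<lambda>y. b1 y * f y) x + (- c1) * T f x"
    using a by (intro T_linear) auto
  have 2: "AE x in lebesgue. T (\<lambda>y. b2 y * f y + (- c2) * f y) x = T (\<lambda>y. b2 y * f y) x + (- c2) * T f x"
    using a by (intro T_linear) auto
  have 3: "AE x in lebesgue. T (\<lambda>y. b1 y * (b2 y * f y) + (- c1) * (b2 y * f y)) x
      = T (\<lambda>y. b1 y * (b2 y * f y)) x + (- c1) * T (\<lambda>y. b2 y * f y) x"
    using a by (intro T_linear) auto
  have 4: "AE x in lebesgue. T (\<lambda>y. (b1 y * (b2 y * f y) + (- c1) * (b2 y * f y)) + (- c2) * (b1 y * f y + (- c1) * f y)) x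
      = T (\<lambda>y. b1 y * (b2 y * f y) + (- c1) * (b2 y * f y)) x + (- c2) * T (\<lambda>y. b1 y * f y + (- c1) * f y) x"
    using a by (intro T_linear Bochner_Integration.integrable_add integrable_mult_right) auto
  show ?thesis
    unfolding c using 1 2 3 4
  proof eventually_elim
    case (elim x)
    show ?case unfolding elim mult_comm_def by (simp add: algebra_simps)
  qed
qed

lemma commutator_centre_bound:
  assumes "admissible b1 b2 f"
  shows "AE x in lebesgue. norm (comm2 b1 b2 f x) \<le> (\<Sum>i<4. weight b1 b2 c1 c2 i x * norm (T (centred b1 b2 c1 c2 f i) x))"
  using commutator_centre[OF assms, of c1 c2]
proof eventually_elim
  case (elim x)
  have "norm (a * b * t0 - b * t1 - a * t2 + t3) \<le> norm a * norm b * norm t0 + norm b * norm t1 + norm a * norm t2 + 1 * norm t3"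
    for a b t0 t1 t2 t3 :: complex
  proof -
    have "norm (a * b * t0 - b * t1 - a * t2 + t3) \<le> norm (a * b * t0) + norm (b * t1) + norm (a * t2) + norm t3"
      by (intro order_trans[OF norm_triangle_ineq] order_trans[OF norm_triangle_ineq4] add_mono order_refl)
    then show ?thesis by (simp add: norm_mult)
  qed
  then show ?case unfolding elim sum_lessThan_4 by (simp add: weight_def)
qed

lemma commutator_add:
  assumes "admissible b1 b2 f" "admissible b1 b2 g"
  shows "AE x in lebesgue. comm2 b1 b2 (\<lambda>y. f y + g y) x = comm2 b1 b2 f x + comm2 b1 b2 g x"
proof -
  note a = assms[unfolded admissible_def]
  have 0: "AE x in lebesgue. T (\<lambda>y. f y + g y) x = T f x + T g x" using a by (intro T_add) auto
  have 1: "AE x in lebesgue. T (\<lambda>y. b1 y * f y + b1 y * g y) x = T (\<lambda>y. b1 y * f y) x + T (\<lambda>y. b1 y * g y) x"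
    using a by (intro T_add) auto
  have 2: "AE x in lebesgue. T (\<lambda>y. b2 y * f y + b2 y * g y) x = T (\<lambda>y. b2 y * f y) x + T (\<lambda>y. b2 y * g y) x"
    using a by (intro T_add) auto
  have 3: "AE x in lebesgue. T (\<lambda>y. b1 y * (b2 y * f y) + b1 y * (b2 y * g y)) x
      = T (\<lambda>y. b1 y * (b2 y * f y)) x + T (\<lambda>y. b1 y * (b2 y * g y)) x"
    using a by (intro T_add) auto
  show ?thesis using 0 1 2 3
    by eventually_elim (simp add: mult_comm_def distrib_left right_diff_distrib)
qed

lemma commutator_cong_AE:
  assumes "admissible b1 b2 f" "admissible b1 b2 g" and eq: "AE x in lebesgue. f x = g x"
  shows "AE x in lebesgue. comm2 b1 b2 f x = comm2 b1 b2 g x"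
proof -
  note a = assms(1,2)[unfolded admissible_def]
  have m: "AE x in lebesgue. h x * f x = h x * g x" for h using eq by eventually_elim simp
  have "AE x in lebesgue. b1 x * (b2 x * f x) = b1 x * (b2 x * g x)" using eq by eventually_elim simp
  then have 3: "AE x in lebesgue. T (\<lambda>y. b1 y * (b2 y * f y)) x = T (\<lambda>y. b1 y * (b2 y * g y)) x"
    using a by (intro T_cong_AE) auto
  have 0: "AE x in lebesgue. T f x = T g x" using a eq by (intro T_cong_AE) auto
  have 1: "AE x in lebesgue. T (\<lambda>y. b1 y * f y) x = T (\<lambda>y. b1 y * g y) x"
    using a m by (intro T_cong_AE) auto
  have 2: "AE x in lebesgue. T (\<lambda>y. b2 y * f y) x = T (\<lambda>y. b2 y * g y) x"
    using a m by (intro T_cong_AE) auto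
  show ?thesis using 0 1 2 3 by eventually_elim (simp add: mult_comm_def)
qed

text \<open>On a stopping cube \<open>p\<close> the function is split into its pieces on
  \<open>star p\<close> and on the rest of \<open>star q\<close>. Only the second is centred at the
  averages over \<open>star q\<close>; the first is handed on as a commutator of the original form,
  ready to be centred at the averages over \<open>star p\<close> in the next round.\<close>

lemma commutator_step:
  obtains C where "0 < C" "\<And>b1 b2 f q. 0 < snd q \<Longrightarrow> admissible b1 b2 f \<Longrightarrow>
    \<exists>F. half_packing q F \<and>
      (AE x in lebesgue. x \<in> hcube q \<longrightarrow>
        (x \<notin> (\<Union>p\<in>F. hcube p) \<longrightarrow> norm (comm2 b1 b2 (cutoff (star q) f) x) \<le> C * sparse_term b1 b2 f (star q) x) \<and>
        (\<forall>p\<in>F. x \<in> hcube p \<longrightarrow> norm (comm2 b1 b2 (cutoff (star q) f) x)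
            \<le> C * sparse_term b1 b2 f (star q) x + norm (comm2 b1 b2 (cutoff (star p) f) x)))"
proof -
  show ?thesis
  proof (rule stopping_step, goal_cases)
  case (1 C)
  note C = 1
  define N where "N = (4 * real DIM('a) + 1) ^ DIM('a)"
  have N: "0 < N" by (simp add: N_def add_nonneg_pos)
  show ?case
  proof (rule that[of "C * N"], goal_cases)
    case 1
    show ?case using C(1) N by simp
  next
    case (2 b1 b2 f q)
    note q = 2(1) and adm = 2(2)
    define c1 where "c1 = avg (star q) b1"
    define c2 where "c2 = avg (star q) b2"
    define w where "w = weight b1 b2 c1 c2"
    define G where "G i = cutoff (star q) (centred b1 b2 c1 c2 f i)" for i
    have G: "integrable lebesgue (G i)" for i unfolding G_def by (intro integrable_cutoff integrable_centred adm) simp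
    have G0: "x \<notin> star q \<Longrightarrow> G i x = 0" for i x by (simp add: G_def cutoff_def)
    have IG: "C * (L1norm (G i)) / vol q = C * N * avg (star q) (\<lambda>y. norm (centred b1 b2 c1 c2 f i y))" for i
      using integral_cutoff_star_avg[OF q, of "\<lambda>y. norm (centred b1 b2 c1 c2 f i y)"]
      by (simp add: G_def norm_cutoff N_def times_divide_eq_right[symmetric] del: times_divide_eq_right)
    have W: "C * N * sparse_term b1 b2 f (star q) x = (\<Sum>i<4. w i x * (C * (L1norm (G i)) / vol q))"
      if "x \<in> star q" for x
      using that unfolding IG sparse_term_def sum_distrib_left by (intro sum.cong) (auto simp: w_def c1_def c2_def)
    obtain F where F: "half_packing q F"
      "\<forall>x \<in> hcube q - (\<Union>p\<in>F. hcube p). \<forall>i<4. norm (T (G i) x) \<le> C * (L1norm (G i)) / vol q"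
      "\<forall>p\<in>F. AE x in lebesgue. x \<in> hcube p \<longrightarrow>
        (\<forall>i<4. norm (T (cutoff (- star p) (G i)) x) \<le> C * (L1norm (G i)) / vol q)"
      using C(2)[of q G, OF q G G0] by blast
    have sub: "0 < snd p" "hcube p \<subseteq> hcube q" if "p \<in> F" for p using F(1) that by (auto simp: half_packing_def)
    have cF: "countable F" using F(1) unfolding half_packing_def by (intro countable_disjoint_hcubes) auto
    have bound: "norm z \<le> C * N * sparse_term b1 b2 f (star q) x"
      if "norm z \<le> (\<Sum>i<4. w i x * norm (t i))" "x \<in> star q"
        "\<forall>i<4. norm (t i) \<le> C * (L1norm (G i)) / vol q" for z :: complex and t :: "nat \<Rightarrow> complex" and x
    proof -
      have "(\<Sum>i<4. w i x * norm (t i)) \<le> (\<Sum>i<4. w i x * (C * (L1norm (G i)) / vol q))"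
        using that(3) by (intro sum_mono mult_left_mono) (auto simp: w_def weight_nonneg)
      then show ?thesis using that(1) W[OF that(2)] by linarith
    qed
    have qs: "hcube q \<subseteq> star q" by (rule hcube_subset_star[OF q])
    have adq: "admissible b1 b2 (cutoff (star q) f)" by (intro admissible_cutoff adm) simp
    have "AE x in lebesgue. norm (comm2 b1 b2 (cutoff (star q) f) x) \<le> (\<Sum>i<4. w i x * norm (T (G i) x))"
      using commutator_centre_bound[OF adq, of c1 c2] by (simp add: centred_cutoff G_def w_def)
    then have first: "AE x in lebesgue. x \<in> hcube q \<longrightarrow> x \<notin> (\<Union>p\<in>F. hcube p) \<longrightarrow>
        norm (comm2 b1 b2 (cutoff (star q) f) x) \<le> C * N * sparse_term b1 b2 f (star q) x"
    proof eventually_elim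
      case (elim x)
      show ?case
      proof (intro impI)
        assume "x \<in> hcube q" "x \<notin> (\<Union>p\<in>F. hcube p)"
        then show "norm (comm2 b1 b2 (cutoff (star q) f) x) \<le> C * N * sparse_term b1 b2 f (star q) x"
          using qs F(2) by (intro bound[OF elim]) blast+
      qed
    qed
    have second: "AE x in lebesgue. x \<in> hcube p \<longrightarrow> norm (comm2 b1 b2 (cutoff (star q) f) x)
            \<le> C * N * sparse_term b1 b2 f (star q) x + norm (comm2 b1 b2 (cutoff (star p) f) x)" if p: "p \<in> F" for p
    proof -
      let ?h = "cutoff (- star p) (cutoff (star q) f)"
      have pq: "hcube p \<subseteq> hcube q" "0 < snd p" using sub[OF p] by auto
      have adp: "admissible b1 b2 (cutoff (star p) f)" by (intro admissible_cutoff adm) simp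
      have adh: "admissible b1 b2 ?h" by (intro admissible_cutoff adq lebesgue_sets_compl) simp
      have "cutoff (star q) f = (\<lambda>y. cutoff (star p) f y + ?h y)"
        using star_mono[OF pq] by (auto simp: cutoff_def fun_eq_iff)
      then have "AE x in lebesgue. comm2 b1 b2 (cutoff (star q) f) x = comm2 b1 b2 (cutoff (star p) f) x + comm2 b1 b2 ?h x"
        using commutator_add[OF adp adh] by simp
      moreover have "AE x in lebesgue. norm (comm2 b1 b2 ?h x) \<le> (\<Sum>i<4. w i x * norm (T (cutoff (- star p) (G i)) x))"
        using commutator_centre_bound[OF adh, of c1 c2] by (simp add: centred_cutoff G_def w_def)
      ultimately show ?thesis using F(3)[rule_format, OF p]
      proof eventually_elim
        case (elim x)
        show ?case
        proof
          assume x: "x \<in> hcube p"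
          then have "x \<in> star q" using pq qs by blast
          then have "norm (comm2 b1 b2 ?h x) \<le> C * N * sparse_term b1 b2 f (star q) x"
            using elim(3) x by (intro bound[OF elim(2)]) auto
          then show "norm (comm2 b1 b2 (cutoff (star q) f) x)
            \<le> C * N * sparse_term b1 b2 f (star q) x + norm (comm2 b1 b2 (cutoff (star p) f) x)"
            unfolding elim(1) using norm_triangle_ineq[of "comm2 b1 b2 (cutoff (star p) f) x" "comm2 b1 b2 ?h x"] by linarith
        qed
      qed
    qed
    have "AE x in lebesgue. \<forall>p\<in>F. x \<in> hcube p \<longrightarrow> norm (comm2 b1 b2 (cutoff (star q) f) x)
            \<le> C * N * sparse_term b1 b2 f (star q) x + norm (comm2 b1 b2 (cutoff (star p) f) x)"
      using second by (subst AE_ball_countable[OF cF]) blast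
    with first have "AE x in lebesgue. x \<in> hcube q \<longrightarrow>
        (x \<notin> (\<Union>p\<in>F. hcube p) \<longrightarrow> norm (comm2 b1 b2 (cutoff (star q) f) x) \<le> C * N * sparse_term b1 b2 f (star q) x) \<and>
        (\<forall>p\<in>F. x \<in> hcube p \<longrightarrow> norm (comm2 b1 b2 (cutoff (star q) f) x)
            \<le> C * N * sparse_term b1 b2 f (star q) x + norm (comm2 b1 b2 (cutoff (star p) f) x))"
      by eventually_elim blast
    then show ?case
      using F(1) by blast
  qed
  qed
qed

end

section \<open>Iteration over a tree of cubes\<close>

primrec generation :: "('b \<Rightarrow> 'b set) \<Rightarrow> 'b \<Rightarrow> nat \<Rightarrow> 'b set" where
  "generation ch q 0 = {q}"
| "generation ch q (Suc n) = (\<Union>p\<in>generation ch q n. ch p)"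

text \<open>\<open>half\<close> is asked of every cube of positive side, not just of the descendants
  of \<open>q\<close>; the children can then be chosen for all cubes at once, before any tree
  exists.\<close>

locale cube_tree =
  fixes ch :: "'a::euclidean_space \<times> real \<Rightarrow> ('a \<times> real) set" and q :: "'a \<times> real"
  assumes root: "0 < snd q"
    and half: "\<And>p. 0 < snd p \<Longrightarrow> half_packing p (ch p)"
begin

abbreviation "gen \<equiv> generation ch q"

lemma child: "0 < snd p \<Longrightarrow> p' \<in> ch p \<Longrightarrow> 0 < snd p' \<and> hcube p' \<subseteq> hcube p"
  and child_disjoint: "0 < snd p \<Longrightarrow> p' \<in> ch p \<Longrightarrow> p'' \<in> ch p \<Longrightarrow> p' \<noteq> p'' \<Longrightarrow> hcube p' \<inter> hcube p'' = {}"
  and child_small: "0 < snd p \<Longrightarrow> emeasure lebesgue (\<Union>p'\<in>ch p. hcube p') \<le> ennreal (vol p / 2)"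
  using half unfolding half_packing_def by blast+

definition "tree = (\<Union>n. gen n)"

lemma gen_pos: "p \<in> gen n \<Longrightarrow> 0 < snd p"
proof (induction n arbitrary: p)
  case (Suc n)
  then obtain r where "r \<in> gen n" "p \<in> ch r" by auto
  then show ?case using child[of r p] Suc.IH by blast
qed (simp add: root)

lemma tree_pos: "p \<in> tree \<Longrightarrow> 0 < snd p"
  unfolding tree_def using gen_pos by blast

lemma gen_disjoint: "p \<in> gen n \<Longrightarrow> p' \<in> gen n \<Longrightarrow> p \<noteq> p' \<Longrightarrow> hcube p \<inter> hcube p' = {}"
proof (induction n arbitrary: p p')
  case (Suc n)
  obtain r r' where r: "r \<in> gen n" "p \<in> ch r" "r' \<in> gen n" "p' \<in> ch r'" using Suc.prems(1,2) by auto
  show ?case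
  proof (cases "r = r'")
    case True
    then show ?thesis using child_disjoint[of r p p'] r Suc.prems(3) gen_pos by blast
  next
    case False
    then have "hcube r \<inter> hcube r' = {}" using Suc.IH r by blast
    then show ?thesis using child[of r p] child[of r' p'] r gen_pos by blast
  qed
qed simp

lemma countable_gen: "countable (gen n)"
  using gen_pos gen_disjoint by (intro countable_disjoint_hcubes) blast+

lemma countable_tree: "countable tree"
  unfolding tree_def using countable_gen by blast

lemma gen_ancestor:
  assumes "p \<in> gen (Suc (k + m))"
  shows "\<exists>r\<in>gen k. \<exists>s\<in>ch r. hcube p \<subseteq> hcube s"
  using assms
proof (induction m arbitrary: p)
  case 0
  then show ?case by auto
next
  case (Suc m)
  then obtain r where r: "r \<in> gen (Suc (k + m))" "p \<in> ch r" by auto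
  then show ?case using Suc.IH[OF r(1)] child[OF gen_pos[OF r(1)] r(2)] by blast
qed

lemma gen_subset_root: "p \<in> gen n \<Longrightarrow> hcube p \<subseteq> hcube q"
proof (induction n arbitrary: p)
  case (Suc n)
  then obtain r where r: "r \<in> gen n" "p \<in> ch r" by auto
  then show ?case using Suc.IH[OF r(1)] child[OF gen_pos[OF r(1)] r(2)] by blast
qed simp

lemma tree_subset_root: "p \<in> tree \<Longrightarrow> hcube p \<subseteq> hcube q"
  unfolding tree_def using gen_subset_root by blast

lemma countable_ch: "0 < snd p \<Longrightarrow> countable (ch p)"
  using child child_disjoint by (intro countable_disjoint_hcubes) blast+

lemma ch_union_lebesgue: "0 < snd p \<Longrightarrow> (\<Union>p'\<in>ch p. hcube p') \<in> sets lebesgue"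
  using countable_ch by (intro sets.countable_UN') auto

text \<open>The children cover at most half of each cube, and the cubes of one generation are
  disjoint, so their volumes add up to the measure of their union.\<close>

lemma emeasure_gen: "emeasure lebesgue (\<Union>p\<in>gen n. hcube p) \<le> ennreal (vol q * (1/2) ^ n)"
proof (induction n)
  case 0
  then show ?case using root by (simp add: emeasure_hcube)
next
  case (Suc n)
  have "emeasure lebesgue (\<Union>p\<in>gen n. \<Union>p'\<in>ch p. hcube p') \<le> ennreal (vol q * (1/2) ^ n / 2)"
  proof (rule emeasure_UN_le_sum[OF countable_gen])
    fix p assume "p \<in> gen n"
    then have p: "0 < snd p" by (rule gen_pos)
    show "(\<Union>p'\<in>ch p. hcube p') \<in> sets lebesgue" by (rule ch_union_lebesgue[OF p])
    show "emeasure lebesgue (\<Union>p'\<in>ch p. hcube p') \<le> ennreal (vol p / 2)" by (rule child_small[OF p])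
    show "0 \<le> vol p / 2" using p by simp
  next
    fix F' assume F': "finite F'" "F' \<subseteq> gen n"
    have pos: "0 < snd p" if "p \<in> F'" for p using F'(2) that gen_pos by blast
    have "ennreal (\<Sum>p\<in>F'. vol p) = (\<Sum>p\<in>F'. ennreal (vol p))"
      using pos by (intro sum_ennreal[symmetric] zero_le_power less_imp_le)
    also have "\<dots> = (\<Sum>p\<in>F'. emeasure lebesgue (hcube p))"
      using pos by (intro sum.cong refl emeasure_hcube[symmetric] less_imp_le)
    also have "\<dots> = emeasure lebesgue (\<Union>p\<in>F'. hcube p)"
    proof (rule sum_emeasure[OF _ _ F'(1)])
      show "disjoint_family_on hcube F'"
        unfolding disjoint_family_on_def using gen_disjoint F'(2) by blast
    qed auto
    also have "\<dots> \<le> emeasure lebesgue (\<Union>p\<in>gen n. hcube p)"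
      using F'(2) countable_gen by (intro emeasure_mono sets.countable_UN') auto
    also have "\<dots> \<le> ennreal (vol q * (1/2) ^ n)" by (rule Suc.IH)
    finally have "(\<Sum>p\<in>F'. vol p) \<le> vol q * (1/2) ^ n"
      using root by (subst (asm) ennreal_le_iff) auto
    then show "(\<Sum>p\<in>F'. vol p / 2) \<le> vol q * (1/2) ^ n / 2"
      by (simp add: sum_divide_distrib[symmetric])
  qed
  then show ?case by simp
qed

text \<open>The points that belong to all generations form a set of measure at most
  \<open>vol q * (1/2) ^ n\<close> for each \<open>n\<close>. Hence the recursion stops almost
  everywhere, and no limit of commutators has to be taken.\<close>

lemma AE_leaves_tree: "AE x in lebesgue. \<exists>n. x \<notin> (\<Union>p\<in>gen n. hcube p)"
proof -
  let ?Z = "\<Inter>n. \<Union>p\<in>gen n. hcube p"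
  have m: "(\<Union>p\<in>gen n. hcube p) \<in> sets lebesgue" for n using countable_gen by (intro sets.countable_UN') auto
  have Z: "?Z \<in> sets lebesgue" using m by (intro sets.countable_INT) auto
  have le: "emeasure lebesgue ?Z \<le> ennreal (vol q * (1/2) ^ n)" for n
    using m by (intro order_trans[OF emeasure_mono emeasure_gen[of n]]) auto
  have "(\<lambda>n. ennreal (vol q * (1/2) ^ n)) \<longlonglongrightarrow> ennreal (vol q * 0)"
    by (intro tendsto_ennrealI tendsto_intros LIMSEQ_power_zero) simp
  then have "(\<lambda>n. ennreal (vol q * (1/2) ^ n)) \<longlonglongrightarrow> 0" by simp
  then have "emeasure lebesgue ?Z \<le> 0" using le by (intro LIMSEQ_le_const) auto
  then have "?Z \<in> null_sets lebesgue" using Z by (auto simp: null_sets_def)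
  then show ?thesis by (rule AE_I') auto
qed

text \<open>These become the disjoint sets that sparseness asks for; the children leave at least
  half of \<open>p\<close> to them.\<close>

definition "core p = hcube p - (\<Union>p'\<in>ch p. hcube p')"

lemma core_lebesgue: "p \<in> tree \<Longrightarrow> core p \<in> sets lebesgue"
  unfolding core_def using ch_union_lebesgue tree_pos by auto

lemma measure_core:
  assumes "p \<in> tree"
  shows "vol p / 2 \<le> measure lebesgue (core p)"
proof -
  have p: "0 < snd p" using tree_pos[OF assms] .
  let ?U = "\<Union>p'\<in>ch p. hcube p'"
  have "measure lebesgue ?U \<le> vol p / 2"
    unfolding measure_def using p child_small[OF p] by (intro enn2real_leI) auto
  moreover have "measure lebesgue (core p) = measure lebesgue (hcube p) - measure lebesgue ?U"
    unfolding core_def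
  proof (rule measure_Diff)
    show "emeasure lebesgue (hcube p) \<noteq> \<infinity>" using p by (simp add: emeasure_hcube)
    show "?U \<subseteq> hcube p" using child[OF p] by blast
  qed (use ch_union_lebesgue[OF p] in auto)
  ultimately show ?thesis using p by (simp add: measure_hcube)
qed

text \<open>A cube \<open>p'\<close> of a later generation lies in a child of some cube
  \<open>r\<close> of the generation of \<open>p\<close>. Either \<open>r = p\<close>, and this
  child has been removed from \<open>core p\<close>, or \<open>r\<close> and \<open>p\<close> are
  disjoint.\<close>

lemma core_disjoint_aux:
  assumes "p \<in> gen k" "p' \<in> gen m" "p \<noteq> p'" "k \<le> m"
  shows "core p \<inter> core p' = {}"
proof (cases "k = m")
  case True
  then show ?thesis using gen_disjoint[of p k p'] assms by (auto simp: core_def)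
next
  case False
  then obtain j where "m = Suc (k + j)" using assms(4) less_iff_Suc_add[of k m] by auto
  then obtain r s where rs: "r \<in> gen k" "s \<in> ch r" "hcube p' \<subseteq> hcube s" using gen_ancestor assms(2) by blast
  show ?thesis
  proof (cases "r = p")
    case True
    then show ?thesis using rs by (auto simp: core_def)
  next
    case False
    then have "hcube p \<inter> hcube r = {}" using gen_disjoint assms(1) rs(1) by blast
    then show ?thesis using child[OF gen_pos[OF rs(1)] rs(2)] rs(3) unfolding core_def by blast
  qed
qed

lemma core_disjoint: "p \<in> tree \<Longrightarrow> p' \<in> tree \<Longrightarrow> p \<noteq> p' \<Longrightarrow> core p \<inter> core p' = {}"
  unfolding tree_def using core_disjoint_aux by (metis Int_commute UN_E nle_le)

text \<open>A child has at most half the volume. Hence no cube lies inside one of its own children,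
  which keeps the cubes of a branch distinct.\<close>

lemma child_smaller:
  assumes p: "0 < snd p" and c: "p' \<in> ch p"
  shows "snd p' < snd p"
proof -
  have p': "0 < snd p'" using child[OF p c] by simp
  have "ennreal (vol p') = emeasure lebesgue (hcube p')" using p' by (simp add: emeasure_hcube)
  also have "\<dots> \<le> emeasure lebesgue (\<Union>p'\<in>ch p. hcube p')"
    using c ch_union_lebesgue[OF p] by (intro emeasure_mono) auto
  also have "\<dots> \<le> ennreal (vol p / 2)" by (rule child_small[OF p])
  finally have "vol p' \<le> vol p / 2" using p by (subst (asm) ennreal_le_iff) auto
  also have "\<dots> < vol p" using p by simp
  finally show ?thesis using p by (simp add: power_less_imp_less_base)
qed

text \<open>Follow the branch of cubes that contain \<open>x\<close>: \<open>step\<close> descends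
  by one generation, \<open>leaf\<close> ends the branch, and it has to end before generation
  \<open>n\<close>.\<close>

lemma tree_sum_bound:
  fixes u v :: "'a \<times> real \<Rightarrow> real"
  assumes leaf: "\<And>p. p \<in> tree \<Longrightarrow> x \<in> hcube p \<Longrightarrow> x \<notin> (\<Union>p'\<in>ch p. hcube p') \<Longrightarrow> u p \<le> v p"
    and step: "\<And>p p'. p \<in> tree \<Longrightarrow> p' \<in> ch p \<Longrightarrow> x \<in> hcube p' \<Longrightarrow> u p \<le> v p + u p'"
    and x: "x \<in> hcube q" "x \<notin> (\<Union>p\<in>gen n. hcube p)"
  shows "\<exists>H. finite H \<and> H \<subseteq> tree \<and> u q \<le> sum v H"
proof -
  \<comment> \<open>Induction on the number \<open>m\<close> of generations that are left. The cubes
    of \<open>H\<close> are kept inside \<open>p\<close>, so that a larger cube can be inserted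
    later without occurring twice in the sum.\<close>
  have "\<exists>H. finite H \<and> H \<subseteq> {p'\<in>tree. hcube p' \<subseteq> hcube p} \<and> u p \<le> sum v H"
    if "k + m = n" "p \<in> gen k" "x \<in> hcube p" for k m p
    using that
  proof (induction m arbitrary: k p)
    case 0
    then show ?case using x by auto
  next
    case (Suc m)
    have pt: "p \<in> tree" using Suc.prems by (auto simp: tree_def)
    show ?case
    proof (cases "x \<in> (\<Union>p'\<in>ch p. hcube p')")
      case False
      then show ?thesis using leaf[OF pt Suc.prems(3)] pt by (intro exI[of _ "{p}"]) auto
    next
      case True
      then obtain p' where p': "p' \<in> ch p" "x \<in> hcube p'" by blast
      have "p' \<in> gen (Suc k)" using Suc.prems(2) p'(1) by auto
      then obtain H where H: "finite H" "H \<subseteq> {p''\<in>tree. hcube p'' \<subseteq> hcube p'}" "u p' \<le> sum v H"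
        using Suc.IH[of "Suc k" p'] Suc.prems(1) p'(2) by auto
      have p0: "0 < snd p" by (rule tree_pos[OF pt])
      have "p \<notin> H"
      proof
        assume "p \<in> H"
        then have "hcube p \<subseteq> hcube p'" using H(2) by blast
        then show False using hcube_subset_snd[of p p'] child_smaller[OF p0 p'(1)] p0 by simp
      qed
      then have "u p \<le> sum v (insert p H)" using step[OF pt p'] H by simp
      moreover have "insert p H \<subseteq> {p'\<in>tree. hcube p' \<subseteq> hcube p}"
        using H(2) pt child[OF p0 p'(1)] by blast
      ultimately show ?thesis using H(1) by (intro exI[of _ "insert p H"]) simp
    qed
  qed
  from this[of 0 n q] x show ?thesis by auto
qed

end

section \<open>The bound on one cube\<close>

context cz_operator
begin

lemma commutator_local_sparse:
  obtains C where "0 < C" "\<And>b1 b2 f q. 0 < snd q \<Longrightarrow> admissible b1 b2 f \<Longrightarrow>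
    \<exists>F E. (\<forall>p\<in>F. 0 < snd p \<and> hcube p \<subseteq> hcube q \<and> E p \<subseteq> hcube p \<and> E p \<in> sets lebesgue
        \<and> vol p / 2 \<le> measure lebesgue (E p)) \<and>
      (\<forall>p\<in>F. \<forall>p'\<in>F. p \<noteq> p' \<longrightarrow> E p \<inter> E p' = {}) \<and>
      (AE x in lebesgue. x \<in> hcube q \<longrightarrow>
        (\<exists>H. finite H \<and> H \<subseteq> F \<and> norm (comm2 b1 b2 (cutoff (star q) f) x) \<le> (\<Sum>p\<in>H. C * sparse_term b1 b2 f (star p) x)))"
proof -
  show ?thesis
  proof (rule commutator_step, goal_cases)
  case (1 C)
  note C = 1
  show ?case
  proof (rule that[OF C(1)], goal_cases)
    case (1 b1 b2 f q)
    note q = 1(1) and adm = 1(2)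
    let ?u = "\<lambda>x p. norm (comm2 b1 b2 (cutoff (star p) f) x)" and ?v = "\<lambda>x p. C * sparse_term b1 b2 f (star p) x"
    define P where "P p F \<longleftrightarrow> half_packing p F \<and>
      (AE x in lebesgue. x \<in> hcube p \<longrightarrow> (x \<notin> (\<Union>p'\<in>F. hcube p') \<longrightarrow> ?u x p \<le> ?v x p) \<and>
        (\<forall>p'\<in>F. x \<in> hcube p' \<longrightarrow> ?u x p \<le> ?v x p + ?u x p'))" for p :: "'a \<times> real" and F
    have "\<exists>F. P p F" if "0 < snd p" for p using C(2)[OF that adm] unfolding P_def .
    then obtain ch where chP: "\<And>p. 0 < snd p \<Longrightarrow> P p (ch p)" by metis
    note ch = chP[unfolded P_def]
    interpret cube_tree ch q by unfold_locales (use q ch in blast)+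
    \<comment> \<open>The tree is countable, so one null set serves all of its cubes.\<close>
    have "AE x in lebesgue. \<forall>p\<in>tree. x \<in> hcube p \<longrightarrow> (x \<notin> (\<Union>p'\<in>ch p. hcube p') \<longrightarrow> ?u x p \<le> ?v x p) \<and>
        (\<forall>p'\<in>ch p. x \<in> hcube p' \<longrightarrow> ?u x p \<le> ?v x p + ?u x p')"
      using ch tree_pos by (subst AE_ball_countable[OF countable_tree]) blast
    with AE_leaves_tree have "AE x in lebesgue. x \<in> hcube q \<longrightarrow> (\<exists>H. finite H \<and> H \<subseteq> tree \<and> ?u x q \<le> sum (?v x) H)"
    proof eventually_elim
      case (elim x)
      show ?case
      proof
        assume x: "x \<in> hcube q"
        obtain n where n: "x \<notin> (\<Union>p\<in>gen n. hcube p)" using elim(1) by blast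
        show "\<exists>H. finite H \<and> H \<subseteq> tree \<and> ?u x q \<le> sum (?v x) H"
        proof (rule tree_sum_bound[OF _ _ x n])
          fix p p' assume p: "p \<in> tree" "p' \<in> ch p" "x \<in> hcube p'"
          then have "x \<in> hcube p" using child[OF tree_pos] by blast
          then show "?u x p \<le> ?v x p + ?u x p'" using elim(2) p by blast
        qed (use elim(2) in blast)
      qed
    qed
    then show ?case
      using tree_pos tree_subset_root core_lebesgue measure_core core_disjoint
      by (intro exI[of _ tree] exI[of _ core] conjI) (auto simp: core_def)
  qed
  qed
qed

end

section \<open>Global sparse domination\<close>

text \<open>The disjoint sets are found for codes of cubes, while \<open>sparse\<close> asks for a
  choice depending on the cube as a set; injectivity lets \<open>inv_into\<close> translate.\<close>

lemma sparse_imageI: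
  assumes inj: "inj_on Q I"
    and E: "\<And>i. i \<in> I \<Longrightarrow> E i \<subseteq> Q i \<and> E i \<in> sets lebesgue \<and> \<gamma> * measure lebesgue (Q i) < measure lebesgue (E i)"
    and dis: "\<And>i j. i \<in> I \<Longrightarrow> j \<in> I \<Longrightarrow> i \<noteq> j \<Longrightarrow> E i \<inter> E j = {}"
  shows "sparse \<gamma> (Q ` I)"
  unfolding sparse_def
proof (intro exI[of _ "\<lambda>R. E (inv_into I Q R)"] conjI ballI impI)
  fix R assume "R \<in> Q ` I"
  then obtain i where "i \<in> I" "R = Q i" by blast
  then show "E (inv_into I Q R) \<subseteq> R" "E (inv_into I Q R) \<in> sets lebesgue"
    "\<gamma> * measure lebesgue R < measure lebesgue (E (inv_into I Q R))"
    using E inv_into_f_f[OF inj] by auto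
  fix R' assume "R' \<in> Q ` I" "R \<noteq> R'"
  then obtain j where "j \<in> I" "R' = Q j" by blast
  then show "E (inv_into I Q R) \<inter> E (inv_into I Q R') = {}"
    using dis[of i j] inv_into_f_f[OF inj] \<open>i \<in> I\<close> \<open>R = Q i\<close> \<open>R \<noteq> R'\<close> by auto
qed

lemma integrable_of_loc_int:
  assumes g: "loc_int g" and S: "compact S" and z: "AE x in lebesgue. x \<notin> S \<longrightarrow> g x = 0"
  shows "integrable lebesgue g"
proof -
  have [measurable]: "g \<in> borel_measurable lebesgue" using g by (simp add: loc_int_def)
  have int: "integrable lebesgue (\<lambda>x. indicator S x *\<^sub>R g x)"
    using g S unfolding loc_int_def set_integrable_def by blast
  have "AE x in lebesgue. indicator S x *\<^sub>R g x = g x"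
    using z by eventually_elim (auto simp: indicator_def)
  then show ?thesis
    using integrable_cong_AE[of "\<lambda>x. indicator S x *\<^sub>R g x" lebesgue g] int borel_measurable_integrable[OF int] by auto
qed

text \<open>Its dilate is the closed ball of radius \<open>(4 * d + 1) * r\<close> in the maximum
  norm.\<close>

definition centred_cube :: "real \<Rightarrow> 'a::euclidean_space \<times> real" where
  "centred_cube r = (- (r *\<^sub>R One), 2 * r)"

lemma snd_centred_cube [simp]: "snd (centred_cube r) = 2 * r"
  by (simp add: centred_cube_def)

lemma mem_star_centred_cube:
  fixes x :: "'a::euclidean_space"
  shows "x \<in> star (centred_cube r) \<longleftrightarrow> (\<forall>i\<in>Basis. \<bar>x \<bullet> i\<bar> \<le> (4 * real DIM('a) + 1) * r)"
  unfolding mem_star_iff by (intro ball_cong refl) (auto simp: centred_cube_def inner_simps abs_le_iff algebra_simps)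

lemma notin_hcube_centred_cube:
  fixes x :: "'a::euclidean_space"
  assumes "x \<notin> hcube (centred_cube r)"
  shows "\<exists>i\<in>Basis. r \<le> \<bar>x \<bullet> i\<bar>"
proof -
  obtain i where "i \<in> Basis" "\<not> (- r \<le> x \<bullet> i \<and> x \<bullet> i < r)"
    using assms by (auto simp: hcube_def centred_cube_def inner_simps)
  then show ?thesis by (intro bexI[of _ i]) auto
qed

context cz_operator
begin

text \<open>At distance \<open>r\<close> from the support the kernel is at most
  \<open>C / r ^ DIM('a)\<close>, and the side of \<open>R\<close> is at most a fixed multiple of
  \<open>r\<close>. So \<open>T\<close> of each centred function is bounded by its average over
  \<open>star R\<close> directly, with no cancellation.\<close>

lemma commutator_far:
  obtains C where "0 \<le> C" "\<And>b1 b2 f S r R. admissible b1 b2 f \<Longrightarrow> closed S \<Longrightarrow> (\<And>y. y \<notin> S \<Longrightarrow> f y = 0) \<Longrightarrow>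
    0 < r \<Longrightarrow> S \<subseteq> star R \<Longrightarrow> 0 < snd R \<Longrightarrow> snd R \<le> 2 * (4 * real DIM('a) + 1) * (2 * r) \<Longrightarrow>
    (AE x in lebesgue. x \<in> star R \<longrightarrow> (\<forall>y\<in>S. r \<le> dist x y) \<longrightarrow> norm (comm2 b1 b2 f x) \<le> C * sparse_term b1 b2 f (star R) x)"
proof -
  obtain C where C: "0 \<le> C" "\<And>x y. x \<noteq> y \<Longrightarrow> norm (K x y) \<le> C / dist x y ^ DIM('a)"
    by (rule kernel_size) blast
  define N where "N = 4 * real DIM('a) + 1"
  have N: "0 < N" by (simp add: N_def add_nonneg_pos)
  \<comment> \<open>\<open>4 * N\<close> bounds the ratio of \<open>snd R\<close> to
    \<open>r\<close>; the factor \<open>N ^ DIM('a)\<close> comes from averaging over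
    \<open>star R\<close> in place of the small cube.\<close>
  define C' where "C' = C * (4 * N) ^ DIM('a) * N ^ DIM('a)"
  show ?thesis
  proof (rule that[of C'], goal_cases)
    case 1
    show ?case using C N by (simp add: C'_def)
  next
    case (2 b1 b2 f S r R)
    note adm = 2(1) and S = 2(2) and supp = 2(3) and r = 2(4) and SR = 2(5) and R = 2(6,7)
    define c1 where "c1 = avg (star R) b1"
    define c2 where "c2 = avg (star R) b2"
    define G where "G = centred b1 b2 c1 c2 f"
    have G: "integrable lebesgue (G i)" for i unfolding G_def by (rule integrable_centred[OF adm])
    have G0: "y \<notin> S \<Longrightarrow> G i y = 0" for i y using supp by (simp add: G_def centred_def)
    have cutG: "cutoff (star R) (\<lambda>y. norm (G i y)) = (\<lambda>y. norm (G i y))" for i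
      using G0[of _ i] SR by (force simp: cutoff_def fun_eq_iff)
    have IG: "(L1norm (G i)) = vol R * N ^ DIM('a) * avg (star R) (\<lambda>y. norm (G i y))" for i
      using integral_cutoff_star_avg[OF R(1), of "\<lambda>y. norm (G i y)"] R(1) unfolding cutG N_def[symmetric] by (simp add: field_simps)
    have ker: "norm (LINT y|lebesgue. K x y * G i y) \<le> C' * avg (star R) (\<lambda>y. norm (G i y))"
      if far: "\<forall>y\<in>S. r \<le> dist x y" for x i
    proof -
      have z: "G i y = 0" if "dist x y < r" for y using G0[of y i] far that by force
      have int: "integrable lebesgue (\<lambda>y. K x y * G i y)" by (rule kernel_mult_integrable[OF G r z])
      have "norm (LINT y|lebesgue. K x y * G i y) \<le> (LINT y|lebesgue. norm (K x y * G i y))" by (rule integral_norm_bound)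
      also have "\<dots> \<le> (LINT y|lebesgue. C / r ^ DIM('a) * norm (G i y))"
      proof (rule integral_mono)
        show "integrable lebesgue (\<lambda>y. norm (K x y * G i y))" using int by (rule integrable_norm)
        show "integrable lebesgue (\<lambda>y. C / r ^ DIM('a) * norm (G i y))" using G by simp
        fix y
        show "norm (K x y * G i y) \<le> C / r ^ DIM('a) * norm (G i y)"
        proof (cases "dist x y < r")
          case False
          then have "0 < dist x y" using r by linarith
          then have "x \<noteq> y" by auto
          from C(2)[OF this] have "norm (K x y) \<le> C / dist x y ^ DIM('a)" .
          also have "\<dots> \<le> C / r ^ DIM('a)"
            using False r C(1) \<open>0 < dist x y\<close> by (intro divide_left_mono power_mono mult_pos_pos zero_less_power) auto
          finally show ?thesis unfolding norm_mult by (rule mult_right_mono) simp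
        qed (simp add: z)
      qed
      also have "\<dots> = C / r ^ DIM('a) * (L1norm (G i))" by simp
      also have "\<dots> = C * (snd R / r) ^ DIM('a) * N ^ DIM('a) * avg (star R) (\<lambda>y. norm (G i y))"
        unfolding IG by (simp add: power_divide)
      also have "\<dots> \<le> C' * avg (star R) (\<lambda>y. norm (G i y))"
        unfolding C'_def
      proof (intro mult_right_mono mult_left_mono power_mono)
        show "snd R / r \<le> 4 * N" using R(2) r by (simp add: N_def divide_le_eq mult_ac)
      qed (use C N R r in \<open>auto intro: avg_nonneg\<close>)
      finally show ?thesis .
    qed
    have "AE x in lebesgue. \<forall>i\<in>{..<4}. x \<notin> S \<longrightarrow> T (G i) x = (LINT y|lebesgue. K x y * G i y)"
      using T_kernel[OF G S G0] by (subst AE_ball_countable) auto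
    moreover have "AE x in lebesgue. norm (comm2 b1 b2 f x) \<le> (\<Sum>i<4. weight b1 b2 c1 c2 i x * norm (T (G i) x))"
      unfolding G_def by (rule commutator_centre_bound[OF adm])
    ultimately show ?case
    proof eventually_elim
      case (elim x)
      show ?case
      proof (intro impI)
        assume x: "x \<in> star R" and far: "\<forall>y\<in>S. r \<le> dist x y"
        have "x \<notin> S" using far r by force
        then have "(\<Sum>i<4. weight b1 b2 c1 c2 i x * norm (T (G i) x))
            \<le> (\<Sum>i<4. weight b1 b2 c1 c2 i x * (C' * avg (star R) (\<lambda>y. norm (G i y))))"
          using elim(1) ker[OF far] by (intro sum_mono mult_left_mono weight_nonneg) auto
        also have "\<dots> = C' * sparse_term b1 b2 f (star R) x"
          unfolding sparse_term_def sum_distrib_left using x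
          by (intro sum.cong) (auto simp: G_def c1_def c2_def)
        finally show "norm (comm2 b1 b2 f x) \<le> C' * sparse_term b1 b2 f (star R) x" using elim(2) by linarith
      qed
    qed
  qed
qed

lemma commutator_sparse:
  obtains CT where "0 < CT" "\<And>f b1 b2. L1c f \<Longrightarrow> loc_int (\<lambda>x. b1 x * f x) \<Longrightarrow> loc_int (\<lambda>x. b2 x * f x) \<Longrightarrow>
    loc_int (\<lambda>x. b1 x * b2 x * f x) \<Longrightarrow>
    \<exists>\<S>. (\<forall>Q\<in>\<S>. is_cube Q) \<and> sparse (1 / (4 * (4 * real DIM('a) + 1) ^ DIM('a))) \<S> \<and>
       (AE x in lebesgue. ennreal (norm (comm2 b1 b2 f x))
          \<le> ennreal CT * (S1 \<S> b1 b2 f x + S2 \<S> b1 b2 f x + S3 \<S> b1 b2 f x + S4 \<S> b1 b2 f x))"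
proof -
  show ?thesis
  proof (rule commutator_local_sparse, rule commutator_far, goal_cases)
  case (1 C D)
  note C = 1(1,2) and D = 1(3,4)
  define N where "N = 4 * real DIM('a) + 1"
  have N5: "5 \<le> N" unfolding N_def using DIM_positive[where 'a='a] by linarith
  then have N: "0 < N" "1 \<le> N" by auto
  have Nd: "5 \<le> N ^ DIM('a)" using self_le_power[of N "DIM('a)"] N5 DIM_positive[where 'a='a] by linarith
  show ?case
  proof (rule that[of "C + D"], goal_cases)
    case 1
    show ?case using C(1) D(1) by simp
  next
    case (2 f b1 b2)
    note f = 2(1) and l1 = 2(2) and l2 = 2(3) and l12 = 2(4)
    obtain S where S: "compact S" and f0: "AE x in lebesgue. x \<notin> S \<longrightarrow> f x = 0" using f unfolding L1c_def by blast
    have adm: "admissible b1 b2 f"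
    proof -
      have z: "AE x in lebesgue. x \<notin> S \<longrightarrow> h x * f x = 0" for h using f0 by eventually_elim simp
      have "integrable lebesgue (\<lambda>x. b1 x * f x)" "integrable lebesgue (\<lambda>x. b2 x * f x)"
        "integrable lebesgue (\<lambda>x. b1 x * b2 x * f x)"
        by (rule integrable_of_loc_int[OF l1 S z] integrable_of_loc_int[OF l2 S z] integrable_of_loc_int[OF l12 S z])+
      then show ?thesis using f by (simp add: admissible_def L1c_def mult.assoc)
    qed
    obtain B where B: "0 < B" "\<And>y. y \<in> S \<Longrightarrow> norm y \<le> B"
      using compact_imp_bounded[OF S] unfolding bounded_pos by blast
    \<comment> \<open>Coordinates of points of \<open>S\<close> are at most \<open>L / 2\<close>, so
      a point outside the cube of half side \<open>L\<close> has distance at least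
      \<open>L / 2\<close> from the support.\<close>
    define L where "L = 2 * B"
    have L: "0 < L" using B by (simp add: L_def)
    have SL: "\<bar>y \<bullet> i\<bar> \<le> L / 2" if "y \<in> S" "i \<in> Basis" for y i
      using B(2)[OF that(1)] Basis_le_norm[OF that(2), of y] by (simp add: L_def)
    \<comment> \<open>The cubes grow by the dilation factor \<open>N\<close>, so that
      \<open>star (Q k)\<close> is the closure of \<open>hcube (Q (Suc k))\<close> and the dilates
      exhaust the space.\<close>
    define Q :: "nat \<Rightarrow> 'a \<times> real" where "Q k = centred_cube (N ^ k * L)" for k
    have Qpos: "0 < snd (Q k)" for k using L N by (simp add: Q_def)
    have memQ: "x \<in> star (Q k) \<longleftrightarrow> (\<forall>i\<in>Basis. \<bar>x \<bullet> i\<bar> \<le> N ^ Suc k * L)" for x :: 'a and k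
      unfolding Q_def mem_star_centred_cube N_def by (simp add: mult.assoc)
    have Nmono: "N ^ j * L \<le> N ^ k * L" if "j \<le> k" for j k
      using that N L by (intro mult_right_mono power_increasing) auto
    have Qmono: "star (Q j) \<subseteq> star (Q k)" if "j \<le> k" for j k
      using Nmono[of "Suc j" "Suc k"] that unfolding subset_iff memQ by (meson Suc_le_mono order_trans)
    have SQ: "S \<subseteq> star (Q k)" for k
    proof
      fix y assume y: "y \<in> S"
      have "L / 2 \<le> N ^ Suc k * L" using Nmono[of 0 "Suc k"] L by simp
      then show "y \<in> star (Q k)" unfolding memQ using SL[OF y] by (meson order_trans)
    qed
    have mQ: "measure lebesgue (star (Q k)) = N ^ DIM('a) * vol (Q k)" for k
      using measure_star[of "Q k"] Qpos[of k] by (simp add: N_def)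
    obtain F E where F: "\<forall>p\<in>F. 0 < snd p \<and> hcube p \<subseteq> hcube (Q 0) \<and> E p \<subseteq> hcube p \<and> E p \<in> sets lebesgue
        \<and> vol p / 2 \<le> measure lebesgue (E p)"
      and dis: "\<forall>p\<in>F. \<forall>p'\<in>F. p \<noteq> p' \<longrightarrow> E p \<inter> E p' = {}"
      and near: "AE x in lebesgue. x \<in> hcube (Q 0) \<longrightarrow>
        (\<exists>H. finite H \<and> H \<subseteq> F \<and> norm (comm2 b1 b2 (cutoff (star (Q 0)) f) x) \<le> (\<Sum>p\<in>H. C * sparse_term b1 b2 f (star p) x))"
      using C(2)[OF Qpos adm, of 0] by blast
    define I where "I = F \<union> range (\<lambda>k. Q (Suc k))"
    \<comment> \<open>Cubes of the tree keep their cores; a concentric cube receives the shell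
      between its dilate and the previous dilate. \<open>THE\<close> recovers the index from the
      pair, which is unique by \<open>Qinj\<close>.\<close>
    define E' where "E' p = (if p \<in> F then E p else star p - star (Q (THE k. p = Q (Suc k))))" for p
    have sndQ: "snd (Q k) = 2 * (N ^ k * L)" for k by (simp add: Q_def)
    have Qinj: "Q j = Q k \<longleftrightarrow> j = k" for j k
    proof
      assume "Q j = Q k"
      then have "N ^ j * L = N ^ k * L" using sndQ by (metis mult_cancel_left zero_neq_numeral)
      then show "j = k" using L N5 by (simp add: power_inject_exp)
    qed simp
    have QF: "Q (Suc k) \<notin> F" for k
    proof
      assume "Q (Suc k) \<in> F"
      then have "snd (Q (Suc k)) \<le> snd (Q 0)" using F hcube_subset_snd Qpos by blast
      then have "N ^ Suc k \<le> 1" using L by (simp add: sndQ)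
      moreover have "1 < N ^ Suc k" using N5 by (intro one_less_power) auto
      ultimately show False by linarith
    qed
    have E'F: "E' p = E p" if "p \<in> F" for p using that by (simp add: E'_def)
    have E'Q: "E' (Q (Suc k)) = star (Q (Suc k)) - star (Q k)" for k
      by (simp add: E'_def QF Qinj)
    have Ipos: "0 < snd p" if "p \<in> I" for p using that F Qpos by (auto simp: I_def)
    have inj: "inj_on star I" using inj_on_subset[OF inj_on_star, of I] Ipos by blast
    \<comment> \<open>A core has at least half of its cube, and the cube has the proportion
      \<open>1 / N ^ DIM('a)\<close> of its dilate. Sparseness asks for a strict inequality, hence 4
      in place of 2. The shells pass easily, as \<open>N ^ DIM('a)\<close> is at least 5.\<close>
    let ?\<gamma> = "1 / (4 * N ^ DIM('a))"
    have sparse: "sparse ?\<gamma> (star ` I)"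
    proof (rule sparse_imageI[OF inj])
      fix p assume "p \<in> I"
      then consider "p \<in> F" | k where "p = Q (Suc k)" by (auto simp: I_def)
      then show "E' p \<subseteq> star p \<and> E' p \<in> sets lebesgue \<and> ?\<gamma> * measure lebesgue (star p) < measure lebesgue (E' p)"
      proof cases
        case 1
        have p: "0 < snd p" using F 1 by blast
        have "?\<gamma> * measure lebesgue (star p) = vol p / 4"
          using measure_star[of p] p N unfolding N_def[symmetric] by simp
        also have "\<dots> < vol p / 2" using p by simp
        also have "\<dots> \<le> measure lebesgue (E p)" using F 1 by blast
        finally show ?thesis using F 1 hcube_subset_star[OF p] unfolding E'F[OF 1] by blast
      next
        case 2
        let ?d = "vol (Q k)"
        have d: "0 < ?d" using Qpos by simp
        have sS: "snd (Q (Suc k)) = N * snd (Q k)" by (simp add: sndQ)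
        have mS: "measure lebesgue (star (Q (Suc k))) = N ^ DIM('a) * (N ^ DIM('a) * ?d)"
          unfolding mQ sS power_mult_distrib ..
        have "measure lebesgue (E' p) = measure lebesgue (star (Q (Suc k))) - measure lebesgue (star (Q k))"
          unfolding 2 E'Q
        proof (rule measure_Diff)
          show "emeasure lebesgue (star (Q (Suc k))) \<noteq> \<infinity>" using emeasure_star[of "Q (Suc k)"] Qpos[of "Suc k"] by simp
        qed (use Qmono[of k "Suc k"] in auto)
        also have "\<dots> = N ^ DIM('a) * ?d * (N ^ DIM('a) - 1)" unfolding mS mQ[of k] by (simp add: algebra_simps)
        finally have mE: "measure lebesgue (E' p) = N ^ DIM('a) * ?d * (N ^ DIM('a) - 1)" .
        have "?\<gamma> * measure lebesgue (star p) = N ^ DIM('a) * ?d * (1 / 4)" unfolding 2 mS using N by simp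
        also have "\<dots> < N ^ DIM('a) * ?d * (N ^ DIM('a) - 1)" using N d Nd by (intro mult_strict_left_mono) auto
        finally show ?thesis using mE unfolding 2 E'Q by auto
      qed
    next
      have FQ: "E p \<inter> (star (Q (Suc k)) - star (Q k)) = {}" if "p \<in> F" for p k
      proof -
        have "E p \<subseteq> hcube (Q 0)" using F that by blast
        also have "\<dots> \<subseteq> star (Q 0)" by (rule hcube_subset_star[OF Qpos])
        also have "\<dots> \<subseteq> star (Q k)" by (rule Qmono) simp
        finally show ?thesis by blast
      qed
      have QQ: "(star (Q (Suc j)) - star (Q j)) \<inter> (star (Q (Suc k)) - star (Q k)) = {}" if "j < k" for j k
        using Qmono[of "Suc j" k] that by auto
      fix p p' assume p: "p \<in> I" "p' \<in> I" "p \<noteq> p'"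
      consider "p \<in> F" "p' \<in> F" | k where "p \<in> F" "p' = Q (Suc k)" | k where "p = Q (Suc k)" "p' \<in> F"
        | j k where "p = Q (Suc j)" "p' = Q (Suc k)" using p by (auto simp: I_def)
      then show "E' p \<inter> E' p' = {}"
      proof cases
        case 1 then show ?thesis using dis p(3) by (simp add: E'F)
      next
        case 2 then show ?thesis using FQ by (simp add: E'F E'Q)
      next
        case 3 then show ?thesis using FQ by (simp add: E'F E'Q Int_commute)
      next
        case 4
        then have "j < k \<or> k < j" using p(3) by (metis linorder_neqE_nat)
        then show ?thesis using QQ[of j k] QQ[of k j] by (auto simp: 4 E'Q)
      qed
    qed
    \<comment> \<open>\<open>f\<close> vanishes off \<open>S\<close> only almost everywhere, while
      the kernel formula is stated for functions that vanish at every point outside;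
      \<open>f'\<close> is the corrected representative.\<close>
    define f' where "f' = cutoff S f"
    have Sm: "S \<in> sets lebesgue" using S by (simp add: compact_imp_closed)
    have adm': "admissible b1 b2 f'" unfolding f'_def by (rule admissible_cutoff[OF adm Sm])
    have ff': "AE x in lebesgue. f x = f' x" using f0 by eventually_elim (simp add: f'_def cutoff_def)
    have admQ: "admissible b1 b2 (cutoff (star (Q 0)) f)" by (rule admissible_cutoff[OF adm]) simp
    have fQ: "AE x in lebesgue. f x = cutoff (star (Q 0)) f x" using f0 by eventually_elim (use SQ[of 0] in \<open>auto simp: cutoff_def\<close>)
    have eq1: "AE x in lebesgue. comm2 b1 b2 f x = comm2 b1 b2 (cutoff (star (Q 0)) f) x"
      by (rule commutator_cong_AE[OF adm admQ fQ])
    have eq2: "AE x in lebesgue. comm2 b1 b2 f x = comm2 b1 b2 f' x" by (rule commutator_cong_AE[OF adm adm' ff'])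
    have terms: "sparse_term b1 b2 f' R x = sparse_term b1 b2 f R x" if R: "R \<in> sets lebesgue" for R x
    proof -
      have "avg R (\<lambda>y. norm (centred b1 b2 c1 c2 f' i y)) = avg R (\<lambda>y. norm (centred b1 b2 c1 c2 f i y))" for c1 c2 i
      proof -
        have "(LINT y|lebesgue. cutoff R (\<lambda>y. norm (centred b1 b2 c1 c2 f' i y)) y) = (LINT y|lebesgue. cutoff R (\<lambda>y. norm (centred b1 b2 c1 c2 f i y)) y)"
        proof (rule integral_cong_AE)
          show "cutoff R (\<lambda>y. norm (centred b1 b2 c1 c2 f' i y)) \<in> borel_measurable lebesgue"
            "cutoff R (\<lambda>y. norm (centred b1 b2 c1 c2 f i y)) \<in> borel_measurable lebesgue"
            using R integrable_centred[OF adm] integrable_centred[OF adm']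
            by (auto intro!: borel_measurable_integrable integrable_cutoff integrable_norm)
          show "AE y in lebesgue. cutoff R (\<lambda>y. norm (centred b1 b2 c1 c2 f' i y)) y = cutoff R (\<lambda>y. norm (centred b1 b2 c1 c2 f i y)) y"
            using ff' by eventually_elim (simp add: cutoff_def centred_def)
        qed
        then show ?thesis by (simp add: avg_eq_cutoff)
      qed
      then show ?thesis by (simp add: sparse_term_def)
    qed
    have farQ: "AE x in lebesgue. \<forall>k. x \<in> star (Q (Suc k)) \<longrightarrow> (\<forall>y\<in>S. N ^ k * L / 2 \<le> dist x y) \<longrightarrow>
        norm (comm2 b1 b2 f' x) \<le> D * sparse_term b1 b2 f' (star (Q (Suc k))) x"
      unfolding AE_all_countable
    proof
      fix k
      show "AE x in lebesgue. x \<in> star (Q (Suc k)) \<longrightarrow> (\<forall>y\<in>S. N ^ k * L / 2 \<le> dist x y) \<longrightarrow>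
        norm (comm2 b1 b2 f' x) \<le> D * sparse_term b1 b2 f' (star (Q (Suc k))) x"
      proof (rule D(2)[OF adm' compact_imp_closed[OF S]])
        show "f' y = 0" if "y \<notin> S" for y using that by (simp add: f'_def cutoff_def)
        show "0 < N ^ k * L / 2" using N L by simp
        show "snd (Q (Suc k)) \<le> 2 * (4 * real DIM('a) + 1) * (2 * (N ^ k * L / 2))"
          unfolding N_def[symmetric] sndQ by simp
      qed (use SQ Qpos in auto)
    qed
    have "AE x in lebesgue. \<exists>H. finite H \<and> H \<subseteq> I \<and> norm (comm2 b1 b2 f x) \<le> (\<Sum>p\<in>H. (C + D) * sparse_term b1 b2 f (star p) x)"
      using near farQ eq1 eq2
    proof eventually_elim
      case (elim x)
      have W0: "0 \<le> sparse_term b1 b2 f R x" for R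
        unfolding sparse_term_def by (intro sum_nonneg mult_nonneg_nonneg weight_nonneg avg_nonneg) auto
      show ?case
      proof (cases "x \<in> hcube (Q 0)")
        case True
        then obtain H where H: "finite H" "H \<subseteq> F"
          "norm (comm2 b1 b2 (cutoff (star (Q 0)) f) x) \<le> (\<Sum>p\<in>H. C * sparse_term b1 b2 f (star p) x)" using elim(1) by blast
        have "(\<Sum>p\<in>H. C * sparse_term b1 b2 f (star p) x) \<le> (\<Sum>p\<in>H. (C + D) * sparse_term b1 b2 f (star p) x)"
          using D(1) W0 by (intro sum_mono mult_right_mono) auto
        then show ?thesis using H elim(3) by (intro exI[of _ H]) (auto simp: I_def)
      next
        case False
        then obtain i0 where i0: "i0 \<in> Basis" "L \<le> \<bar>x \<bullet> i0\<bar>"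
          using notin_hcube_centred_cube[of x "N ^ 0 * L"] by (auto simp: Q_def)
        have "\<exists>k. x \<in> star (Q (Suc k))"
        proof -
          obtain n where n: "norm x / L < N ^ n" using real_arch_pow[of N] N5 by auto
          have "norm x \<le> N ^ n * L" using n L by (simp add: divide_less_eq less_imp_le)
          also have "\<dots> \<le> N ^ Suc (Suc n) * L" by (rule Nmono) simp
          finally show ?thesis unfolding memQ using Basis_le_norm order_trans by blast
        qed
        \<comment> \<open>The first dilate \<open>star (Q (Suc k))\<close> that contains
          \<open>x\<close>. Some coordinate of \<open>x\<close> is then at least
          \<open>N ^ k * L\<close> in absolute value: for \<open>k = 0\<close> because
          \<open>x\<close> is outside \<open>hcube (Q 0)\<close>, otherwise because \<open>x\<close>
          is outside the preceding dilate.\<close>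
        then obtain k where k: "x \<in> star (Q (Suc k))" "\<forall>j<k. x \<notin> star (Q (Suc j))"
          using exists_least_iff[of "\<lambda>k. x \<in> star (Q (Suc k))"] by blast
        have "\<exists>i\<in>Basis. N ^ k * L \<le> \<bar>x \<bullet> i\<bar>"
        proof (cases k)
          case 0
          then show ?thesis using i0 by auto
        next
          case (Suc j)
          then have "x \<notin> star (Q (Suc j))" using k(2) by blast
          then obtain i where i: "i \<in> Basis" "N ^ Suc (Suc j) * L < \<bar>x \<bullet> i\<bar>" unfolding memQ by (auto simp: not_le)
          then have "N ^ k * L \<le> \<bar>x \<bullet> i\<bar>" using Nmono[of k "Suc (Suc j)"] Suc by simp
          then show ?thesis using i(1) by blast
        qed
        then obtain i where i: "i \<in> Basis" "N ^ k * L \<le> \<bar>x \<bullet> i\<bar>" by blast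
        have "N ^ k * L / 2 \<le> dist x y" if y: "y \<in> S" for y
        proof -
          have "\<bar>y \<bullet> i\<bar> \<le> L / 2" using SL[OF y i(1)] .
          moreover have "L \<le> N ^ k * L" using Nmono[of 0 k] by simp
          ultimately have "N ^ k * L / 2 \<le> \<bar>x \<bullet> i - y \<bullet> i\<bar>" using i(2) by linarith
          also have "\<dots> \<le> dist x y" unfolding dist_norm inner_diff_left[symmetric] by (rule Basis_le_norm[OF i(1)])
          finally show ?thesis .
        qed
        then have "norm (comm2 b1 b2 f x) \<le> D * sparse_term b1 b2 f (star (Q (Suc k))) x"
          using elim(2,4) k(1) by (simp add: terms)
        also have "\<dots> \<le> (C + D) * sparse_term b1 b2 f (star (Q (Suc k))) x"
          using C(1) W0 by (intro mult_right_mono) auto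
        finally show ?thesis by (intro exI[of _ "{Q (Suc k)}"]) (auto simp: I_def)
      qed
    qed
    then have dom: "AE x in lebesgue. ennreal (norm (comm2 b1 b2 f x))
        \<le> ennreal (C + D) * (S1 (star ` I) b1 b2 f x + S2 (star ` I) b1 b2 f x + S3 (star ` I) b1 b2 f x + S4 (star ` I) b1 b2 f x)"
    proof eventually_elim
      case (elim x)
      then obtain H where H: "finite H" "H \<subseteq> I" "norm (comm2 b1 b2 f x) \<le> (\<Sum>p\<in>H. (C + D) * sparse_term b1 b2 f (star p) x)" by blast
      have W0: "0 \<le> sparse_term b1 b2 f R x" for R
        unfolding sparse_term_def by (intro sum_nonneg mult_nonneg_nonneg weight_nonneg avg_nonneg) auto
      have "ennreal (norm (comm2 b1 b2 f x)) \<le> ennreal ((C + D) * (\<Sum>p\<in>H. sparse_term b1 b2 f (star p) x))"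
        using H(3) by (intro ennreal_leI) (simp add: sum_distrib_left)
      also have "\<dots> = ennreal (C + D) * ennreal (\<Sum>p\<in>H. sparse_term b1 b2 f (star p) x)"
        using C(1) D(1) by (intro ennreal_mult') simp
      also have "ennreal (\<Sum>p\<in>H. sparse_term b1 b2 f (star p) x) = (\<Sum>p\<in>H. ennreal (sparse_term b1 b2 f (star p) x))"
        using W0 by (intro sum_ennreal[symmetric])
      \<comment> \<open>The sparse operators count each set once; as \<open>star\<close> is
        injective on \<open>I\<close>, the sum over codes has no repetitions either.\<close>
      also have "\<dots> = (\<Sum>R\<in>star ` H. ennreal (sparse_term b1 b2 f R x))"
        using inj_on_subset[OF inj H(2)] by (simp add: sum.reindex)
      also have "ennreal (C + D) * \<dots> \<le> ennreal (C + D) * (S1 (star ` I) b1 b2 f x + S2 (star ` I) b1 b2 f x + S3 (star ` I) b1 b2 f x + S4 (star ` I) b1 b2 f x)"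
        using H by (intro mult_left_mono sum_sparse_term_le) auto
      finally show ?case .
    qed
    show ?case
      using sparse dom is_cube_star Ipos unfolding N_def by (intro exI[of _ "star ` I"] conjI) auto
  qed
  qed
qed

end

theorem theorem3p5:
  shows "\<exists>\<gamma>::real. 0 < \<gamma> \<and> \<gamma> < 1 \<and>
    (\<forall>(T :: ('a::euclidean_space \<Rightarrow> complex) \<Rightarrow> 'a \<Rightarrow> complex) K \<omega>.
       CZ_omega_Dini T K \<omega> \<and> L1_extension T \<longrightarrow>
       (\<exists>CT::real. CT > 0 \<and>
         (\<forall>f b1 b2. L1c f \<and> loc_int b1 \<and> loc_int b2 \<and> loc_int (\<lambda>x. b1 x * b2 x)
            \<and> loc_int (\<lambda>x. b1 x * f x) \<and> loc_int (\<lambda>x. b2 x * f x)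
            \<and> loc_int (\<lambda>x. b1 x * b2 x * f x) \<longrightarrow>
            (\<exists>\<S>. (\<forall>Q\<in>\<S>. is_cube Q) \<and> sparse \<gamma> \<S> \<and>
               (AE x in lebesgue.
                  ennreal (norm (mult_comm b2 (mult_comm b1 T) f x))
                    \<le> ennreal CT * (S1 \<S> b1 b2 f x + S2 \<S> b1 b2 f x
                                   + S3 \<S> b1 b2 f x + S4 \<S> b1 b2 f x))))))"
proof (rule exI[of _ "1 / (4 * (4 * real DIM('a) + 1) ^ DIM('a))"], intro conjI allI impI)
  have one: "1 \<le> (4 * real DIM('a) + 1) ^ DIM('a)" by (rule one_le_power) simp
  then show "0 < 1 / (4 * (4 * real DIM('a) + 1) ^ DIM('a))" by simp
  have "1 < 4 * (4 * real DIM('a) + 1) ^ DIM('a)" using one by linarith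
  then show "1 / (4 * (4 * real DIM('a) + 1) ^ DIM('a)) < 1" by simp
  fix T :: "('a \<Rightarrow> complex) \<Rightarrow> 'a \<Rightarrow> complex" and K \<omega>
  assume "CZ_omega_Dini T K \<omega> \<and> L1_extension T"
  then interpret cz_operator T K \<omega> by unfold_locales blast+
  show "\<exists>CT::real. CT > 0 \<and>
         (\<forall>f b1 b2. L1c f \<and> loc_int b1 \<and> loc_int b2 \<and> loc_int (\<lambda>x. b1 x * b2 x)
            \<and> loc_int (\<lambda>x. b1 x * f x) \<and> loc_int (\<lambda>x. b2 x * f x)
            \<and> loc_int (\<lambda>x. b1 x * b2 x * f x) \<longrightarrow>
            (\<exists>\<S>. (\<forall>Q\<in>\<S>. is_cube Q) \<and> sparse (1 / (4 * (4 * real DIM('a) + 1) ^ DIM('a))) \<S> \<and>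
               (AE x in lebesgue.
                  ennreal (norm (mult_comm b2 (mult_comm b1 T) f x))
                    \<le> ennreal CT * (S1 \<S> b1 b2 f x + S2 \<S> b1 b2 f x
                                   + S3 \<S> b1 b2 f x + S4 \<S> b1 b2 f x))))"
    by (rule commutator_sparse) blast
qed

end
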